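(* Let $\lambda>0$ and $\alpha,\gamma\ge0$. Consider the weight-dependent random connection model in dimension $d=2$ with vertex intensity $\lambda$, interpolation kernel $g(s,t)=(s\wedge t)^\gamma(s\vee t)^\alpha$, and a non-increasing profile function $\rho:(0,\infty)\to[0,1]$ satisfying $\rho(x)\asymp 1\wedge x^{-\delta}$. If $$\delta>2,\qquad \gamma<1-\frac1\delta,\qquad \alpha<1-\gamma,$$ then almost surely every connected component is recurrent.
   Context: The weight-dependent random connection model (WDRCM) in dimension $d$ with profile $\rho:(0,\infty)\to[0,1]$ and kernel $g:(0,1)^2\to(0,\infty)$ is the following random graph. The vertex set $V$ is a homogeneous Poisson point process on $\mathbb{R}^d$ of intensity $\lambda>0$. Conditionally on $V$, the vertices $v\in V$ carry i.i.d. marks $u_v$ uniformly distributed on $(0,1)$. Given the vertices and marks, each pair of distinct vertices $v,w$ is connected by an edge with probability $\rho\big(g(u_v,u_w)\,|v-w|^d\big)$, independently of all other pairs, where $|\cdot|$ is the Euclidean norm. Here $d=2$. The notation $\rho(x)\asymp 1\wedge x^{-\delta}$ means that there are constants $0<c\le C<\infty$ with $c(1\wedge x^{-\delta})\le\rho(x)\le C(1\wedge x^{-\delta})$ for all $x>0$. Graphs are regarded as electrical networks with unit conductances. A connected component is recurrent if the effective resistance from one (equivalently every) vertex of that component to infinity is infinite (equivalently, simple random walk on it is recurrent); finite components are recurrent by convention. *)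

theory Defs
  imports "HOL-Probability.Probability"
begin

section \<open>Graphs as electrical networks with unit conductances\<close>

text \<open>
  A simple graph is given by its vertex set and its symmetric, irreflexive edge relation \<open>E\<close>.
  The neighbours of \<open>x\<close> are \<open>E `` {x}\<close>, the connected component of \<open>x\<close> is \<open>E\<^sup>* `` {x}\<close>.
\<close>

definition connected_components :: "'v set \<Rightarrow> ('v \<times> 'v) set \<Rightarrow> 'v set set" where
  "connected_components V E = V // E\<^sup>*"

text \<open>
  The voltages \<open>h\<close> when a unit current enters the network at \<open>v\<close> and all vertices outside the
  finite set \<open>K\<close> are grounded: by Ohm's law the current from \<open>x\<close> to a neighbour \<open>y\<close> is
  \<open>h x - h y\<close>, so the second clause is Kirchhoff's node law.
\<close>

definition unit_current_voltage :: "('v \<times> 'v) set \<Rightarrow> 'v \<Rightarrow> 'v set \<Rightarrow> ('v \<Rightarrow> real) \<Rightarrow> bool" where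
  "unit_current_voltage E v K h \<longleftrightarrow>
     (\<forall>x. x \<notin> K \<longrightarrow> h x = 0) \<and>
     (\<forall>x\<in>K. (\<Sum>y\<in>E `` {x}. h x - h y) = (if x = v then 1 else 0))"

text \<open>
  The effective resistance between \<open>v\<close> and the complement of \<open>K\<close> is the potential difference
  that drives a unit current. The voltage function exists and is unique if \<open>K\<close> is a finite subset
  of an infinite, locally finite connected component.
\<close>

definition effective_resistance :: "('v \<times> 'v) set \<Rightarrow> 'v \<Rightarrow> 'v set \<Rightarrow> real" where
  "effective_resistance E v K = (THE h. unit_current_voltage E v K h) v"

text \<open>
  The limit is along all finite subsets of the component of \<open>v\<close>, directed by inclusion; it exists
  by Rayleigh monotonicity and agrees with the limit along any exhaustion by finite sets.
\<close>

definition effective_resistance_to_infinity :: "('v \<times> 'v) set \<Rightarrow> 'v \<Rightarrow> ereal" where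
  "effective_resistance_to_infinity E v =
     Lim (finite_subsets_at_top (E\<^sup>* `` {v})) (\<lambda>K. ereal (effective_resistance E v K))"

text \<open>
  The voltages above only make sense in a locally finite component. A vertex of infinite degree has
  effective resistance 0 to infinity, so that a component containing one is not recurrent.
\<close>

definition recurrent_component :: "('v \<times> 'v) set \<Rightarrow> 'v set \<Rightarrow> bool" where
  "recurrent_component E C \<longleftrightarrow>
     finite C \<or>
     ((\<forall>v\<in>C. finite (E `` {v})) \<and> (\<forall>v\<in>C. effective_resistance_to_infinity E v = \<infinity>))"

section \<open>The weight-dependent random connection model\<close>

text \<open>
  Homogeneous Poisson point processes of intensity \<open>lam\<close>, as random locally finite sets. The law
  of the counts is written out because \<^const>\<open>poisson_pmf\<close> excludes the rate 0, which
  occurs for null sets \<open>B\<close>.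
\<close>

definition poisson_point_process ::
    "'w measure \<Rightarrow> real \<Rightarrow> ('w \<Rightarrow> 'a::euclidean_space set) \<Rightarrow> bool" where
  "poisson_point_process M lam V \<longleftrightarrow>
     (AE \<omega> in M. \<forall>B. bounded B \<longrightarrow> finite (V \<omega> \<inter> B)) \<and>
     (\<forall>B\<in>sets borel. bounded B \<longrightarrow>
        (\<lambda>\<omega>. card (V \<omega> \<inter> B)) \<in> measurable M (count_space UNIV) \<and>
        (\<forall>k. measure M {\<omega> \<in> space M. card (V \<omega> \<inter> B) = k} =
               exp (- (lam * measure lborel B)) * (lam * measure lborel B) ^ k / fact k)) \<and>
     (\<forall>B :: nat \<Rightarrow> 'a set. (\<forall>i. B i \<in> sets borel \<and> bounded (B i)) \<and> disjoint_family B \<longrightarrow>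
        prob_space.indep_vars M (\<lambda>_. count_space UNIV) (\<lambda>i \<omega>. card (V \<omega> \<inter> B i)) UNIV)"

text \<open>
  \<open>V \<omega>\<close> is the vertex set, \<open>u \<omega> x\<close> the mark of the vertex \<open>x\<close> and \<open>E \<omega>\<close> the edge relation. To speak
  about the individual marks and edges, the (almost surely countably infinite) vertex set is
  enumerated measurably by \<open>X\<close>.
\<close>

definition vertex_enumeration ::
    "'w measure \<Rightarrow> ('w \<Rightarrow> 'a::euclidean_space set) \<Rightarrow> (nat \<Rightarrow> 'w \<Rightarrow> 'a) \<Rightarrow> bool" where
  "vertex_enumeration M V X \<longleftrightarrow>
     (\<forall>n. X n \<in> borel_measurable M) \<and> (AE \<omega> in M. bij_betw (\<lambda>n. X n \<omega>) UNIV (V \<omega>))"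

definition iid_uniform_marks ::
    "'w measure \<Rightarrow> (nat \<Rightarrow> 'w \<Rightarrow> 'a::euclidean_space) \<Rightarrow> ('w \<Rightarrow> 'a \<Rightarrow> real) \<Rightarrow> bool" where
  "iid_uniform_marks M X u \<longleftrightarrow>
     (\<forall>n. distr M borel (\<lambda>\<omega>. u \<omega> (X n \<omega>)) = uniform_measure lborel {0<..<1}) \<and>
     prob_space.indep_vars M (\<lambda>_. borel) (\<lambda>n \<omega>. u \<omega> (X n \<omega>)) UNIV \<and>
     prob_space.indep_set M
       (sets (vimage_algebra (space M) (\<lambda>\<omega> n. X n \<omega>) (Pi\<^sub>M UNIV (\<lambda>_. borel))))
       (sets (vimage_algebra (space M) (\<lambda>\<omega> n. u \<omega> (X n \<omega>)) (Pi\<^sub>M UNIV (\<lambda>_. borel))))"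

definition vertices_and_marks ::
    "'w measure \<Rightarrow> (nat \<Rightarrow> 'w \<Rightarrow> 'a::euclidean_space) \<Rightarrow> ('w \<Rightarrow> 'a \<Rightarrow> real) \<Rightarrow> 'w measure" where
  "vertices_and_marks M X u =
     vimage_algebra (space M) (\<lambda>\<omega> n. (X n \<omega>, u \<omega> (X n \<omega>))) (Pi\<^sub>M UNIV (\<lambda>_. borel))"

definition connection_probability ::
    "(real \<Rightarrow> real) \<Rightarrow> (real \<Rightarrow> real \<Rightarrow> real) \<Rightarrow> ('a::euclidean_space \<Rightarrow> real) \<Rightarrow> 'a \<Rightarrow> 'a \<Rightarrow> real" where
  "connection_probability \<rho> g u v w = \<rho> (g (u v) (u w) * norm (v - w) ^ DIM('a))"

text \<open>
  The joint law of finitely many edge indicators, given the vertices and marks: \<open>A\<close> is a finite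
  set of (unordered) pairs of vertex indices and \<open>S\<close> the prescribed subset of those that are edges.
\<close>

definition independent_edges ::
    "'w measure \<Rightarrow> (real \<Rightarrow> real) \<Rightarrow> (real \<Rightarrow> real \<Rightarrow> real) \<Rightarrow> (nat \<Rightarrow> 'w \<Rightarrow> 'a::euclidean_space) \<Rightarrow>
     ('w \<Rightarrow> 'a \<Rightarrow> real) \<Rightarrow> ('w \<Rightarrow> ('a \<times> 'a) set) \<Rightarrow> bool" where
  "independent_edges M \<rho> g X u E \<longleftrightarrow>
     (\<forall>i j. i < j \<longrightarrow> {\<omega> \<in> space M. (X i \<omega>, X j \<omega>) \<in> E \<omega>} \<in> sets M) \<and>
     (\<forall>A S. finite A \<and> A \<subseteq> {(i, j). i < j} \<and> S \<subseteq> A \<longrightarrow>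
        (AE \<omega> in M.
           real_cond_exp M (vertices_and_marks M X u)
             (indicator {\<omega> \<in> space M. \<forall>(i, j)\<in>A. (X i \<omega>, X j \<omega>) \<in> E \<omega> \<longleftrightarrow> (i, j) \<in> S}) \<omega> =
           (\<Prod>(i, j)\<in>A. let p = connection_probability \<rho> g (u \<omega>) (X i \<omega>) (X j \<omega>)
                         in if (i, j) \<in> S then p else 1 - p)))"

text \<open>The dimension \<open>d\<close> is \<open>DIM('a)\<close>.\<close>

locale wdrcm = prob_space M
  for M :: "'w measure"
    and lam :: real
    and \<rho> :: "real \<Rightarrow> real"
    and g :: "real \<Rightarrow> real \<Rightarrow> real"
    and V :: "'w \<Rightarrow> 'a::euclidean_space set"
    and u :: "'w \<Rightarrow> 'a \<Rightarrow> real"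
    and E :: "'w \<Rightarrow> ('a \<times> 'a) set" +
  assumes poisson_vertices: "poisson_point_process M lam V"
    and simple_graph: "AE \<omega> in M. E \<omega> \<subseteq> V \<omega> \<times> V \<omega> \<and> sym (E \<omega>) \<and> irrefl (E \<omega>)"
    and marks_and_edges:
      "\<exists>X. vertex_enumeration M V X \<and> iid_uniform_marks M X u \<and> independent_edges M \<rho> g X u E"

definition interpolation_kernel :: "real \<Rightarrow> real \<Rightarrow> real \<Rightarrow> real \<Rightarrow> real" where
  "interpolation_kernel \<gamma> \<alpha> s t = min s t powr \<gamma> * max s t powr \<alpha>"

definition polynomial_profile :: "(real \<Rightarrow> real) \<Rightarrow> real \<Rightarrow> bool" where
  "polynomial_profile \<rho> \<delta> \<longleftrightarrow>
     (\<exists>c C. 0 < c \<and> c \<le> C \<and>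
       (\<forall>x>0. c * min 1 (x powr - \<delta>) \<le> \<rho> x \<and> \<rho> x \<le> C * min 1 (x powr - \<delta>)))"

end

theory Submission
  imports Defs "HOL-Real_Asymp.Real_Asymp"
begin

text \<open>
  A locally finite graph is recurrent as soon as, for every finite set of vertices, there is a
  finitely supported function equal to 1 on that set with energy below a fixed constant: averaging
  two such functions with disjoint gradients halves the energy. To find these functions, a vertex
  with mark \<open>t\<close> is given the radius \<open>t powr (-1/\<sigma>)\<close> for some \<open>\<sigma> > 2\<close>, slightly larger than the
  typical length of its edges, and the plane, divided into unit cells, is equipped with the pseudometric
  in which cells closer than the radius of one of them are identified. The truncated distance from a
  box is constant along the short edges of hubs, and the remaining edges have finite mean squared
  length under the assumptions on \<open>\<alpha>\<close>, \<open>\<gamma>\<close> and \<open>\<delta>\<close>; so, by Fatou's lemma, its energy stays bounded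
  along infinitely many scales. As \<open>\<sigma> > 2\<close>, the hubs are sparse, and a renormalization argument shows
  that crossing a large box in this pseudometric is still as expensive as in the plane, up to a
  constant factor.
\<close>

section \<open>Networks with functions of small energy\<close>

text \<open>Shortcuts are needed because the plain truncated distance can fail: for marks s < t, the
  squared length of an edge, integrated over the plane, is of order
  \<open>(s powr \<gamma> * t powr \<alpha>) powr -2\<close>, which is not integrable at s = 0 once
  \<gamma> is at least 1/2. Discarding the edges shorter than the radius
  \<open>s powr (-1/\<sigma>)\<close> leaves distances D with s * D^\<sigma> > 1, so the connection
  probability may be multiplied by (s * D^\<sigma>)^\<theta>. This gains the power \<theta> in s and
  loses \<sigma> * \<theta> in D. Squared lengths are summable over the plane if 2 * \<delta> -
  \<sigma> * \<theta> > 4, which some \<sigma> > 2 allows iff \<theta> < \<delta> - 2; integrability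
  in the marks asks for \<theta> > \<gamma> * \<delta> - 1 and \<theta> > (\<gamma> + \<alpha>) *
  \<delta> - 2. Such a \<theta> >= 0 exists exactly under the three hypotheses on the
  exponents.\<close>

lemma linear_system_solvable:
  fixes A :: "'a \<Rightarrow> 'b \<Rightarrow> real"
  assumes "finite I" "finite J" "card I = card J"
    and "\<And>h. \<forall>i\<in>I. (\<Sum>j\<in>J. A i j * h j) = 0 \<Longrightarrow> \<forall>j\<in>J. h j = 0"
  shows "\<exists>h. \<forall>i\<in>I. (\<Sum>j\<in>J. A i j * h j) = b i"
  using assms
proof (induction "card J" arbitrary: I J A b)
  case 0
  then show ?case by simp
next
  case (Suc n)
  then obtain z where z: "z \<in> J" by (metis card.empty equals0I nat.distinct(1))
  \<comment> \<open>A zero column would put the indicator of \<open>z\<close> into the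
    kernel.\<close>
  have "\<exists>i\<in>I. A i z \<noteq> 0"
  proof (rule ccontr)
    assume "\<not> ?thesis"
    then have "\<forall>i\<in>I. (\<Sum>j\<in>J. A i j * (if j = z then 1 else 0)) = 0"
      using Suc.prems z by (simp add: if_distrib sum.delta cong: if_cong)
    from Suc.prems(4)[OF this] z show False by auto
  qed
  then obtain k where k: "k \<in> I" "A k z \<noteq> 0" by blast
  \<comment> \<open>Gaussian elimination with the pivot \<open>A k z\<close>: row \<open>k\<close>
    and column \<open>z\<close> are removed.\<close>
  define A' where "A' i j = A i j - A i z / A k z * A k j" for i j
  define b' where "b' i = b i - A i z / A k z * b k" for i
  have split: "(\<Sum>j\<in>J. A i j * h j) = A i z * h z + (\<Sum>j\<in>J - {z}. A i j * h j)" for i h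
    using z Suc.prems by (simp add: sum.remove)
  have A'sum: "(\<Sum>j\<in>J - {z}. A' i j * h j) =
      (\<Sum>j\<in>J - {z}. A i j * h j) - A i z / A k z * (\<Sum>j\<in>J - {z}. A k j * h j)" for i h
    by (simp add: A'_def left_diff_distrib sum_subtractf sum_distrib_left mult.assoc)
  \<comment> \<open>\<open>ext h c\<close> recovers the eliminated unknown so that row
    \<open>k\<close> takes the value \<open>c\<close>: with \<open>c = 0\<close> the trivial kernel
    passes to the smaller system, with \<open>c = b k\<close> its solution is lifted.\<close>
  define ext where "ext h c j = (if j = z then (c - (\<Sum>j\<in>J - {z}. A k j * h j)) / A k z else h j)"
    for h c j
  have ext_sum: "(\<Sum>j\<in>J - {z}. A i j * ext h c j) = (\<Sum>j\<in>J - {z}. A i j * h j)" for i h c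
    by (rule sum.cong) (auto simp: ext_def)
  have ext: "(\<Sum>j\<in>J. A i j * ext h c j) =
      A i z / A k z * c + (\<Sum>j\<in>J - {z}. A' i j * h j)" for i h c
    using k unfolding split ext_sum A'sum by (simp add: ext_def field_simps)
  have A'k: "A' k j = 0" for j using k by (simp add: A'_def)
  have "\<exists>h. \<forall>i\<in>I - {k}. (\<Sum>j\<in>J - {z}. A' i j * h j) = b' i"
  proof (rule Suc.hyps)
    show "n = card (J - {z})" "card (I - {k}) = card (J - {z})"
      using Suc z k by simp_all
    fix h assume h: "\<forall>i\<in>I - {k}. (\<Sum>j\<in>J - {z}. A' i j * h j) = 0"
    have "\<forall>i\<in>I. (\<Sum>j\<in>J. A i j * ext h 0 j) = 0"
    proof
      fix i assume "i \<in> I"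
      then show "(\<Sum>j\<in>J. A i j * ext h 0 j) = 0"
        unfolding ext using h A'k by (cases "i = k") auto
    qed
    from Suc.prems(4)[OF this] show "\<forall>j\<in>J - {z}. h j = 0"
      by (metis DiffE ext_def singletonI)
  qed (use Suc.prems in auto)
  then obtain h where h: "\<forall>i\<in>I - {k}. (\<Sum>j\<in>J - {z}. A' i j * h j) = b' i" by blast
  have "(\<Sum>j\<in>J. A i j * ext h (b k) j) = b i" if "i \<in> I" for i
  proof (cases "i = k")
    case True
    then show ?thesis unfolding ext using k A'k by simp
  next
    case False
    then show ?thesis unfolding ext using h that by (simp add: b'_def)
  qed
  then show ?case by blast
qed

section \<open>Green's identity and grounded voltages\<close>

definition boundary_edges :: "('v \<times> 'v) set \<Rightarrow> 'v set \<Rightarrow> ('v \<times> 'v) set" where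
  "boundary_edges E K = {(x, y) \<in> E. x \<in> K \<or> y \<in> K}"

lemma finite_boundary_edges:
  assumes "sym E" "finite K" "\<And>x. x \<in> K \<Longrightarrow> finite (E `` {x})"
  shows "finite (boundary_edges E K)"
proof -
  have "boundary_edges E K \<subseteq> (SIGMA x:K. E `` {x}) \<union> (SIGMA x:K. E `` {x})\<inverse>"
    using assms(1) by (auto simp: boundary_edges_def sym_def)
  moreover have "finite (SIGMA x:K. E `` {x})" using assms by auto
  ultimately show ?thesis by (meson finite_UnI finite_converse finite_subset)
qed

text \<open>Summation by parts. Edges are ordered pairs, so every undirected edge occurs in both
  orientations; adding the sum to its reversed copy produces the product of the two differences and
  the factor 2. Vanishing off \<open>K\<close> is asked of \<open>f\<close> alone, so that
  \<open>f\<close> can be a test function or the voltage itself.\<close>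

lemma green_identity:
  fixes f h :: "'v \<Rightarrow> real"
  assumes E: "sym E" "finite K" "\<And>x. x \<in> K \<Longrightarrow> finite (E `` {x})"
    and f: "\<And>x. x \<notin> K \<Longrightarrow> f x = 0"
  shows "2 * (\<Sum>x\<in>K. f x * (\<Sum>y\<in>E `` {x}. h x - h y)) =
    (\<Sum>(x, y)\<in>boundary_edges E K. (f x - f y) * (h x - h y))"
proof -
  let ?P = "boundary_edges E K"
  have fin: "finite ?P" by (rule finite_boundary_edges[OF E])
  have eq1: "(\<Sum>x\<in>K. f x * (\<Sum>y\<in>E `` {x}. h x - h y)) = (\<Sum>(x, y)\<in>?P. f x * (h x - h y))"
  proof -
    have "(\<Sum>x\<in>K. f x * (\<Sum>y\<in>E `` {x}. h x - h y)) =
        (\<Sum>(x, y)\<in>(SIGMA x:K. E `` {x}). f x * (h x - h y))"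
      using E by (simp add: sum_distrib_left sum.Sigma)
    also have "\<dots> = (\<Sum>(x, y)\<in>?P. f x * (h x - h y))"
      using f by (intro sum.mono_neutral_left[OF fin]) (force simp: boundary_edges_def)+
    finally show ?thesis .
  qed
  have bij: "bij_betw prod.swap ?P ?P"
    using E(1) by (intro bij_betwI[where g = prod.swap]) (auto simp: boundary_edges_def sym_def)
  have eq2: "(\<Sum>(x, y)\<in>?P. f y * (h y - h x)) = (\<Sum>(x, y)\<in>?P. f x * (h x - h y))"
    using sum.reindex_bij_betw[OF bij, of "\<lambda>(x, y). f x * (h x - h y)"]
    by (simp add: case_prod_unfold)
  have "(\<Sum>(x, y)\<in>?P. (f x - f y) * (h x - h y)) =
      (\<Sum>(x, y)\<in>?P. f x * (h x - h y)) + (\<Sum>(x, y)\<in>?P. f y * (h y - h x))"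
    by (simp add: sum.distrib[symmetric] case_prod_unfold algebra_simps)
  then show ?thesis using eq1 eq2 by simp
qed

text \<open>With \<open>f = h\<close>, Green's identity makes the energy of \<open>h\<close> vanish,
  so \<open>h\<close> is constant on the component. The finite set \<open>K\<close> cannot exhaust
  an infinite component, hence the constant is 0.\<close>

lemma unit_current_voltage_zero:
  fixes h :: "'v \<Rightarrow> real"
  assumes E: "sym E" "finite K" "\<And>x. x \<in> K \<Longrightarrow> finite (E `` {x})"
    and inf: "K \<subseteq> E\<^sup>* `` {v}" "infinite (E\<^sup>* `` {v})"
    and h0: "\<And>x. x \<notin> K \<Longrightarrow> h x = 0"
    and hK: "\<And>x. x \<in> K \<Longrightarrow> (\<Sum>y\<in>E `` {x}. h x - h y) = 0"
  shows "h x = 0"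
proof (cases "x \<in> K")
  case True
  have fin: "finite (boundary_edges E K)" by (rule finite_boundary_edges[OF E])
  have "(\<Sum>(x, y)\<in>boundary_edges E K. (h x - h y) * (h x - h y)) = 0"
    using green_identity[OF E, of h h] h0 hK by simp
  then have zero: "h a = h b" if "(a, b) \<in> boundary_edges E K" for a b
    using that fin by (subst (asm) sum_nonneg_eq_0_iff) auto
  have step: "h a = h b" if "(a, b) \<in> E" for a b
    using zero[of a b] h0[of a] h0[of b] that by (cases "a \<in> K \<or> b \<in> K") (auto simp: boundary_edges_def)
  have conn: "h a = h b" if "(a, b) \<in> E\<^sup>*" for a b
    using that by induction (auto simp: step)
  obtain w where w: "w \<in> E\<^sup>* `` {v}" "w \<notin> K" using inf E(2) by (meson finite_subset subsetI)
  have "(v, w) \<in> E\<^sup>*" "(v, x) \<in> E\<^sup>*" using w True inf by auto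
  then have "h v = h w" "h v = h x" by (auto dest: conn)
  then show ?thesis using h0[OF w(2)] by simp
qed (use h0 in simp)

text \<open>The voltages solve a square linear system, so existence follows from the uniqueness in
  \<open>unit_current_voltage_zero\<close>.\<close>

lemma unit_current_voltage_ex1:
  assumes E: "sym E" "finite K" "\<And>x. x \<in> K \<Longrightarrow> finite (E `` {x})"
    and inf: "K \<subseteq> E\<^sup>* `` {v}" "infinite (E\<^sup>* `` {v})"
  shows "\<exists>!h. unit_current_voltage E v K h"
proof -
  \<comment> \<open>The graph Laplacian restricted to \<open>K\<close>; the degrees on the diagonal
    also count the edges that leave \<open>K\<close>.\<close>
  define A :: "'a \<Rightarrow> 'a \<Rightarrow> real" where
    "A x y = (if x = y then real (card (E `` {x})) else 0) - (if (x, y) \<in> E then 1 else 0)" for x y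
  have A: "(\<Sum>y\<in>K. A x y * h y) = (\<Sum>y\<in>E `` {x}. h x - h y)"
    if "x \<in> K" "\<And>x. x \<notin> K \<Longrightarrow> h x = 0" for x h
  proof -
    have "(\<Sum>y\<in>K. A x y * h y) =
        (\<Sum>y\<in>K. if x = y then real (card (E `` {x})) * h y else 0) - (\<Sum>y\<in>K. if (x, y) \<in> E then h y else 0)"
      unfolding sum_subtractf[symmetric] by (rule sum.cong) (auto simp: A_def algebra_simps)
    also have "(\<Sum>y\<in>K. if (x, y) \<in> E then h y else 0) = (\<Sum>y\<in>K \<inter> E `` {x}. h y)"
      using E(2) by (simp add: sum.inter_restrict Image_singleton)
    also have "\<dots> = (\<Sum>y\<in>E `` {x}. h y)"
      using E that by (intro sum.mono_neutral_left) auto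
    finally show ?thesis using that E by (simp add: sum_subtractf)
  qed
  have "\<exists>h. \<forall>x\<in>K. (\<Sum>y\<in>K. A x y * h y) = (if x = v then 1 else 0)"
  proof (rule linear_system_solvable)
    fix h assume h: "\<forall>x\<in>K. (\<Sum>y\<in>K. A x y * h y) = 0"
    define h' where "h' x = (if x \<in> K then h x else 0)" for x
    have "(\<Sum>y\<in>E `` {x}. h' x - h' y) = 0" if "x \<in> K" for x
    proof -
      have "(\<Sum>y\<in>K. A x y * h' y) = (\<Sum>y\<in>K. A x y * h y)"
        by (rule sum.cong) (auto simp: h'_def)
      then show ?thesis using A[of x h'] that h by (auto simp: h'_def)
    qed
    then have "h' x = 0" for x
      using unit_current_voltage_zero[OF E inf, of h'] by (auto simp: h'_def)
    then show "\<forall>x\<in>K. h x = 0" by (metis h'_def)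
  qed (use E in auto)
  then obtain h where h: "\<forall>x\<in>K. (\<Sum>y\<in>K. A x y * h y) = (if x = v then 1 else 0)" by blast
  define h' where "h' x = (if x \<in> K then h x else 0)" for x
  have "unit_current_voltage E v K h'"
    unfolding unit_current_voltage_def
  proof safe
    fix x assume x: "x \<in> K"
    have "(\<Sum>y\<in>K. A x y * h' y) = (\<Sum>y\<in>K. A x y * h y)"
      by (rule sum.cong) (auto simp: h'_def)
    then show "(\<Sum>y\<in>E `` {x}. h' x - h' y) = (if x = v then 1 else 0)"
      using A[of x h'] x h by (auto simp: h'_def)
  qed (auto simp: h'_def)
  moreover have "g = h" if g: "unit_current_voltage E v K g" and h: "unit_current_voltage E v K h" for g h
  proof
    fix x
    have "(\<lambda>x. g x - h x) x = 0"
    proof (rule unit_current_voltage_zero[OF E inf])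
      fix x assume "x \<in> K"
      then have "(\<Sum>y\<in>E `` {x}. g x - g y) = (\<Sum>y\<in>E `` {x}. h x - h y)"
        using g h by (simp add: unit_current_voltage_def)
      moreover have "(\<Sum>y\<in>E `` {x}. g x - h x - (g y - h y)) =
          (\<Sum>y\<in>E `` {x}. g x - g y) - (\<Sum>y\<in>E `` {x}. h x - h y)"
        by (simp add: sum_subtractf[symmetric] algebra_simps)
      ultimately show "(\<Sum>y\<in>E `` {x}. g x - h x - (g y - h y)) = 0" by simp
    qed (use g h in \<open>auto simp: unit_current_voltage_def\<close>)
    then show "g x = h x" by simp
  qed
  ultimately show ?thesis by blast
qed

text \<open>Quantifying over finite sets of edges gives meaning to the energy without summability.\<close>

definition dirichlet_le :: "('v \<times> 'v) set \<Rightarrow> ('v \<Rightarrow> real) \<Rightarrow> real \<Rightarrow> bool" where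
  "dirichlet_le E f c \<longleftrightarrow> (\<forall>P. finite P \<and> P \<subseteq> E \<longrightarrow> (\<Sum>(x, y)\<in>P. (f x - f y)\<^sup>2) \<le> c)"

text \<open>One half of Dirichlet's principle. Pairing the voltage \<open>h\<close> with
  \<open>f\<close> gives \<open>f v = 1\<close>, pairing it with itself gives \<open>h v\<close>,
  which is the resistance. As sums run over both orientations of an edge, Cauchy-Schwarz yields
  \<open>2 \<le> c * h v\<close>.\<close>

lemma effective_resistance_ge:
  fixes f :: "'v \<Rightarrow> real"
  assumes E: "sym E" "finite K" "\<And>x. x \<in> K \<Longrightarrow> finite (E `` {x})"
    and inf: "K \<subseteq> E\<^sup>* `` {v}" "infinite (E\<^sup>* `` {v})"
    and v: "v \<in> K" "f v = 1" and f: "\<And>x. x \<notin> K \<Longrightarrow> f x = 0"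
    and c: "dirichlet_le E f c" "c > 0"
  shows "effective_resistance E v K \<ge> 1 / c"
proof -
  let ?P = "boundary_edges E K"
  define h where "h = (THE h. unit_current_voltage E v K h)"
  have h: "unit_current_voltage E v K h"
    unfolding h_def by (rule theI'[OF unit_current_voltage_ex1[OF E inf]])
  have h0: "\<And>x. x \<notin> K \<Longrightarrow> h x = 0"
    and hK: "\<And>x. x \<in> K \<Longrightarrow> (\<Sum>y\<in>E `` {x}. h x - h y) = (if x = v then 1 else 0)"
    using h by (auto simp: unit_current_voltage_def)
  have flux: "(\<Sum>x\<in>K. g x * (\<Sum>y\<in>E `` {x}. h x - h y)) = g v" for g :: "'v \<Rightarrow> real"
  proof -
    have "(\<Sum>x\<in>K. g x * (\<Sum>y\<in>E `` {x}. h x - h y)) = (\<Sum>x\<in>K. if x = v then g x else 0)"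
      using hK by (intro sum.cong) auto
    then show ?thesis using E v by simp
  qed
  have fin: "finite ?P" by (rule finite_boundary_edges[OF E])
  have green_f: "2 * (\<Sum>x\<in>K. f x * (\<Sum>y\<in>E `` {x}. h x - h y)) =
      (\<Sum>(x, y)\<in>?P. (f x - f y) * (h x - h y))"
    by (intro green_identity E f)
  have green_h: "2 * (\<Sum>x\<in>K. h x * (\<Sum>y\<in>E `` {x}. h x - h y)) =
      (\<Sum>(x, y)\<in>?P. (h x - h y) * (h x - h y))"
    by (intro green_identity E h0)
  have "(\<Sum>(x, y)\<in>?P. (f x - f y) * (h x - h y)) = 2"
    using green_f flux[of f] v by simp
  moreover have hh: "(\<Sum>(x, y)\<in>?P. (h x - h y)\<^sup>2) = 2 * h v"
    using green_h flux[of h] by (simp add: power2_eq_square)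
  moreover have "(\<Sum>(x, y)\<in>?P. (f x - f y)\<^sup>2) \<le> c"
    using c(1) fin by (auto simp: dirichlet_le_def boundary_edges_def dest!: spec[of _ ?P])
  moreover have "(\<Sum>(x, y)\<in>?P. (f x - f y) * (h x - h y))\<^sup>2 \<le>
      (\<Sum>(x, y)\<in>?P. (f x - f y)\<^sup>2) * (\<Sum>(x, y)\<in>?P. (h x - h y)\<^sup>2)"
    using Cauchy_Schwarz_ineq_sum[of "\<lambda>(x, y). f x - f y" "\<lambda>(x, y). h x - h y" ?P]
    by (simp add: case_prod_unfold)
  moreover have "h v \<ge> 0"
  proof -
    have "0 \<le> (\<Sum>(x, y)\<in>?P. (h x - h y)\<^sup>2)" by (intro sum_nonneg) auto
    then show ?thesis using hh by simp
  qed
  ultimately have "4 \<le> c * (2 * h v)"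
    using mult_right_mono[of "\<Sum>(x, y)\<in>?P. (f x - f y)\<^sup>2" c "2 * h v"] by (simp add: mult.commute)
  then have "h v \<ge> 1 / c" using c(2) \<open>h v \<ge> 0\<close> by (simp add: field_simps)
  then show ?thesis unfolding effective_resistance_def h_def .
qed

text \<open>
  Averaging two functions whose gradients live on disjoint sets of edges halves the energy, so that
  bounded energy can be improved to arbitrarily small energy.
\<close>

lemma dirichlet_le_halve:
  fixes E :: "('v \<times> 'v) set"
  assumes E: "sym E" "\<And>x. finite (E `` {x})"
    and ex: "\<And>S. finite S \<Longrightarrow> \<exists>f. finite {x. f x \<noteq> 0} \<and> (\<forall>x\<in>S. f x = 1) \<and> dirichlet_le E f c"
    and S: "finite S"
  shows "\<exists>f. finite {x. f x \<noteq> 0} \<and> (\<forall>x\<in>S. f x = 1) \<and> dirichlet_le E f (c / 2)"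
proof -
  obtain f where f: "finite {x. f x \<noteq> 0}" "\<forall>x\<in>S. f x = 1" "dirichlet_le E f c"
    using ex[OF S] by blast
  \<comment> \<open>\<open>g\<close> is to equal 1 on the support of \<open>f\<close> and on its
    neighbours, that is, at both ends of every edge along which \<open>f\<close> varies.\<close>
  define S' where "S' = S \<union> {x. f x \<noteq> 0} \<union> (\<Union>x\<in>{x. f x \<noteq> 0}. E `` {x})"
  have "finite S'" using S f(1) E(2) by (auto simp: S'_def)
  from ex[OF this] obtain g
    where g: "finite {x. g x \<noteq> 0}" "\<forall>x\<in>S'. g x = 1" "dirichlet_le E g c" by blast
  define k where "k x = (f x + g x) / 2" for x
  have "finite {x. k x \<noteq> 0}"
    by (rule finite_subset[OF _ finite_UnI[OF f(1) g(1)]]) (auto simp: k_def)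
  moreover have "\<forall>x\<in>S. k x = 1" using f(2) g(2) by (auto simp: k_def S'_def)
  moreover have "dirichlet_le E k (c / 2)"
    unfolding dirichlet_le_def
  proof safe
    fix P :: "('v \<times> 'v) set" assume P: "finite P" "P \<subseteq> E"
    have disj: "f x = f y \<or> g x = g y" if "(x, y) \<in> E" for x y
    proof (cases "f x = 0 \<and> f y = 0")
      case False
      moreover have "(y, x) \<in> E" using that E(1) by (auto simp: sym_def)
      ultimately have "x \<in> S'" "y \<in> S'" using that by (auto simp: S'_def)
      then show ?thesis using g(2) by simp
    qed simp
    have "(k x - k y)\<^sup>2 = (f x - f y)\<^sup>2 / 4 + (g x - g y)\<^sup>2 / 4" if "(x, y) \<in> P" for x y
    proof -
      have "(f x - f y) * (g x - g y) = 0" using disj[of x y] that P(2) by auto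
      moreover have "k x - k y = ((f x - f y) + (g x - g y)) / 2" by (simp add: k_def field_simps)
      ultimately show ?thesis by (simp only: power_divide power2_sum) (simp add: field_simps)
    qed
    then have "(\<Sum>(x, y)\<in>P. (k x - k y)\<^sup>2) = (\<Sum>(x, y)\<in>P. (f x - f y)\<^sup>2 / 4 + (g x - g y)\<^sup>2 / 4)"
      by (intro sum.cong) auto
    also have "\<dots> = (\<Sum>(x, y)\<in>P. (f x - f y)\<^sup>2) / 4 + (\<Sum>(x, y)\<in>P. (g x - g y)\<^sup>2) / 4"
      by (simp add: case_prod_unfold sum.distrib sum_divide_distrib)
    also have "\<dots> \<le> c / 4 + c / 4"
      using f(3) g(3) P by (intro add_mono divide_right_mono) (auto simp: dirichlet_le_def)
    finally show "(\<Sum>(x, y)\<in>P. (k x - k y)\<^sup>2) \<le> c / 2" by simp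
  qed
  ultimately show ?thesis by blast
qed

lemma dirichlet_le_small:
  fixes E :: "('v \<times> 'v) set"
  assumes E: "sym E" "\<And>x. finite (E `` {x})"
    and ex: "\<And>S. finite S \<Longrightarrow> \<exists>f. finite {x. f x \<noteq> 0} \<and> (\<forall>x\<in>S. f x = 1) \<and> dirichlet_le E f c"
    and S: "finite S"
  shows "\<exists>f. finite {x. f x \<noteq> 0} \<and> (\<forall>x\<in>S. f x = 1) \<and> dirichlet_le E f (c / 2 ^ n)"
  using S
proof (induction n arbitrary: S)
  case 0
  then show ?case using ex by simp
next
  case (Suc n)
  from dirichlet_le_halve[OF E Suc.IH Suc.prems] show ?case by (simp add: mult.commute)
qed

text \<open>Halving the energy often enough pushes the resistance above any level \<open>r\<close>,
  for all finite \<open>K\<close> that contain the support of the test function. This is convergence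
  along the filter of finite subsets.\<close>

lemma recurrent_component_if_bounded_energy:
  fixes E :: "('v \<times> 'v) set"
  assumes E: "sym E" "\<And>x. finite (E `` {x})"
    and ex: "\<And>S. finite S \<Longrightarrow> \<exists>f. finite {x. f x \<noteq> 0} \<and> (\<forall>x\<in>S. f x = 1) \<and> dirichlet_le E f c"
  shows "recurrent_component E (E\<^sup>* `` {w})"
proof (cases "finite (E\<^sup>* `` {w})")
  case False
  have "effective_resistance_to_infinity E v = \<infinity>" if v: "v \<in> E\<^sup>* `` {w}" for v
  proof -
    have "sym (E\<^sup>*)" using E(1) by (rule sym_rtrancl)
    then have comp: "E\<^sup>* `` {w} = E\<^sup>* `` {v}"
      using v by (auto simp: sym_def intro: rtrancl_trans)
    let ?F = "finite_subsets_at_top (E\<^sup>* `` {v})"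
    have "eventually (\<lambda>K. ereal r < ereal (effective_resistance E v K)) ?F" for r
    proof -
      obtain n where n: "(\<bar>c\<bar> + 1) * (\<bar>r\<bar> + 1) < 2 ^ n"
        using real_arch_pow[of 2 "(\<bar>c\<bar> + 1) * (\<bar>r\<bar> + 1)"] by auto
      \<comment> \<open>\<open>\<bar>c\<bar> + 1\<close> makes \<open>e\<close> positive whatever
        the sign of \<open>c\<close>.\<close>
      define e where "e = (\<bar>c\<bar> + 1) / 2 ^ n"
      have e: "e > 0" by (simp add: e_def)
      have "r * (\<bar>c\<bar> + 1) \<le> (\<bar>c\<bar> + 1) * (\<bar>r\<bar> + 1)"
        by (subst mult.commute, rule mult_left_mono) auto
      then have re: "r < 1 / e" using n by (simp add: e_def pos_less_divide_eq divide_less_eq)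
      obtain f where f: "finite {x. f x \<noteq> 0}" "f v = 1" "dirichlet_le E f (c / 2 ^ n)"
        using dirichlet_le_small[OF E ex, of "{v}" n] by auto
      \<comment> \<open>No edge leaves the component, so cutting \<open>f\<close> off outside of it
        creates no gradient; the support then fits into sets \<open>K\<close> of vertices of the
        component.\<close>
      define g where "g x = (if x \<in> E\<^sup>* `` {v} then f x else 0)" for x
      have g: "dirichlet_le E g e"
        unfolding dirichlet_le_def
      proof safe
        fix P :: "('v \<times> 'v) set" assume P: "finite P" "P \<subseteq> E"
        have "x \<in> E\<^sup>* `` {v} \<longleftrightarrow> y \<in> E\<^sup>* `` {v}" if "(x, y) \<in> E" for x y
          using that E(1) by (auto simp: sym_def intro: rtrancl_into_rtrancl)
        then have "(\<Sum>(x, y)\<in>P. (g x - g y)\<^sup>2) \<le> (\<Sum>(x, y)\<in>P. (f x - f y)\<^sup>2)"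
          using P by (intro sum_mono) (auto simp: g_def)
        also have "\<dots> \<le> c / 2 ^ n" using f(3) P by (auto simp: dirichlet_le_def)
        also have "\<dots> \<le> e" by (auto simp: e_def divide_right_mono)
        finally show "(\<Sum>(x, y)\<in>P. (g x - g y)\<^sup>2) \<le> e" .
      qed
      define K0 where "K0 = insert v ({x. f x \<noteq> 0} \<inter> E\<^sup>* `` {v})"
      have "ereal r < ereal (effective_resistance E v K)"
        if K: "finite K" "K0 \<subseteq> K" "K \<subseteq> E\<^sup>* `` {v}" for K
      proof -
        have "1 / e \<le> effective_resistance E v K"
        proof (rule effective_resistance_ge[OF E(1) K(1) E(2) K(3), where f = g])
          show "infinite (E\<^sup>* `` {v})" using False comp by simp
          show "g x = 0" if "x \<notin> K" for x using that K(2) by (auto simp: g_def K0_def)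
        qed (use K g e f in \<open>auto simp: g_def K0_def\<close>)
        then show ?thesis using re by simp
      qed
      then show ?thesis
        unfolding eventually_finite_subsets_at_top
        using f(1) by (intro exI[of _ K0]) (auto simp: K0_def)
    qed
    then have "((\<lambda>K. ereal (effective_resistance E v K)) \<longlongrightarrow> \<infinity>) ?F"
      by (simp add: tendsto_PInfty)
    then show ?thesis
      unfolding effective_resistance_to_infinity_def
      by (intro tendsto_Lim) (auto simp: finite_subsets_at_top_neq_bot)
  qed
  then show ?thesis using E(2) by (simp add: recurrent_component_def)
qed (simp add: recurrent_component_def)

section \<open>Crossing costs with shortcuts\<close>

definition cdist :: "int \<times> int \<Rightarrow> int \<times> int \<Rightarrow> int" where
  "cdist c d = max \<bar>fst c - fst d\<bar> \<bar>snd c - snd d\<bar>"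

lemma cdist_nonneg [simp]: "0 \<le> cdist c d"
  by (simp add: cdist_def)

lemma cdist_self [simp]: "cdist c c = 0"
  by (simp add: cdist_def)

lemma cdist_commute: "cdist c d = cdist d c"
  by (simp add: cdist_def abs_minus_commute)

lemma cdist_triangle: "cdist a c \<le> cdist a b + cdist b c"
  unfolding cdist_def by linarith

lemma cdist_eq_0_iff: "cdist c d = 0 \<longleftrightarrow> c = d"
  by (cases c; cases d) (auto simp: cdist_def max_def split: if_splits)

lemma abs_div_diff_le:
  fixes x y L n :: int
  assumes "0 < L" "\<bar>x - y\<bar> \<le> n * L"
  shows "\<bar>x div L - y div L\<bar> \<le> n"
proof -
  have "x div L \<le> (y + n * L) div L" "y div L \<le> (x + n * L) div L"
    by (intro zdiv_mono1; use assms in linarith)+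
  then show ?thesis using assms(1) by simp
qed

lemma abs_diff_le_div:
  fixes x y L n :: int
  assumes "0 < L" "\<bar>x div L - y div L\<bar> \<le> n"
  shows "\<bar>x - y\<bar> \<le> (n + 1) * L"
proof -
  have "x - y = (x div L - y div L) * L + (x mod L - y mod L)"
    unfolding left_diff_distrib minus_mod_eq_div_mult[symmetric] by simp
  then have "\<bar>x - y\<bar> \<le> \<bar>(x div L - y div L) * L\<bar> + \<bar>x mod L - y mod L\<bar>" by linarith
  also have "\<bar>(x div L - y div L) * L\<bar> \<le> n * L"
    using assms by (simp add: abs_mult mult_right_mono)
  also have "\<bar>x mod L - y mod L\<bar> \<le> L"
    using assms(1) pos_mod_bound[of L x] pos_mod_bound[of L y] pos_mod_sign[of L x] pos_mod_sign[of L y]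
    by linarith
  finally show ?thesis by (simp add: distrib_right)
qed

text \<open>\<open>Rad c\<close> stands for the radii of the vertices in the cell \<open>c\<close>.
  The window from \<open>a\<close> to \<open>b\<close> serves an induction over scales:
  \<open>a\<close> stays at \<open>L0\<close>, while \<open>b\<close> grows with the level and
  larger radii are treated as absent.\<close>

definition shortcut ::
    "(int \<times> int \<Rightarrow> real set) \<Rightarrow> real \<Rightarrow> real \<Rightarrow> int \<times> int \<Rightarrow> int \<times> int \<Rightarrow> bool" where
  "shortcut Rad a b c d \<longleftrightarrow> (\<exists>r\<in>Rad c \<union> Rad d. a < r \<and> r \<le> b \<and> cdist c d \<le> r)"

definition step_cost ::
    "(int \<times> int \<Rightarrow> real set) \<Rightarrow> real \<Rightarrow> real \<Rightarrow> int \<times> int \<Rightarrow> int \<times> int \<Rightarrow> real" where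
  "step_cost Rad a b c d = (if shortcut Rad a b c d then 0 else cdist c d)"

definition path_cost ::
    "(int \<times> int \<Rightarrow> real set) \<Rightarrow> real \<Rightarrow> real \<Rightarrow> (nat \<Rightarrow> int \<times> int) \<Rightarrow> nat \<Rightarrow> nat \<Rightarrow> real" where
  "path_cost Rad a b p i j = (\<Sum>t = i..<j. step_cost Rad a b (p t) (p (Suc t)))"

lemma step_cost_nonneg [simp]: "0 \<le> step_cost Rad a b c d"
  by (simp add: step_cost_def)

lemma step_cost_commute: "step_cost Rad a b c d = step_cost Rad a b d c"
  unfolding step_cost_def shortcut_def cdist_commute[of c d] Un_commute[of "Rad c"] ..

lemma cdist_le_step_cost: "0 \<le> b \<Longrightarrow> cdist c d \<le> step_cost Rad a b c d + b"
  by (auto simp: step_cost_def shortcut_def)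

lemma path_cost_nonneg [simp]: "0 \<le> path_cost Rad a b p i j"
  by (simp add: path_cost_def sum_nonneg)

lemma path_cost_self [simp]: "path_cost Rad a b p i i = 0"
  by (simp add: path_cost_def)

lemma path_cost_append:
  "i \<le> j \<Longrightarrow> j \<le> k \<Longrightarrow> path_cost Rad a b p i k = path_cost Rad a b p i j + path_cost Rad a b p j k"
  by (simp add: path_cost_def sum.atLeastLessThan_concat)

lemma path_cost_Suc:
  "i \<le> j \<Longrightarrow> path_cost Rad a b p i (Suc j) = path_cost Rad a b p i j + step_cost Rad a b (p j) (p (Suc j))"
  by (simp add: path_cost_def)

lemma path_cost_mono:
  "i \<le> i' \<Longrightarrow> i' \<le> j' \<Longrightarrow> j' \<le> j \<Longrightarrow> path_cost Rad a b p i' j' \<le> path_cost Rad a b p i j"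
  unfolding path_cost_def by (intro sum_mono2) auto

text \<open>The window from \<open>a\<close> to \<open>a\<close> is empty, so no step is free. This
  is level 0 of the renormalization.\<close>

lemma cdist_le_path_cost:
  assumes "i \<le> j"
  shows "cdist (p i) (p j) \<le> path_cost Rad a a p i j"
  using assms
proof (induction j rule: dec_induct)
  case (step j)
  have "\<not> shortcut Rad a a (p j) (p (Suc j))" by (auto simp: shortcut_def)
  then have "path_cost Rad a a p i (Suc j) = path_cost Rad a a p i j + cdist (p j) (p (Suc j))"
    using step by (simp add: path_cost_Suc step_cost_def)
  then show ?case using step.IH cdist_triangle[of "p i" "p (Suc j)" "p j"] by linarith
qed simp

section \<open>Renormalization over growing scales\<close>

locale scales =
  fixes L0 K :: int
  assumes L0: "1 \<le> L0" and K: "32 \<le> K"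
begin

text \<open>Doubling ratios make the relative losses \<open>8 / ratio m\<close> summable, with sum
  16 / K; this is at most 1/2 because K is at least 32.\<close>

definition ratio :: "nat \<Rightarrow> int" where
  "ratio m = K * 2 ^ m"

primrec len :: "nat \<Rightarrow> int" where
  "len 0 = L0"
| "len (Suc m) = len m * ratio m"

text \<open>A lower bound for the cost per unit of distance at level \<open>m\<close>. The 8 adds up
  what one induction step of \<open>exit_cost\<close> loses, in units of \<open>len m\<close>: 1 for
  each of two good runs, 5 for a cluster of bad boxes, 1 for the step out of it.\<close>

primrec speed :: "nat \<Rightarrow> real" where
  "speed 0 = 1"
| "speed (Suc m) = speed m * (1 - 8 / ratio m)"

definition box :: "nat \<Rightarrow> int \<times> int \<Rightarrow> int \<times> int" where
  "box m c = (fst c div len m, snd c div len m)"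

definition parent :: "nat \<Rightarrow> int \<times> int \<Rightarrow> int \<times> int" where
  "parent m b = (fst b div ratio m, snd b div ratio m)"

text \<open>A good box tolerates one cluster of bad boxes of the level below, since passing it loses
  only a constant multiple of \<open>len m\<close>. Badness of a box is decided by the cells in
  boxes of its level at distance at most 2; the distance 5 between \<open>b1\<close> and
  \<open>b2\<close> makes their regions disjoint, so that two separate defects get the squared
  probability bound.\<close>

primrec bad :: "nat \<Rightarrow> (int \<times> int \<Rightarrow> real set) \<Rightarrow> int \<times> int \<Rightarrow> bool" where
  "bad 0 Rad b = False"
| "bad (Suc m) Rad b =
     ((\<exists>c. \<exists>r\<in>Rad c. cdist (box (Suc m) c) b \<le> 2 \<and> len m < r \<and> r \<le> len (Suc m)) \<or>
      (\<exists>b1 b2. cdist (parent m b1) b \<le> 1 \<and> cdist (parent m b2) b \<le> 1 \<and> 5 \<le> cdist b1 b2 \<and>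
         bad m Rad b1 \<and> bad m Rad b2))"

lemma ratio_ge: "32 \<le> ratio m"
  using K mult_mono[of 32 K 1 "2 ^ m"] by (simp add: ratio_def)

lemma len_ge: "1 \<le> len m"
proof (induction m)
  case (Suc m)
  then show ?case using ratio_ge[of m] mult_mono[of 1 "len m" 1 "ratio m"] by simp
qed (use L0 in simp)

text \<open>The product of the factors is bounded below by 1 minus the sum of the losses, a
  geometric series whose partial sums telescope.\<close>

lemma speed_bounds: "1 - 16 / K * (1 - (1 / 2) ^ m) \<le> speed m \<and> 0 \<le> speed m \<and> speed m \<le> 1"
proof (induction m)
  case (Suc m)
  have pos: "0 < real_of_int K" using K by simp
  have r: "0 \<le> 8 / real_of_int (ratio m)" "8 / real_of_int (ratio m) \<le> 1"
    using ratio_ge[of m] by auto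
  have "speed m * (8 / ratio m) \<le> 8 / ratio m"
    using Suc.IH r(1) mult_right_mono[of "speed m" 1 "8 / ratio m"] by simp
  also have "8 / ratio m = 16 / K * ((1 / 2) ^ m - (1 / 2) ^ Suc m)"
    using pos by (simp add: ratio_def field_simps power_divide)
  finally have "1 - 16 / K * (1 - (1 / 2) ^ Suc m) \<le> speed (Suc m)"
    using Suc.IH by (simp add: right_diff_distrib)
  moreover have "0 \<le> speed (Suc m)" "speed (Suc m) \<le> 1"
    using Suc.IH r mult_mono[of "speed m" 1 "1 - 8 / ratio m" 1] by auto
  ultimately show ?case by blast
qed simp

lemma speed_ge_half: "1 / 2 \<le> speed m"
proof -
  have "16 / real_of_int K \<le> 1 / 2" using K by (simp add: field_simps)
  moreover have "0 \<le> 1 - (1 / 2 :: real) ^ m" "1 - (1 / 2 :: real) ^ m \<le> 1"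
    by (simp_all add: power_le_one)
  ultimately have "16 / K * (1 - (1 / 2) ^ m) \<le> 1 / 2 * 1"
    using K by (intro mult_mono) auto
  then show ?thesis using speed_bounds[of m] by linarith
qed

lemma box_Suc: "box (Suc m) c = parent m (box m c)"
  using ratio_ge[of m] len_ge[of m] by (simp add: box_def parent_def zdiv_zmult2_eq)

lemma cdist_box_le:
  assumes "cdist c d \<le> n * len m"
  shows "cdist (box m c) (box m d) \<le> n"
  using assms len_ge[of m] abs_div_diff_le[of "len m" "fst c" "fst d" n]
    abs_div_diff_le[of "len m" "snd c" "snd d" n] by (simp add: cdist_def box_def)

lemma cdist_le_box:
  assumes "cdist (box m c) (box m d) \<le> n"
  shows "cdist c d \<le> (n + 1) * len m"
  using assms len_ge[of m] abs_diff_le_div[of "len m" "fst c" "fst d" n]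
    abs_diff_le_div[of "len m" "snd c" "snd d" n] by (simp add: cdist_def box_def)

text \<open>
  A path through good boxes is cut at the first exits from the balls of radius \<open>len m\<close> around its
  successive stopping points; only the last piece may be too short to be charged for.
\<close>

lemma good_run:
  assumes exit: "\<And>i j. \<not> bad m Rad (box m (p i)) \<Longrightarrow> i \<le> j \<Longrightarrow>
      (\<And>t. i \<le> t \<Longrightarrow> t < j \<Longrightarrow> cdist (p i) (p t) \<le> len m) \<Longrightarrow> len m < cdist (p i) (p j) \<Longrightarrow>
      speed m * cdist (p i) (p j) \<le> path_cost Rad L0 (len m) p i j"
    and "i \<le> j" "\<And>t. i \<le> t \<Longrightarrow> t < j \<Longrightarrow> \<not> bad m Rad (box m (p t))"
  shows "speed m * cdist (p i) (p j) \<le> path_cost Rad L0 (len m) p i j + speed m * len m"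
  using assms(2,3)
proof (induction "j - i" arbitrary: i rule: less_induct)
  case less
  have s: "0 \<le> speed m" "speed m \<le> 1" using speed_bounds[of m] by auto
  show ?case
  proof (cases "\<exists>t. i \<le> t \<and> t \<le> j \<and> len m < cdist (p i) (p t)")
    case False
    then have "cdist (p i) (p j) \<le> len m" using less.prems by force
    then have "speed m * cdist (p i) (p j) \<le> speed m * len m"
      using s by (intro mult_left_mono) auto
    then show ?thesis using path_cost_nonneg[of Rad L0 "len m" p i j] by linarith
  next
    case True
    define t where "t = (LEAST t. i \<le> t \<and> t \<le> j \<and> len m < cdist (p i) (p t))"
    have t: "i \<le> t" "t \<le> j" "len m < cdist (p i) (p t)"
      using LeastI_ex[OF True] by (auto simp: t_def)
    have lt: "cdist (p i) (p k) \<le> len m" if "i \<le> k" "k < t" for k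
      using not_less_Least[of k "\<lambda>t. i \<le> t \<and> t \<le> j \<and> len m < cdist (p i) (p t)"] that t
      by (fold t_def) auto
    have "t \<noteq> i" using t(3) len_ge[of m] by auto
    then have "i < t" using t(1) by simp
    have 1: "speed m * cdist (p i) (p t) \<le> path_cost Rad L0 (len m) p i t"
      using less.prems t \<open>i < t\<close> lt by (intro exit) auto
    have 2: "speed m * cdist (p t) (p j) \<le> path_cost Rad L0 (len m) p t j + speed m * len m"
      using less.prems t \<open>i < t\<close> by (intro less.hyps) auto
    have "speed m * cdist (p i) (p j) \<le> speed m * (cdist (p i) (p t) + cdist (p t) (p j))"
      using s cdist_triangle[of "p i" "p j" "p t"] by (intro mult_left_mono) (auto simp flip: of_int_add)
    then show ?thesis
      using 1 2 path_cost_append[OF t(1,2), of Rad L0 "len m" p] by (simp add: algebra_simps)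
  qed
qed

text \<open>Before its exit the path stays in boxes at distance at most 1 from its first box, which
  is good. Hence hubs with radius between \<open>len m\<close> and \<open>len (Suc m)\<close> are
  out of reach, and all bad boxes of level \<open>m\<close> on the way belong to one cluster. The
  path is cut at its first and its last visit to a bad box; the outer parts are good runs at the
  speed of level \<open>m\<close>. In total at most 8 * \<open>len m\<close> is lost, a fraction of
  at most \<open>8 / ratio m\<close> of the distance covered.\<close>

lemma exit_cost:
  assumes "\<not> bad m Rad (box m (p i))" "i \<le> j"
    and "\<And>t. i \<le> t \<Longrightarrow> t < j \<Longrightarrow> cdist (p i) (p t) \<le> len m" "len m < cdist (p i) (p j)"
  shows "speed m * cdist (p i) (p j) \<le> path_cost Rad L0 (len m) p i j"
  using assms
proof (induction m arbitrary: i j)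
  case 0
  then show ?case using cdist_le_path_cost[of i j p Rad L0] by simp
next
  case (Suc m)
  define b where "b = box (Suc m) (p i)"
  let ?c = "path_cost Rad L0 (len m) p"
  have s: "0 \<le> speed m" "speed m \<le> 1" using speed_bounds[of m] by auto
  have nohub: "\<not> (cdist (box (Suc m) c) b \<le> 2 \<and> len m < r \<and> r \<le> len (Suc m))" if "r \<in> Rad c" for c and r :: real
    using Suc.prems(1) that unfolding b_def bad.simps by blast
  have near: "cdist (box (Suc m) (p t)) b \<le> 1" if "i \<le> t" "t < j" for t
    using cdist_box_le[of "p i" "p t" 1 "Suc m"] Suc.prems(3)[OF that]
    by (simp add: b_def cdist_commute)
  have bad_near: "cdist b1 b2 \<le> 4"
    if "bad m Rad b1" "bad m Rad b2" "cdist (parent m b1) b \<le> 1" "cdist (parent m b2) b \<le> 1" for b1 b2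
  proof (rule ccontr)
    assume "\<not> ?thesis"
    then have "5 \<le> cdist b1 b2" by simp
    then show False using Suc.prems(1) that unfolding b_def bad.simps by blast
  qed
  \<comment> \<open>With the intermediate hubs absent, a step that is free at level
    \<open>Suc m\<close> is already free at level \<open>m\<close>.\<close>
  have step: "step_cost Rad L0 (len m) (p t) (p (Suc t)) \<le> step_cost Rad L0 (len (Suc m)) (p t) (p (Suc t))"
    if t: "i \<le> t" "t < j" for t
  proof -
    have "shortcut Rad L0 (len m) (p t) (p (Suc t))" if sc: "shortcut Rad L0 (len (Suc m)) (p t) (p (Suc t))"
    proof -
      obtain r :: real where r: "r \<in> Rad (p t) \<union> Rad (p (Suc t))" "L0 < r" "r \<le> len (Suc m)"
          "cdist (p t) (p (Suc t)) \<le> r"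
        using sc by (auto simp: shortcut_def)
      have "real_of_int (cdist (p t) (p (Suc t))) \<le> len (Suc m)" using r by linarith
      then have "cdist (box (Suc m) (p t)) (box (Suc m) (p (Suc t))) \<le> 1"
        by (intro cdist_box_le) (simp only: of_int_le_iff mult_1)
      \<comment> \<open>The far end of a free step may lie one box farther out than the path so far:
        this is the 2 in the hub clause of \<open>bad\<close>.\<close>
      then have "cdist (box (Suc m) (p (Suc t))) b \<le> 2"
        using near[OF t] cdist_triangle[of "box (Suc m) (p (Suc t))" b "box (Suc m) (p t)"]
        by (simp add: cdist_commute)
      then have "r \<le> len m" using nohub[of r "p t"] nohub[of r "p (Suc t)"] r near[OF t] by fastforce
      then show ?thesis using r by (auto simp: shortcut_def)
    qed
    then show ?thesis by (auto simp: step_cost_def)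
  qed
  then have cost: "?c i j \<le> path_cost Rad L0 (len (Suc m)) p i j"
    unfolding path_cost_def by (intro sum_mono) auto
  have run: "speed m * cdist (p k) (p l) \<le> ?c k l + speed m * len m"
    if "k \<le> l" "\<And>t. k \<le> t \<Longrightarrow> t < l \<Longrightarrow> \<not> bad m Rad (box m (p t))" for k l
    using Suc.IH that by (rule good_run)
  have "speed m * cdist (p i) (p j) \<le> ?c i j + 8 * (speed m * len m)"
  proof (cases "\<exists>t. i \<le> t \<and> t < j \<and> bad m Rad (box m (p t))")
    case False
    then have "speed m * cdist (p i) (p j) \<le> ?c i j + speed m * len m"
      using Suc.prems(2) by (intro run) auto
    then show ?thesis using s len_ge[of m] mult_nonneg_nonneg[of "speed m" "len m"] by linarith
  next
    case True
    define T where "T = {t. i \<le> t \<and> t < j \<and> bad m Rad (box m (p t))}"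
    have T: "finite T" "T \<noteq> {}" using True by (auto simp: T_def)
    \<comment> \<open>Between the first and the last visit to a bad box, the cost is estimated by 0,
      however often good boxes are visited there.\<close>
    define t1 t2 where "t1 = Min T" and "t2 = Max T"
    have t12: "t1 \<in> T" "t2 \<in> T" "t1 \<le> t2" using T by (auto simp: t1_def t2_def)
    then have le: "i \<le> t1" "t1 \<le> t2" "t2 < j" by (auto simp: T_def)
    have 1: "speed m * cdist (p i) (p t1) \<le> ?c i t1 + speed m * len m"
    proof (rule run)
      fix t assume t: "i \<le> t" "t < t1"
      then have "t \<notin> T" using Min_le[OF T(1)] unfolding t1_def by (meson leD)
      then show "\<not> bad m Rad (box m (p t))" using t le by (simp add: T_def)
    qed (use le in auto)
    have 2: "speed m * cdist (p (Suc t2)) (p j) \<le> ?c (Suc t2) j + speed m * len m"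
    proof (rule run)
      fix t assume t: "Suc t2 \<le> t" "t < j"
      then have "t \<notin> T" using Max_ge[OF T(1)] unfolding t2_def by (meson Suc_le_lessD leD)
      then show "\<not> bad m Rad (box m (p t))" using t le by (simp add: T_def)
    qed (use le in auto)
    have "cdist (box m (p t1)) (box m (p t2)) \<le> 4"
      using t12 le near[of t1] near[of t2] by (intro bad_near) (auto simp: T_def box_Suc)
    then have "cdist (p t1) (p t2) \<le> 5 * len m" using cdist_le_box by fastforce
    then have "real_of_int (cdist (p t1) (p t2)) \<le> 5 * len m" by linarith
    from mult_left_mono[OF this s(1)]
    have 3: "speed m * cdist (p t1) (p t2) \<le> 5 * (speed m * len m)" by simp
    \<comment> \<open>The box at \<open>t2\<close> is bad, so the next run can only start at
      \<open>Suc t2\<close>. If the step in between is free, it is no longer than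
      \<open>len m\<close>.\<close>
    have "cdist (p t2) (p (Suc t2)) \<le> step_cost Rad L0 (len m) (p t2) (p (Suc t2)) + len m"
      using len_ge[of m] by (intro cdist_le_step_cost) auto
    then have "speed m * cdist (p t2) (p (Suc t2)) \<le> speed m * (?c t2 (Suc t2) + len m)"
      using s by (intro mult_left_mono) (simp_all add: path_cost_Suc)
    also have "\<dots> \<le> ?c t2 (Suc t2) + speed m * len m"
      using s mult_right_mono[of "speed m" 1 "?c t2 (Suc t2)"] by (simp add: distrib_left)
    finally have 4: "speed m * cdist (p t2) (p (Suc t2)) \<le> ?c t2 (Suc t2) + speed m * len m" .
    have "cdist (p i) (p j) \<le> cdist (p i) (p t1) + cdist (p t1) (p t2) + cdist (p t2) (p (Suc t2))
        + cdist (p (Suc t2)) (p j)"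
      using cdist_triangle[of "p i" "p j" "p t1"] cdist_triangle[of "p t1" "p j" "p t2"]
        cdist_triangle[of "p t2" "p j" "p (Suc t2)"] by linarith
    then have "real_of_int (cdist (p i) (p j)) \<le> cdist (p i) (p t1) + cdist (p t1) (p t2)
        + cdist (p t2) (p (Suc t2)) + cdist (p (Suc t2)) (p j)" by linarith
    from mult_left_mono[OF this s(1)]
    have "speed m * cdist (p i) (p j) \<le> speed m * cdist (p i) (p t1) + speed m * cdist (p t1) (p t2)
        + speed m * cdist (p t2) (p (Suc t2)) + speed m * cdist (p (Suc t2)) (p j)"
      by (simp add: algebra_simps)
    also have "\<dots> \<le> ?c i t1 + ?c t2 (Suc t2) + ?c (Suc t2) j + 8 * (speed m * len m)" using 1 2 3 4 by linarith
    also have "\<dots> \<le> ?c i t1 + ?c t1 t2 + ?c t2 (Suc t2) + ?c (Suc t2) j + 8 * (speed m * len m)" by simp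
    also have "\<dots> = ?c i j + 8 * (speed m * len m)"
      using le by (simp add: path_cost_append[of i t1 j] path_cost_append[of t1 t2 j]
          path_cost_append[of t2 "Suc t2" j])
    finally show ?thesis .
  qed
  moreover have "8 * (speed m * len m) \<le> speed m * (8 / ratio m * cdist (p i) (p j))"
  proof -
    have "len m * ratio m \<le> cdist (p i) (p j)" using Suc.prems(4) by simp
    then have "real_of_int (len m * ratio m) \<le> cdist (p i) (p j)" by (simp only: of_int_le_iff)
    then have "8 / ratio m * real_of_int (len m * ratio m) \<le> 8 / ratio m * cdist (p i) (p j)"
      using ratio_ge[of m] by (intro mult_left_mono) auto
    then have "8 * len m \<le> 8 / ratio m * cdist (p i) (p j)"
      using ratio_ge[of m] by simp
    from mult_left_mono[OF this s(1)] show ?thesis by simp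
  qed
  moreover have "speed (Suc m) * cdist (p i) (p j) =
      speed m * cdist (p i) (p j) - speed m * (8 / ratio m * cdist (p i) (p j))"
    unfolding speed.simps left_diff_distrib right_diff_distrib by simp
  ultimately show ?case using cost by linarith
qed

text \<open>The cost distance from the square of radius \<open>len m\<close>, rescaled and
  truncated. The four boxes around the origin cover that square, so a path from it to beyond
  \<open>2 * len m\<close> starts in a good box and gets farther than \<open>len m\<close> from its
  start. At speed at least 1/2 this costs \<open>len m / 2\<close>, where \<open>f\<close> reaches
  0.\<close>

lemma potential:
  assumes good: "\<And>b. fst b \<in> {-1, 0} \<Longrightarrow> snd b \<in> {-1, 0} \<Longrightarrow> \<not> bad m Rad b"
  obtains f :: "int \<times> int \<Rightarrow> real" where
    "\<And>c. cdist (0, 0) c < len m \<Longrightarrow> f c = 1"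
    "\<And>c. 2 * len m < cdist (0, 0) c \<Longrightarrow> f c = 0"
    "\<And>c d. \<bar>f c - f d\<bar> \<le> 2 / len m * step_cost Rad L0 (len m) c d"
proof
  define S where "S c = {path_cost Rad L0 (len m) p 0 q | p q. cdist (0, 0) (p 0) < len m \<and> p q = c}" for c
  define F where "F c = Inf (S c)" for c
  define f where "f c = max 0 (1 - 2 / len m * F c)" for c
  have len: "1 \<le> len m" by (rule len_ge)
  have SI: "path_cost Rad L0 (len m) p 0 q \<in> S (p q)" if "cdist (0, 0) (p 0) < len m" for p q
    using that by (auto simp: S_def)
  have bdd: "bdd_below (S c)" for c by (rule bdd_belowI[of _ 0]) (auto simp: S_def)
  have ne: "S c \<noteq> {}" for c
  proof -
    define p :: "nat \<Rightarrow> int \<times> int" where "p t = (if t = 0 then (0, 0) else c)" for t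
    have "path_cost Rad L0 (len m) p 0 1 \<in> S c" using len SI[of p 1] by (simp add: p_def)
    then show ?thesis by blast
  qed
  have F0: "0 \<le> F c" for c unfolding F_def by (rule cInf_greatest[OF ne]) (auto simp: S_def)
  show "f c = 1" if "cdist (0, 0) c < len m" for c
  proof -
    have "path_cost Rad L0 (len m) (\<lambda>_. c) 0 0 \<in> S c" using that SI[of "\<lambda>_. c" 0] by simp
    then have "F c \<le> 0" using cInf_lower[OF _ bdd] unfolding F_def by fastforce
    then show ?thesis using F0[of c] by (simp add: f_def)
  qed
  show "f c = 0" if c: "2 * len m < cdist (0, 0) c" for c
  proof -
    have "len m / 2 \<le> F c" unfolding F_def
    proof (rule cInf_greatest[OF ne])
      fix x assume "x \<in> S c"
      then obtain p q where x: "x = path_cost Rad L0 (len m) p 0 q"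
        and p: "cdist (0, 0) (p 0) < len m" "p q = c" by (auto simp: S_def)
      have ex: "\<exists>t. t \<le> q \<and> len m < cdist (p 0) (p t)"
        using c p cdist_triangle[of "(0, 0)" c "p 0"] by (intro exI[of _ q]) auto
      define t where "t = (LEAST t. t \<le> q \<and> len m < cdist (p 0) (p t))"
      have t: "t \<le> q" "len m < cdist (p 0) (p t)"
        using LeastI_ex[OF ex] by (auto simp: t_def)
      have lt: "cdist (p 0) (p k) \<le> len m" if "k < t" for k
        using not_less_Least[of k "\<lambda>t. t \<le> q \<and> len m < cdist (p 0) (p t)"] that t
        by (fold t_def) auto
      \<comment> \<open>Negative coordinates fall into boxes of index -1, as \<open>div\<close>
        rounds down.\<close>
      have "x div len m \<in> {-1, 0}" if "\<bar>x\<bar> < len m" for x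
      proof (cases "0 \<le> x")
        case False
        then have "(x + len m) div len m = 0" using that by (intro div_pos_pos_trivial) auto
        then show ?thesis using len by simp
      qed (use that in simp)
      then have "\<not> bad m Rad (box m (p 0))"
        using p by (intro good) (auto simp: box_def cdist_def)
      then have "speed m * cdist (p 0) (p t) \<le> path_cost Rad L0 (len m) p 0 t"
        using t lt by (intro exit_cost) auto
      also have "\<dots> \<le> x" unfolding x using t by (intro path_cost_mono) auto
      finally have "speed m * cdist (p 0) (p t) \<le> x" .
      moreover have "1 / 2 * real_of_int (len m) \<le> speed m * cdist (p 0) (p t)"
        using speed_ge_half[of m] t len by (intro mult_mono) auto
      ultimately show "len m / 2 \<le> x" by simp
    qed
    then show ?thesis using len by (simp add: f_def field_simps)
  qed
  have F_le: "F d \<le> F c + step_cost Rad L0 (len m) c d" for c d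
  proof -
    have "F d - step_cost Rad L0 (len m) c d \<le> F c" unfolding F_def[of c]
    proof (rule cInf_greatest[OF ne])
      fix x assume "x \<in> S c"
      then obtain p q where x: "x = path_cost Rad L0 (len m) p 0 q"
        and p: "cdist (0, 0) (p 0) < len m" "p q = c" by (auto simp: S_def)
      define p' where "p' = p(Suc q := d)"
      have "path_cost Rad L0 (len m) p' 0 q = x"
        unfolding x path_cost_def by (rule sum.cong) (auto simp: p'_def)
      then have "path_cost Rad L0 (len m) p' 0 (Suc q) = x + step_cost Rad L0 (len m) c d"
        using p by (simp add: path_cost_Suc) (simp add: p'_def)
      moreover have "path_cost Rad L0 (len m) p' 0 (Suc q) \<in> S d"
        using p SI[of p' "Suc q"] by (simp add: p'_def)
      ultimately have "F d \<le> x + step_cost Rad L0 (len m) c d"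
        using cInf_lower[OF _ bdd] unfolding F_def by fastforce
      then show "F d - step_cost Rad L0 (len m) c d \<le> x" by simp
    qed
    then show ?thesis by simp
  qed
  show "\<bar>f c - f d\<bar> \<le> 2 / len m * step_cost Rad L0 (len m) c d" for c d
  proof -
    have "\<bar>F c - F d\<bar> \<le> step_cost Rad L0 (len m) c d"
      using F_le[of c d] F_le[of d c] step_cost_commute[of Rad L0 "len m" c d] by linarith
    then have "2 / len m * \<bar>F c - F d\<bar> \<le> 2 / len m * step_cost Rad L0 (len m) c d"
      using len by (intro mult_left_mono) auto
    moreover have "\<bar>f c - f d\<bar> \<le> \<bar>2 / len m * F c - 2 / len m * F d\<bar>"
      unfolding f_def by linarith
    moreover have "\<bar>2 / len m * F c - 2 / len m * F d\<bar> = 2 / len m * \<bar>F c - F d\<bar>"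
      unfolding right_diff_distrib[symmetric] abs_mult using len by simp
    ultimately show ?thesis by linarith
  qed
qed

end

section \<open>The probability of bad boxes\<close>

text \<open>
  The charges \<open>w a\<close> are upper bounds for the probability of a radius above \<open>a\<close> in a given cell.
  Charges of lists with disjoint cells multiply, which replaces the independence of distant boxes
  and only requires bounds on the factorial moments of the point process.
\<close>

definition witnessed ::
    "(real \<Rightarrow> real) \<Rightarrow> (int \<times> int) set \<Rightarrow> real \<Rightarrow> ((int \<times> int \<Rightarrow> real set) \<Rightarrow> bool) \<Rightarrow> bool" where
  "witnessed w S p P \<longleftrightarrow>
     (\<exists>ls. (\<forall>l\<in>set ls. distinct (map fst l) \<and> fst ` set l \<subseteq> S \<and> (\<forall>(c, a)\<in>set l. 0 < a)) \<and>
        (\<forall>Rad. P Rad \<longrightarrow> (\<exists>l\<in>set ls. \<forall>(c, a)\<in>set l. \<exists>r\<in>Rad c. a < r)) \<and>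
        (\<Sum>l\<leftarrow>ls. \<Prod>(c, a)\<leftarrow>l. w a) \<le> p)"

lemma witnessed_mono:
  assumes "witnessed w S p P" "S \<subseteq> S'" "p \<le> p'" "\<And>Rad. P' Rad \<Longrightarrow> P Rad"
  shows "witnessed w S' p' P'"
  using assms unfolding witnessed_def by (meson order_trans)

lemma witnessed_False: "0 \<le> p \<Longrightarrow> witnessed w S p (\<lambda>_. False)"
  unfolding witnessed_def by (rule exI[of _ "[]"]) simp

lemma witnessed_radius: "0 < a \<Longrightarrow> witnessed w {c} (w a) (\<lambda>Rad. \<exists>r\<in>Rad c. a < r)"
  unfolding witnessed_def by (rule exI[of _ "[[(c, a)]]"]) simp

lemma witnessed_disj:
  assumes "witnessed w S p P" "witnessed w S q Q"
  shows "witnessed w S (p + q) (\<lambda>Rad. P Rad \<or> Q Rad)"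
proof -
  obtain ls where ls: "\<forall>l\<in>set ls. distinct (map fst l) \<and> fst ` set l \<subseteq> S \<and> (\<forall>(c, a)\<in>set l. 0 < a)"
      "\<forall>Rad. P Rad \<longrightarrow> (\<exists>l\<in>set ls. \<forall>(c, a)\<in>set l. \<exists>r\<in>Rad c. a < r)"
      "(\<Sum>l\<leftarrow>ls. \<Prod>(c, a)\<leftarrow>l. w a) \<le> p"
    using assms(1) unfolding witnessed_def by blast
  obtain ks where ks: "\<forall>l\<in>set ks. distinct (map fst l) \<and> fst ` set l \<subseteq> S \<and> (\<forall>(c, a)\<in>set l. 0 < a)"
      "\<forall>Rad. Q Rad \<longrightarrow> (\<exists>l\<in>set ks. \<forall>(c, a)\<in>set l. \<exists>r\<in>Rad c. a < r)"
      "(\<Sum>l\<leftarrow>ks. \<Prod>(c, a)\<leftarrow>l. w a) \<le> q"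
    using assms(2) unfolding witnessed_def by blast
  show ?thesis
    unfolding witnessed_def
  proof (intro exI[of _ "ls @ ks"] conjI allI impI)
    fix Rad assume "P Rad \<or> Q Rad"
    then show "\<exists>l\<in>set (ls @ ks). \<forall>(c, a)\<in>set l. \<exists>r\<in>Rad c. a < r"
      using ls(2) ks(2) unfolding set_append bex_Un by blast
  next
    show "\<forall>l\<in>set (ls @ ks). distinct (map fst l) \<and> fst ` set l \<subseteq> S \<and> (\<forall>(c, a)\<in>set l. 0 < a)"
      using ls(1) ks(1) unfolding set_append ball_Un by blast
  qed (use ls(3) ks(3) in \<open>simp add: add_mono\<close>)
qed

lemma witnessed_Union:
  assumes "finite I" "\<And>i. i \<in> I \<Longrightarrow> witnessed w S (p i) (P i)"
  shows "witnessed w S (\<Sum>i\<in>I. p i) (\<lambda>Rad. \<exists>i\<in>I. P i Rad)"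
  using assms
proof (induction I)
  case (insert i I)
  then show ?case using witnessed_disj[of w S "p i" "P i"] by simp
qed (simp add: witnessed_False)

text \<open>Every list for \<open>P\<close> is concatenated with every list for \<open>Q\<close>.
  Disjoint regions keep the cells of a concatenation distinct, and the sum of products
  factorizes.\<close>

lemma witnessed_conj:
  assumes "witnessed w S p P" "witnessed w T q Q" "S \<inter> T = {}" "\<And>a. 0 \<le> w a"
  shows "witnessed w (S \<union> T) (p * q) (\<lambda>Rad. P Rad \<and> Q Rad)"
proof -
  obtain ls where ls: "\<forall>l\<in>set ls. distinct (map fst l) \<and> fst ` set l \<subseteq> S \<and> (\<forall>(c, a)\<in>set l. 0 < a)"
      "\<forall>Rad. P Rad \<longrightarrow> (\<exists>l\<in>set ls. \<forall>(c, a)\<in>set l. \<exists>r\<in>Rad c. a < r)"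
      "(\<Sum>l\<leftarrow>ls. \<Prod>(c, a)\<leftarrow>l. w a) \<le> p"
    using assms(1) unfolding witnessed_def by blast
  obtain ks where ks: "\<forall>l\<in>set ks. distinct (map fst l) \<and> fst ` set l \<subseteq> T \<and> (\<forall>(c, a)\<in>set l. 0 < a)"
      "\<forall>Rad. Q Rad \<longrightarrow> (\<exists>l\<in>set ks. \<forall>(c, a)\<in>set l. \<exists>r\<in>Rad c. a < r)"
      "(\<Sum>l\<leftarrow>ks. \<Prod>(c, a)\<leftarrow>l. w a) \<le> q"
    using assms(2) unfolding witnessed_def by blast
  define js where "js = concat (map (\<lambda>l. map (\<lambda>k. l @ k) ks) ls)"
  have js: "set js = {l @ k | l k. l \<in> set ls \<and> k \<in> set ks}" by (auto simp: js_def)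
  have nonneg: "0 \<le> (\<Prod>(c, a)\<leftarrow>l. w a)" for l :: "((int \<times> int) \<times> real) list"
    by (induction l) (auto simp: assms(4))
  have row: "(\<Sum>k\<leftarrow>ks. \<Prod>(c, a)\<leftarrow>l @ k. w a) = (\<Prod>(c, a)\<leftarrow>l. w a) * (\<Sum>k\<leftarrow>ks. \<Prod>(c, a)\<leftarrow>k. w a)" for l
    by (simp add: sum_list_const_mult)
  have "(\<Sum>l\<leftarrow>js. \<Prod>(c, a)\<leftarrow>l. w a) = (\<Sum>l\<leftarrow>ls. \<Sum>k\<leftarrow>ks. \<Prod>(c, a)\<leftarrow>l @ k. w a)"
    unfolding js_def by (induction ls) (simp_all add: comp_def)
  also have "\<dots> = (\<Sum>l\<leftarrow>ls. \<Prod>(c, a)\<leftarrow>l. w a) * (\<Sum>k\<leftarrow>ks. \<Prod>(c, a)\<leftarrow>k. w a)"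
    unfolding row by (simp add: sum_list_mult_const)
  also have "\<dots> \<le> p * q"
    using ls(3) ks(3) nonneg by (intro mult_mono order_trans[OF _ ls(3)] sum_list_nonneg) auto
  finally have sum: "(\<Sum>l\<leftarrow>js. \<Prod>(c, a)\<leftarrow>l. w a) \<le> p * q" .
  show ?thesis
    unfolding witnessed_def
  proof (intro exI[of _ js] conjI allI impI, rule ballI)
    fix j assume "j \<in> set js"
    then obtain l k where j: "j = l @ k" "l \<in> set ls" "k \<in> set ks" by (auto simp: js)
    have "fst ` set l \<subseteq> S" "fst ` set k \<subseteq> T" "distinct (map fst l)" "distinct (map fst k)"
      "\<forall>(c, a)\<in>set l. 0 < a" "\<forall>(c, a)\<in>set k. 0 < a"
      using ls(1) ks(1) j by blast+
    moreover from this have "fst ` set l \<inter> fst ` set k = {}" using assms(3) by blast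
    ultimately show "distinct (map fst j) \<and> fst ` set j \<subseteq> S \<union> T \<and> (\<forall>(c, a)\<in>set j. 0 < a)"
      unfolding j(1) set_append ball_Un by (auto simp: image_Un)
  next
    fix Rad assume "P Rad \<and> Q Rad"
    then obtain l k where "l \<in> set ls" "\<forall>(c, a)\<in>set l. \<exists>r\<in>Rad c. a < r"
        "k \<in> set ks" "\<forall>(c, a)\<in>set k. \<exists>r\<in>Rad c. a < r"
      using ls(2) ks(2) by blast
    then show "\<exists>l\<in>set js. \<forall>(c, a)\<in>set l. \<exists>r\<in>Rad c. a < r"
      unfolding js by (intro bexI[of _ "l @ k"]) auto
  qed (rule sum)
qed

lemma boxes_eq:
  fixes L n :: int
  assumes "0 < L"
  shows "{c. cdist (fst c div L, snd c div L) b \<le> n} =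
    {(fst b - n) * L..<(fst b + n + 1) * L} \<times> {(snd b - n) * L..<(snd b + n + 1) * L}"
proof -
  have "\<bar>x div L - y\<bar> \<le> n \<longleftrightarrow> (y - n) * L \<le> x \<and> x < (y + n + 1) * L" for x y
  proof -
    have le: "z \<le> x div L \<longleftrightarrow> z * L \<le> x" for z
    proof
      assume "z \<le> x div L"
      then have "z * L \<le> x div L * L" using assms by (intro mult_right_mono) auto
      also have "\<dots> \<le> x" using assms by (simp add: minus_mod_eq_div_mult[symmetric])
      finally show "z * L \<le> x" .
    next
      assume "z * L \<le> x"
      then have "z * L div L \<le> x div L" using assms by (intro zdiv_mono1)
      then show "z \<le> x div L" using assms by simp
    qed
    have "\<bar>x div L - y\<bar> \<le> n \<longleftrightarrow> y - n \<le> x div L \<and> \<not> y + n + 1 \<le> x div L" by auto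
    then show ?thesis unfolding le by (simp only: not_le)
  qed
  then show ?thesis by (auto simp: cdist_def)
qed

lemma
  fixes L n :: int
  assumes "0 < L" "0 \<le> n"
  shows finite_boxes: "finite {c. cdist (fst c div L, snd c div L) b \<le> n}"
    and card_boxes: "real (card {c. cdist (fst c div L, snd c div L) b \<le> n}) = ((2 * n + 1) * L)\<^sup>2"
proof -
  have "(x + n + 1) * L - (x - n) * L = (2 * n + 1) * L" for x by (simp add: algebra_simps)
  then show "real (card {c. cdist (fst c div L, snd c div L) b \<le> n}) = ((2 * n + 1) * L)\<^sup>2"
    unfolding boxes_eq[OF assms(1)] card_cartesian_product
    using assms by (simp add: power2_eq_square)
  show "finite {c. cdist (fst c div L, snd c div L) b \<le> n}"
    unfolding boxes_eq[OF assms(1)] by simp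
qed

context scales
begin

text \<open>A union bound. The 25 boxes at distance at most 2 hold
  \<open>25 * (len (Suc m))\<^sup>2\<close> cells for a hub. The children of the 9 boxes at distance
  at most 1 form at most \<open>(9 * (ratio m)\<^sup>2)\<^sup>2\<close> pairs, each with bound
  \<open>(p m)\<^sup>2\<close> because the two regions are disjoint.\<close>

lemma witnessed_bad:
  fixes w :: "real \<Rightarrow> real" and p :: "nat \<Rightarrow> real"
  assumes w: "\<And>a. 0 \<le> w a" and p0: "0 \<le> p 0"
    and p: "\<And>m. 25 * (len (Suc m))\<^sup>2 * w (len m) + 81 * ratio m ^ 4 * (p m)\<^sup>2 \<le> p (Suc m)"
  shows "witnessed w {c. cdist (box m c) b \<le> 2} (p m) (\<lambda>Rad. bad m Rad b)"
proof (induction m arbitrary: b)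
  case 0
  then show ?case using p0 by (simp add: witnessed_False)
next
  case (Suc m)
  let ?S = "{c. cdist (box (Suc m) c) b \<le> 2}"
  let ?B = "{b1. cdist (parent m b1) b \<le> 1}"
  let ?I = "{(b1, b2). b1 \<in> ?B \<and> b2 \<in> ?B \<and> 5 \<le> cdist b1 b2}"
  have finS: "finite ?S" and cardS: "real (card ?S) = 25 * (len (Suc m))\<^sup>2"
    using finite_boxes[of "len (Suc m)" 2 b] card_boxes[of "len (Suc m)" 2 b] len_ge[of "Suc m"]
    by (auto simp: box_def power_mult_distrib simp del: len.simps)
  have B: "?B = {c. cdist (fst c div ratio m, snd c div ratio m) b \<le> 1}"
    by (simp add: parent_def)
  have finB: "finite ?B" unfolding B using ratio_ge[of m] by (intro finite_boxes) auto
  have cardB: "real (card ?B) = 9 * (ratio m)\<^sup>2"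
    unfolding B using card_boxes[of "ratio m" 1 b] ratio_ge[of m] by (simp add: power_mult_distrib)
  have I: "?I \<subseteq> ?B \<times> ?B" by auto
  have finI: "finite ?I" by (rule finite_subset[OF I finite_cartesian_product[OF finB finB]])
  have "card ?I \<le> card ?B * card ?B"
    using card_mono[OF finite_cartesian_product[OF finB finB] I] by (simp add: card_cartesian_product)
  then have "real (card ?I) \<le> real (card ?B * card ?B)" by (simp only: of_nat_le_iff)
  also have "\<dots> = real (card ?B) * real (card ?B)" by simp
  also have "\<dots> = 81 * ratio m ^ 4" unfolding cardB by (simp add: power2_eq_square power4_eq_xxxx)
  finally have cardI: "real (card ?I) \<le> 81 * ratio m ^ 4" .
  have 1: "witnessed w ?S (\<Sum>c\<in>?S. w (len m)) (\<lambda>Rad. \<exists>c\<in>?S. \<exists>r\<in>Rad c. len m < r)"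
    using finS
  proof (rule witnessed_Union)
    fix c assume "c \<in> ?S"
    then show "witnessed w ?S (w (len m)) (\<lambda>Rad. \<exists>r\<in>Rad c. len m < r)"
      using len_ge[of m] by (intro witnessed_mono[OF witnessed_radius]) auto
  qed
  have 2: "witnessed w ?S (\<Sum>i\<in>?I. (p m)\<^sup>2) (\<lambda>Rad. \<exists>i\<in>?I. bad m Rad (fst i) \<and> bad m Rad (snd i))"
  proof (rule witnessed_Union[OF finI])
    fix i assume i: "i \<in> ?I"
    let ?T = "\<lambda>b. {c. cdist (box m c) b \<le> 2}"
    have sub: "?T b' \<subseteq> ?S" if "b' \<in> ?B" for b'
    proof
      fix c assume "c \<in> ?T b'"
      \<comment> \<open>The region of a child reaches at most one parent box farther, since
        \<open>ratio m\<close> exceeds 2.\<close>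
      then have "cdist (box m c) b' \<le> 1 * ratio m" using ratio_ge[of m] by simp
      then have "cdist (parent m (box m c)) (parent m b') \<le> 1"
        using ratio_ge[of m] abs_div_diff_le[of "ratio m" "fst (box m c)" "fst b'" 1]
          abs_div_diff_le[of "ratio m" "snd (box m c)" "snd b'" 1]
        by (simp add: cdist_def parent_def)
      then show "c \<in> ?S"
        using that cdist_triangle[of "parent m (box m c)" b "parent m b'"] by (simp add: box_Suc)
    qed
    have "?T (fst i) \<inter> ?T (snd i) = {}"
    proof (rule ccontr)
      assume "\<not> ?thesis"
      then obtain c where "cdist (box m c) (fst i) \<le> 2" "cdist (box m c) (snd i) \<le> 2" by auto
      then show False
        using i cdist_triangle[of "fst i" "snd i" "box m c"] cdist_commute[of "fst i"] by auto
    qed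
    from witnessed_conj[OF Suc.IH Suc.IH this w]
    show "witnessed w ?S ((p m)\<^sup>2) (\<lambda>Rad. bad m Rad (fst i) \<and> bad m Rad (snd i))"
    proof (rule witnessed_mono)
      have "fst i \<in> ?B" "snd i \<in> ?B" using i by auto
      then show "?T (fst i) \<union> ?T (snd i) \<subseteq> ?S" using sub by blast
    qed (auto simp: power2_eq_square)
  qed
  have "(\<Sum>c\<in>?S. w (len m)) + (\<Sum>i\<in>?I. (p m)\<^sup>2) \<le> p (Suc m)"
    using p[of m] cardS mult_right_mono[OF cardI, of "(p m)\<^sup>2"] by simp
  then show ?case
    by (rule witnessed_mono[OF witnessed_disj[OF 1 2] order_refl]) auto
qed

lemma len_ge_power: "real_of_int L0 * real_of_int K ^ m \<le> len m"
proof (induction m)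
  case (Suc m)
  have "K * 1 \<le> ratio m" unfolding ratio_def using K by (intro mult_left_mono) auto
  then have "real_of_int K \<le> ratio m" by simp
  with Suc have "(L0 * real_of_int K ^ m) * K \<le> real_of_int (len m) * ratio m"
    using L0 K len_ge[of m] by (intro mult_mono) auto
  then show ?case by (simp add: mult_ac)
qed simp

end

text \<open>The recursion of \<open>witnessed_bad\<close> closes with
  \<open>p m = k / 16 ^ m\<close>, each of its two terms taking half of
  \<open>k / 16 ^ Suc m\<close>. The order of the choices matters: K depends on \<sigma> - 2, then k
  is made small in terms of K to absorb the quadratic term, and finally L0 is made large to absorb
  the hubs.\<close>

lemma scales_exist:
  fixes lam \<sigma> :: real
  assumes "0 \<le> lam" "2 < \<sigma>"
  obtains L0 K :: int and k :: real where "scales L0 K" "0 < k"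
    "\<And>m b. witnessed (\<lambda>a. lam * a powr - \<sigma>) {c. cdist (scales.box L0 K m c) b \<le> 2}
      (k / 16 ^ m) (\<lambda>Rad. scales.bad L0 K m Rad b)"
proof -
  define e where "e = \<sigma> - 2"
  have e: "0 < e" using assms by (simp add: e_def)
  have large: "\<exists>n\<ge>N. x \<le> real n powr e" for x and N :: nat
  proof -
    have "filterlim (\<lambda>n. real n powr e) at_top sequentially" using e by real_asymp
    then have "eventually (\<lambda>n. x \<le> real n powr e) sequentially" by (simp add: filterlim_at_top)
    then obtain n0 where "\<forall>n\<ge>n0. x \<le> real n powr e" by (auto simp: eventually_sequentially)
    then show ?thesis by (intro exI[of _ "max N n0"]) simp
  qed
  \<comment> \<open>64 = 4 * 16: per level, \<open>(ratio m)\<^sup>2\<close> grows by the factor 4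
    and the target decays by the factor 16.\<close>
  obtain n where n: "64 \<le> real n powr e" "32 \<le> n" using large[of 32 64] by blast
  define K where "K = int n"
  \<comment> \<open>2592 = 32 * 81 makes the quadratic term equal to
    \<open>(k / 32) / 16 ^ m\<close>.\<close>
  define k where "k = 1 / (2592 * real_of_int K ^ 4)"
  have k: "0 < k" using n by (simp add: k_def K_def)
  \<comment> \<open>800 = 32 * 25 brings the hub term down to at most
    \<open>(k / 32) / 16 ^ m\<close>.\<close>
  obtain n0 where n0: "800 * lam * (real_of_int K)\<^sup>2 / k \<le> real n0 powr e" "1 \<le> n0"
    using large[of 1 "800 * lam * (real_of_int K)\<^sup>2 / k"] by blast
  define L0 where "L0 = int n0"
  interpret scales L0 K by unfold_locales (use n n0 in \<open>auto simp: K_def L0_def\<close>)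
  have main: "25 * (len (Suc m))\<^sup>2 * (lam * len m powr - \<sigma>) + 81 * ratio m ^ 4 * (k / 16 ^ m)\<^sup>2
      \<le> k / 16 ^ Suc m" for m
  proof -
    have len: "0 < real_of_int (len m)" using len_ge[of m] by simp
    have "real_of_int L0 powr e * 64 ^ m \<le> real_of_int L0 powr e * (real_of_int K powr e) ^ m"
      using n by (intro mult_left_mono power_mono) (auto simp: K_def)
    also have "\<dots> = (real_of_int L0 * real_of_int K ^ m) powr e"
    proof -
      have "(real_of_int K powr e) ^ m = (real_of_int K ^ m) powr e"
        by (induction m) (auto simp: powr_mult K_def)
      then show ?thesis by (simp add: powr_mult K_def L0_def)
    qed
    also have "\<dots> \<le> len m powr e"
      using e len_ge_power n n0 by (intro powr_mono2) (auto simp: K_def L0_def)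
    finally have l: "real_of_int L0 powr e * 64 ^ m \<le> len m powr e" .
    have "(len (Suc m))\<^sup>2 * (len m powr - \<sigma>) = (ratio m)\<^sup>2 * (len m powr 2 * len m powr - \<sigma>)"
      using len by (simp add: power_mult_distrib mult_ac)
    also have "len m powr 2 * len m powr - \<sigma> = len m powr - e"
      by (simp add: powr_add[symmetric] e_def)
    also have "\<dots> \<le> 1 / (real_of_int L0 powr e * 64 ^ m)"
      using l n0 len by (simp add: powr_minus_divide L0_def frac_le)
    finally have "(len (Suc m))\<^sup>2 * (len m powr - \<sigma>) \<le> (ratio m)\<^sup>2 * (1 / (real_of_int L0 powr e * 64 ^ m))"
      by (simp add: mult_left_mono)
    moreover have "(real_of_int (ratio m))\<^sup>2 = (real_of_int K)\<^sup>2 * 4 ^ m"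
      by (simp add: ratio_def power_mult_distrib power_even_eq[symmetric]) (simp add: power_mult)
    moreover have "(64 :: real) ^ m = 4 ^ m * 16 ^ m" by (simp flip: power_mult_distrib)
    ultimately have "(len (Suc m))\<^sup>2 * (len m powr - \<sigma>) \<le> (real_of_int K)\<^sup>2 / real_of_int L0 powr e / 16 ^ m"
      by simp
    then have "25 * lam * ((len (Suc m))\<^sup>2 * (len m powr - \<sigma>)) \<le>
        25 * lam * ((real_of_int K)\<^sup>2 / real_of_int L0 powr e / 16 ^ m)"
      using assms by (intro mult_left_mono) auto
    also have "\<dots> = (25 * lam * (real_of_int K)\<^sup>2 / real_of_int L0 powr e) / 16 ^ m" by simp
    also have "\<dots> \<le> (k / 32) / 16 ^ m"
      using n0 k by (intro divide_right_mono) (auto simp: L0_def field_simps)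
    finally have 1: "25 * lam * ((len (Suc m))\<^sup>2 * (len m powr - \<sigma>)) \<le> (k / 32) / 16 ^ m" .
    have "81 * real_of_int (ratio m) ^ 4 * (k / 16 ^ m)\<^sup>2 = (81 * real_of_int K ^ 4 * k) * k / 16 ^ m"
    proof -
      have "((2 :: real) ^ m) ^ 4 = 16 ^ m" by (simp add: mult.commute[of m] flip: power_mult) (simp add: power_mult)
      then show ?thesis by (simp add: ratio_def power_mult_distrib power2_eq_square)
    qed
    also have "81 * real_of_int K ^ 4 * k = 1 / 32" using n by (simp add: k_def K_def)
    finally have 2: "81 * real_of_int (ratio m) ^ 4 * (k / 16 ^ m)\<^sup>2 = (k / 32) / 16 ^ m" by simp
    have "25 * (len (Suc m))\<^sup>2 * (lam * len m powr - \<sigma>) = 25 * lam * ((len (Suc m))\<^sup>2 * (len m powr - \<sigma>))"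
      by (simp only: mult_ac)
    moreover have "(k / 32) / 16 ^ m + (k / 32) / 16 ^ m = k / 16 ^ Suc m" by simp
    ultimately show ?thesis
      using 1 2 unfolding of_int_mult of_int_power of_int_numeral by linarith
  qed
  show thesis
    by (rule that[OF scales_axioms k], rule witnessed_bad) (use assms k main in auto)
qed

section \<open>Marked points in cells\<close>

lemma nn_integral_uniform_powr:
  assumes "q < (1::real)"
  shows "(\<integral>\<^sup>+t. ennreal (t powr - q) \<partial>uniform_measure lborel {0<..<1}) = ennreal (1 / (1 - q))"
proof -
  have "((\<lambda>t. t powr - q) has_integral (1 powr (- q + 1) / (- q + 1))) {0..1::real}"
    using assms by (intro has_integral_powr_from_0) auto
  then have "((\<lambda>t. indicator {0..1} t * t powr - q) has_integral (1 / (1 - q))) UNIV"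
    by (subst (asm) has_integral_restrict_UNIV[symmetric], elim has_integral_eq[rotated, THEN has_integral_eq_rhs])
      (auto simp: indicator_def)
  then have "(\<integral>\<^sup>+t. ennreal (indicator {0..1} t * t powr - q) \<partial>lborel) = ennreal (1 / (1 - q))"
    by (intro nn_integral_has_integral_lborel) auto
  moreover have "(\<integral>\<^sup>+t. ennreal (indicator {0..1} t * t powr - q) \<partial>lborel) =
      (\<integral>\<^sup>+t. ennreal (t powr - q) * indicator {0<..<1} t \<partial>lborel)"
  proof (rule nn_integral_cong_AE)
    have "AE t in lborel. t \<noteq> (0::real)" "AE t in lborel. t \<noteq> (1::real)"
      by (rule AE_lborel_singleton)+
    then show "AE t in lborel. ennreal (indicator {0..1} t * t powr - q) =
        ennreal (t powr - q) * indicator {0<..<1::real} t"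
      by eventually_elim (auto simp: indicator_def)
  qed
  ultimately show ?thesis by (simp add: nn_integral_uniform_measure divide_ennreal_def)
qed

text \<open>A radius above \<open>a\<close> means a mark below \<open>a powr - \<sigma>\<close>.
  This Pareto tail, with an index above 2, is what makes hubs sparse in the plane.\<close>

lemma nn_integral_uniform_radius:
  assumes "0 < a" "0 < \<sigma>"
  shows "(\<integral>\<^sup>+t. indicator {t. a < t powr (- 1 / \<sigma>)} t \<partial>uniform_measure lborel {0<..<1::real})
    \<le> ennreal (a powr - \<sigma>)"
proof -
  have "t < a powr - \<sigma>" if "0 < t" "a < t powr (- 1 / \<sigma>)" for t
  proof -
    have "(t powr (- 1 / \<sigma>)) powr - \<sigma> < a powr - \<sigma>"
      using that assms by (intro powr_less_mono2_neg) auto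
    then show ?thesis using that assms by (simp add: powr_powr)
  qed
  then have sub: "{0<..<1} \<inter> {t. a < t powr (- 1 / \<sigma>)} \<subseteq> {0..a powr - \<sigma>}" by force
  have "(\<integral>\<^sup>+t. indicator {t. a < t powr (- 1 / \<sigma>)} t \<partial>uniform_measure lborel {0<..<1::real}) =
      emeasure (uniform_measure lborel {0<..<1::real}) {t. a < t powr (- 1 / \<sigma>)}"
    by (subst nn_integral_indicator) auto
  also have "\<dots> = emeasure lborel ({0<..<1} \<inter> {t. a < t powr (- 1 / \<sigma>)})"
    by (subst emeasure_uniform_measure) (auto simp: divide_ennreal_def)
  also have "\<dots> \<le> emeasure lborel {0..a powr - \<sigma>}" by (rule emeasure_mono[OF sub]) auto
  also have "\<dots> = ennreal (a powr - \<sigma>)" by simp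
  finally show ?thesis .
qed

text \<open>The Poisson law enters only through the expected product of the counts of distinct
  cells, each of unit area. Counts are series of indicators over the enumerated vertices, with
  values in \<open>ennreal\<close>, so that sums and expectations can be exchanged freely.\<close>

locale marked_cells = prob_space M for M :: "'w measure" +
  fixes lam :: real and cell :: "nat \<Rightarrow> 'w \<Rightarrow> int \<times> int" and mark :: "nat \<Rightarrow> 'w \<Rightarrow> real"
  assumes lam_nonneg: "0 \<le> lam"
    and measurable_cell [measurable]: "\<And>i. cell i \<in> measurable M (count_space UNIV)"
    and cell_mark_indep:
      "distr M (Pi\<^sub>M UNIV (\<lambda>_. count_space UNIV) \<Otimes>\<^sub>M Pi\<^sub>M UNIV (\<lambda>_. borel))
         (\<lambda>\<omega>. (\<lambda>i. cell i \<omega>, \<lambda>i. mark i \<omega>)) =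
       distr M (Pi\<^sub>M UNIV (\<lambda>_. count_space UNIV)) (\<lambda>\<omega> i. cell i \<omega>) \<Otimes>\<^sub>M
       distr M (Pi\<^sub>M UNIV (\<lambda>_. borel)) (\<lambda>\<omega> i. mark i \<omega>)"
    and mark_indep: "indep_vars (\<lambda>_. borel) mark UNIV"
    and mark_uniform: "\<And>i. distr M borel (mark i) = uniform_measure lborel {0<..<1}"
    and cell_counts: "\<And>F. finite F \<Longrightarrow>
      (\<integral>\<^sup>+\<omega>. (\<Prod>c\<in>F. \<Sum>i. indicator {c} (cell i \<omega>)) \<partial>M) = ennreal lam ^ card F"
begin

lemma measurable_mark [measurable]: "mark i \<in> borel_measurable M"
  using mark_indep by (auto simp: indep_vars_def)

lemma measurable_cell_indicator [measurable]:
  "(\<lambda>\<omega>. indicator A (cell i \<omega>) :: ennreal) \<in> borel_measurable M"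
  by (rule measurable_compose[OF measurable_cell]) simp

lemma nn_integral_mark:
  assumes [measurable]: "\<phi> \<in> borel_measurable borel"
  shows "(\<integral>\<^sup>+\<omega>. \<phi> (mark i \<omega>) \<partial>M) = (\<integral>\<^sup>+t. \<phi> t \<partial>uniform_measure lborel {0<..<1})"
  unfolding mark_uniform[of i, symmetric] by (rule nn_integral_distr[symmetric]) auto

text \<open>Distinct cells involve disjoint, hence independent, families of marks.\<close>

lemma nn_integral_fixed_cells:
  fixes \<phi> :: "int \<times> int \<Rightarrow> real \<Rightarrow> ennreal"
  assumes F: "finite F" and [measurable]: "\<And>c. \<phi> c \<in> borel_measurable borel"
  shows "(\<integral>\<^sup>+\<omega>. (\<Prod>c\<in>F. \<Sum>i. indicator {c} (z i) * \<phi> c (mark i \<omega>)) \<partial>M) =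
    (\<Prod>c\<in>F. \<Sum>i. indicator {c} (z i)) * (\<Prod>c\<in>F. \<integral>\<^sup>+t. \<phi> c t \<partial>uniform_measure lborel {0<..<1})"
proof -
  let ?K = "\<lambda>c. {i. z i = c}"
  have "indep_vars (\<lambda>c. Pi\<^sub>M (?K c) (\<lambda>_. borel)) (\<lambda>c \<omega>. restrict (\<lambda>i. mark i \<omega>) (?K c)) F"
    using mark_indep by (rule indep_vars_restrict) (auto simp: disjoint_family_on_def)
  then have "indep_vars (\<lambda>_. borel)
      (\<lambda>c \<omega>. (\<lambda>y. \<Sum>i. if z i = c then \<phi> c (y i) else 0) (restrict (\<lambda>i. mark i \<omega>) (?K c))) F"
  proof (rule indep_vars_compose2)
    fix c
    have "(\<lambda>y. if z i = c then \<phi> c (y i) else 0) \<in> borel_measurable (Pi\<^sub>M (?K c) (\<lambda>_. borel))" for i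
      by (cases "z i = c") (auto intro: measurable_compose[OF measurable_component_singleton])
    then show "(\<lambda>y. \<Sum>i. if z i = c then \<phi> c (y i) else 0) \<in> borel_measurable (Pi\<^sub>M (?K c) (\<lambda>_. borel))"
      by simp
  qed
  moreover have "(\<lambda>y. \<Sum>i. if z i = c then \<phi> c (y i) else 0) (restrict (\<lambda>i. mark i \<omega>) (?K c)) =
      (\<Sum>i. indicator {c} (z i) * \<phi> c (mark i \<omega>))" for c \<omega>
    by (auto intro!: suminf_cong)
  ultimately have "indep_vars (\<lambda>_. borel) (\<lambda>c \<omega>. \<Sum>i. indicator {c} (z i) * \<phi> c (mark i \<omega>)) F" by simp
  then have "(\<integral>\<^sup>+\<omega>. (\<Prod>c\<in>F. \<Sum>i. indicator {c} (z i) * \<phi> c (mark i \<omega>)) \<partial>M) =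
      (\<Prod>c\<in>F. \<integral>\<^sup>+\<omega>. (\<Sum>i. indicator {c} (z i) * \<phi> c (mark i \<omega>)) \<partial>M)"
    by (intro indep_vars_nn_integral F) auto
  also have "\<dots> = (\<Prod>c\<in>F. (\<Sum>i. indicator {c} (z i)) * (\<integral>\<^sup>+t. \<phi> c t \<partial>uniform_measure lborel {0<..<1}))"
    by (intro prod.cong refl) (simp add: nn_integral_suminf nn_integral_cmult nn_integral_mark)
  finally show ?thesis by (simp add: prod.distrib)
qed

text \<open>A Campbell formula for distinct cells: as marks are independent of positions, Fubini
  allows the cells to be frozen while the marks are integrated out; what remains is the expected
  product of the counts.\<close>

lemma nn_integral_marked_cells:
  fixes \<phi> :: "int \<times> int \<Rightarrow> real \<Rightarrow> ennreal"
  assumes F: "finite F" and \<phi> [measurable]: "\<And>c. \<phi> c \<in> borel_measurable borel"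
  shows "(\<integral>\<^sup>+\<omega>. (\<Prod>c\<in>F. \<Sum>i. indicator {c} (cell i \<omega>) * \<phi> c (mark i \<omega>)) \<partial>M) =
    (\<Prod>c\<in>F. ennreal lam * (\<integral>\<^sup>+t. \<phi> c t \<partial>uniform_measure lborel {0<..<1}))"
proof -
  let ?S = "Pi\<^sub>M UNIV (\<lambda>_. count_space UNIV) :: (nat \<Rightarrow> int \<times> int) measure"
  let ?T = "Pi\<^sub>M UNIV (\<lambda>_. borel) :: (nat \<Rightarrow> real) measure"
  let ?Z = "\<lambda>\<omega> i. cell i \<omega>" and ?U = "\<lambda>\<omega> i. mark i \<omega>"
  define G where "G zy = (\<Prod>c\<in>F. \<Sum>i. indicator {c} (fst zy i) * \<phi> c (snd zy i))"
    for zy :: "(nat \<Rightarrow> int \<times> int) \<times> (nat \<Rightarrow> real)"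
  have Z [measurable]: "?Z \<in> measurable M ?S" by (rule measurable_PiM_single') auto
  have U [measurable]: "?U \<in> measurable M ?T" by (rule measurable_PiM_single') auto
  have 1 [measurable]: "(\<lambda>zy. fst zy i) \<in> measurable (?S \<Otimes>\<^sub>M ?T) (count_space UNIV)" for i
    by (rule measurable_compose[OF measurable_fst measurable_component_singleton]) simp
  have 2 [measurable]: "(\<lambda>zy. snd zy i) \<in> measurable (?S \<Otimes>\<^sub>M ?T) borel" for i
    by (rule measurable_compose[OF measurable_snd measurable_component_singleton]) simp
  have 3 [measurable]: "(\<lambda>zy. \<phi> c (snd zy i)) \<in> borel_measurable (?S \<Otimes>\<^sub>M ?T)" for c i
    by (rule measurable_compose[OF 2 \<phi>])
  have 4 [measurable]: "(\<lambda>zy. indicator {c} (fst zy i) :: ennreal) \<in> borel_measurable (?S \<Otimes>\<^sub>M ?T)" for c i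
    by (rule measurable_compose[OF 1]) simp
  have G [measurable]: "G \<in> borel_measurable (?S \<Otimes>\<^sub>M ?T)"
    unfolding G_def by measurable
  interpret U: prob_space "distr M ?T ?U" by (rule prob_space_distr) simp
  have "(\<integral>\<^sup>+\<omega>. G (?Z \<omega>, ?U \<omega>) \<partial>M) = (\<integral>\<^sup>+zy. G zy \<partial>distr M (?S \<Otimes>\<^sub>M ?T) (\<lambda>\<omega>. (?Z \<omega>, ?U \<omega>)))"
    by (subst nn_integral_distr) auto
  also have "distr M (?S \<Otimes>\<^sub>M ?T) (\<lambda>\<omega>. (?Z \<omega>, ?U \<omega>)) = distr M ?S ?Z \<Otimes>\<^sub>M distr M ?T ?U"
    by (rule cell_mark_indep)
  also have "(\<integral>\<^sup>+zy. G zy \<partial>\<dots>) = (\<integral>\<^sup>+z. \<integral>\<^sup>+y. G (z, y) \<partial>distr M ?T ?U \<partial>distr M ?S ?Z)"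
    by (rule U.nn_integral_fst[symmetric]) measurable
  also have "\<dots> = (\<integral>\<^sup>+\<omega>. \<integral>\<^sup>+\<omega>'. G (?Z \<omega>, ?U \<omega>') \<partial>M \<partial>M)"
  proof -
    have "(\<lambda>y. G (z, y)) \<in> borel_measurable ?T" for z
      by (rule measurable_compose[OF measurable_Pair1' G]) (simp add: space_PiM)
    then show ?thesis by (simp add: nn_integral_distr)
  qed
  also have "\<dots> = (\<integral>\<^sup>+\<omega>. (\<Prod>c\<in>F. \<Sum>i. indicator {c} (cell i \<omega>)) *
      (\<Prod>c\<in>F. \<integral>\<^sup>+t. \<phi> c t \<partial>uniform_measure lborel {0<..<1}) \<partial>M)"
    using nn_integral_fixed_cells[OF F \<phi>] by (simp add: G_def)
  also have "\<dots> = ennreal lam ^ card F * (\<Prod>c\<in>F. \<integral>\<^sup>+t. \<phi> c t \<partial>uniform_measure lborel {0<..<1})"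
    by (subst nn_integral_multc) (simp_all add: F cell_counts)
  finally show ?thesis by (simp add: G_def prod.distrib)
qed

definition radii :: "real \<Rightarrow> 'w \<Rightarrow> int \<times> int \<Rightarrow> real set" where
  "radii \<sigma> \<omega> c = {mark i \<omega> powr (- 1 / \<sigma>) | i. cell i \<omega> = c}"

lemma ball_radii: "(\<exists>r\<in>radii \<sigma> \<omega> c. a < r) \<longleftrightarrow> (\<exists>i. cell i \<omega> = c \<and> a < mark i \<omega> powr (- 1 / \<sigma>))"
  by (auto simp: radii_def)

text \<open>Markov's inequality for the product, over the cells of \<open>l\<close>, of the number
  of vertices whose radius exceeds the threshold: on the event, every such number is at least
  1.\<close>

lemma emeasure_witness:
  assumes \<sigma>: "0 < \<sigma>" and l: "distinct (map fst l)" "\<forall>(c, a)\<in>set l. 0 < a"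
  shows "{\<omega>\<in>space M. \<forall>(c, a)\<in>set l. \<exists>r\<in>radii \<sigma> \<omega> c. a < r} \<in> sets M"
    and "emeasure M {\<omega>\<in>space M. \<forall>(c, a)\<in>set l. \<exists>r\<in>radii \<sigma> \<omega> c. a < r} \<le>
      ennreal (\<Prod>(c, a)\<leftarrow>l. lam * a powr - \<sigma>)"
proof -
  let ?A = "{\<omega>\<in>space M. \<forall>(c, a)\<in>set l. \<exists>r\<in>radii \<sigma> \<omega> c. a < r}"
  \<comment> \<open>The threshold of a cell is well defined because the cells of \<open>l\<close>
    are distinct.\<close>
  define h where "h c = the (map_of l c)" for c
  have h: "h c = a" if "(c, a) \<in> set l" for c a using that l(1) by (simp add: h_def)
  define \<phi> where "\<phi> c t = (indicator {t. h c < t powr (- 1 / \<sigma>)} t :: ennreal)" for c t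
  have [measurable]: "\<phi> c \<in> borel_measurable borel" for c unfolding \<phi>_def by measurable
  let ?F = "fst ` set l"
  show A: "?A \<in> sets M" unfolding ball_radii by measurable
  have ge1: "1 \<le> (\<Sum>i. indicator {c} (cell i \<omega>) * \<phi> c (mark i \<omega>))"
    if mem: "(c, a) \<in> set l" and ex: "\<exists>r\<in>radii \<sigma> \<omega> c. a < r" for \<omega> c a
  proof -
    obtain i where i: "cell i \<omega> = c" "a < mark i \<omega> powr (- 1 / \<sigma>)" using ex by (auto simp: radii_def)
    have "1 = (\<Sum>j\<in>{i}. indicator {c} (cell j \<omega>) * \<phi> c (mark j \<omega>))"
      using i h[OF mem] by (simp add: \<phi>_def)
    also have "\<dots> \<le> (\<Sum>i. indicator {c} (cell i \<omega>) * \<phi> c (mark i \<omega>))"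
      by (rule sum_le_suminf) auto
    finally show ?thesis .
  qed
  have "emeasure M ?A = (\<integral>\<^sup>+\<omega>. indicator ?A \<omega> \<partial>M)" using A by simp
  also have "\<dots> \<le> (\<integral>\<^sup>+\<omega>. (\<Prod>c\<in>?F. \<Sum>i. indicator {c} (cell i \<omega>) * \<phi> c (mark i \<omega>)) \<partial>M)"
  proof (rule nn_integral_mono)
    fix \<omega>
    show "indicator ?A \<omega> \<le> (\<Prod>c\<in>?F. \<Sum>i. indicator {c} (cell i \<omega>) * \<phi> c (mark i \<omega>))"
    proof (cases "\<omega> \<in> ?A")
      case True
      have "(\<Prod>c\<in>?F. 1 :: ennreal) \<le> (\<Prod>c\<in>?F. \<Sum>i. indicator {c} (cell i \<omega>) * \<phi> c (mark i \<omega>))"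
      proof (rule prod_mono_ennreal)
        fix c assume "c \<in> ?F"
        then obtain a where a: "(c, a) \<in> set l" by auto
        then have "\<exists>r\<in>radii \<sigma> \<omega> c. a < r" using True by auto
        with a show "1 \<le> (\<Sum>i. indicator {c} (cell i \<omega>) * \<phi> c (mark i \<omega>))" by (rule ge1)
      qed
      then show ?thesis using True by simp
    qed simp
  qed
  also have "\<dots> = (\<Prod>c\<in>?F. ennreal lam * (\<integral>\<^sup>+t. \<phi> c t \<partial>uniform_measure lborel {0<..<1}))"
    by (rule nn_integral_marked_cells) auto
  also have "\<dots> \<le> (\<Prod>c\<in>?F. ennreal lam * ennreal (h c powr - \<sigma>))"
  proof (intro prod_mono_ennreal mult_left_mono)
    fix c assume "c \<in> ?F"
    then have "0 < h c" using h l(2) by auto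
    then show "(\<integral>\<^sup>+t. \<phi> c t \<partial>uniform_measure lborel {0<..<1}) \<le> ennreal (h c powr - \<sigma>)"
      unfolding \<phi>_def using \<sigma> by (rule nn_integral_uniform_radius)
  qed auto
  also have "\<dots> = ennreal (\<Prod>c\<in>?F. lam * h c powr - \<sigma>)"
    by (simp add: lam_nonneg prod_ennreal ennreal_mult[symmetric])
  also have "(\<Prod>c\<in>?F. lam * h c powr - \<sigma>) = (\<Prod>(c, a)\<leftarrow>l. lam * a powr - \<sigma>)"
  proof -
    have "(\<Prod>c\<in>?F. lam * h c powr - \<sigma>) = (\<Prod>c\<in>set (map fst l). lam * h c powr - \<sigma>)" by simp
    also have "\<dots> = (\<Prod>c\<leftarrow>map fst l. lam * h c powr - \<sigma>)"
      using l(1) by (rule prod.distinct_set_conv_list)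
    also have "\<dots> = (\<Prod>(c, a)\<leftarrow>l. lam * a powr - \<sigma>)"
      unfolding map_map by (intro arg_cong[of _ _ prod_list] map_cong) (auto simp: h)
    finally show ?thesis .
  qed
  finally show "emeasure M ?A \<le> ennreal (\<Prod>(c, a)\<leftarrow>l. lam * a powr - \<sigma>)" .
qed

text \<open>\<open>P\<close> is an arbitrary predicate, so its event is enclosed in a measurable
  one, the union of the events of the witnessing lists.\<close>

lemma witnessed_emeasure:
  assumes \<sigma>: "0 < \<sigma>" and "witnessed (\<lambda>a. lam * a powr - \<sigma>) S p P"
  obtains W where "W \<in> sets M" "emeasure M W \<le> ennreal p" "\<And>\<omega>. \<omega> \<in> space M \<Longrightarrow> P (radii \<sigma> \<omega>) \<Longrightarrow> \<omega> \<in> W"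
proof -
  obtain ls where ls: "\<forall>l\<in>set ls. distinct (map fst l) \<and> fst ` set l \<subseteq> S \<and> (\<forall>(c, a)\<in>set l. 0 < a)"
      "\<forall>Rad. P Rad \<longrightarrow> (\<exists>l\<in>set ls. \<forall>(c, a)\<in>set l. \<exists>r\<in>Rad c. a < r)"
      "(\<Sum>l\<leftarrow>ls. \<Prod>(c, a)\<leftarrow>l. lam * a powr - \<sigma>) \<le> p"
    using assms(2) unfolding witnessed_def by blast
  define A where "A l = {\<omega>\<in>space M. \<forall>(c, a)\<in>set l. \<exists>r\<in>radii \<sigma> \<omega> c. a < r}" for l
  have A: "A l \<in> sets M" "emeasure M (A l) \<le> ennreal (\<Prod>(c, a)\<leftarrow>l. lam * a powr - \<sigma>)" if "l \<in> set ls" for l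
    unfolding A_def using emeasure_witness[OF \<sigma>, of l] ls(1) that by auto
  have nonneg: "0 \<le> (\<Prod>(c, a)\<leftarrow>l. lam * a powr - \<sigma>)" for l :: "((int \<times> int) \<times> real) list"
    by (induction l) (auto simp: lam_nonneg)
  have sum: "emeasure M (\<Union>l\<in>set ks. A l) \<le> ennreal (\<Sum>l\<leftarrow>ks. \<Prod>(c, a)\<leftarrow>l. lam * a powr - \<sigma>)"
    if "set ks \<subseteq> set ls" for ks
    using that
  proof (induction ks)
    case (Cons k ks)
    have "emeasure M (\<Union>l\<in>set (k # ks). A l) \<le> emeasure M (A k) + emeasure M (\<Union>l\<in>set ks. A l)"
      using Cons.prems A by (simp, intro emeasure_subadditive) (auto intro!: sets.finite_UN)
    also have "\<dots> \<le> ennreal (\<Prod>(c, a)\<leftarrow>k. lam * a powr - \<sigma>) + ennreal (\<Sum>l\<leftarrow>ks. \<Prod>(c, a)\<leftarrow>l. lam * a powr - \<sigma>)"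
      using Cons A by (intro add_mono) auto
    also have "\<dots> = ennreal (\<Sum>l\<leftarrow>k # ks. \<Prod>(c, a)\<leftarrow>l. lam * a powr - \<sigma>)"
      by (simp add: nonneg, subst ennreal_plus) (auto intro!: sum_list_nonneg nonneg)
    finally show ?case .
  qed simp
  show thesis
  proof
    show "(\<Union>l\<in>set ls. A l) \<in> sets M" using A by (intro sets.finite_UN) auto
    show "emeasure M (\<Union>l\<in>set ls. A l) \<le> ennreal p"
      using sum[of ls] ls(3) by (meson ennreal_leI order_refl order_trans)
    show "\<omega> \<in> (\<Union>l\<in>set ls. A l)" if "\<omega> \<in> space M" "P (radii \<sigma> \<omega>)" for \<omega>
      using that ls(2) by (auto simp: A_def)
  qed
qed

end

section \<open>Sums over long edges\<close>

text \<open>Four sides of \<open>2 * k + 1\<close> cells each, the corners being counted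
  twice.\<close>

lemma card_sphere:
  "finite {d. cdist c d = int k}" "card {d. cdist c d = int k} \<le> 8 * k + 4"
proof -
  let ?E = "{- int k, int k}" and ?B = "{- int k..int k}"
  have sub: "{d. cdist c d = int k} \<subseteq>
      (\<lambda>(i, j). (fst c + i, snd c + j)) ` (?E \<times> ?B \<union> ?B \<times> ?E)"
  proof
    fix d assume "d \<in> {d. cdist c d = int k}"
    then have "(fst d - fst c, snd d - snd c) \<in> ?E \<times> ?B \<union> ?B \<times> ?E"
      by (auto simp: cdist_def max_def split: if_splits)
    then show "d \<in> (\<lambda>(i, j). (fst c + i, snd c + j)) ` (?E \<times> ?B \<union> ?B \<times> ?E)"
      by (rule rev_image_eqI) simp
  qed
  then show "finite {d. cdist c d = int k}" by (rule finite_subset) simp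
  have "card {d. cdist c d = int k} \<le> card (?E \<times> ?B \<union> ?B \<times> ?E)"
    using sub by (intro surj_card_le) auto
  also have "\<dots> \<le> card (?E \<times> ?B) + card (?B \<times> ?E)" by (rule card_Un_le)
  also have "\<dots> \<le> 8 * k + 4"
  proof -
    have "card ?E \<le> 2" by (simp add: card_insert_le_m1)
    then have "card ?E * card ?B \<le> 2 * card ?B" by (rule mult_right_mono) simp
    moreover have "card ?B = 2 * k + 1" by simp
    ultimately show ?thesis
      unfolding card_cartesian_product using mult.commute[of "card ?B" "card ?E"] by linarith
  qed
  finally show "card {d. cdist c d = int k} \<le> 8 * k + 4" .
qed

lemma nn_integral_cdist_le:
  "(\<integral>\<^sup>+d. h (nat (cdist c d)) \<partial>count_space UNIV) \<le> (\<Sum>k. ennreal (8 * real k + 4) * h k)"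
proof -
  have "(\<integral>\<^sup>+d. h (nat (cdist c d)) \<partial>count_space UNIV) =
      (\<integral>\<^sup>+d. (\<Sum>k. h k * indicator {d. cdist c d = int k} d) \<partial>count_space UNIV)"
  proof (rule nn_integral_cong)
    fix d
    have "(\<Sum>k. h k * indicator {d. cdist c d = int k} d) =
        (\<Sum>k\<in>{nat (cdist c d)}. h k * indicator {d. cdist c d = int k} d)"
      by (rule suminf_finite) (auto simp: indicator_def)
    then show "h (nat (cdist c d)) = (\<Sum>k. h k * indicator {d. cdist c d = int k} d)" by simp
  qed
  also have "\<dots> = (\<Sum>k. h k * emeasure (count_space UNIV) {d. cdist c d = int k})"
    by (subst nn_integral_suminf) (simp_all add: nn_integral_cmult_indicator)
  also have "\<dots> \<le> (\<Sum>k. ennreal (8 * real k + 4) * h k)"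
  proof (rule suminf_le)
    fix k
    have "emeasure (count_space UNIV) {d. cdist c d = int k} = of_nat (card {d. cdist c d = int k})"
      using card_sphere(1) by (simp add: emeasure_count_space)
    also have "\<dots> = ennreal (real (card {d. cdist c d = int k}))" by (simp add: ennreal_of_nat_eq_real_of_nat)
    also have "\<dots> \<le> ennreal (8 * real k + 4)"
      using card_sphere(2)[of c k] by (intro ennreal_leI) linarith
    finally show "h k * emeasure (count_space UNIV) {d. cdist c d = int k} \<le> ennreal (8 * real k + 4) * h k"
      by (subst mult.commute, rule mult_right_mono) auto
  qed auto
  finally show ?thesis .
qed

text \<open>Spheres of cells grow linearly with the radius, so the tail is compared with the series
  of \<open>k powr (1 - \<tau>)\<close>, which converges for \<tau> > 2. The bound is uniform in the
  centre \<open>c\<close>.\<close>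

lemma radial_sum_bounded:
  fixes a b \<tau> :: real and N :: int
  assumes "0 \<le> a" "0 \<le> b" "2 < \<tau>"
  obtains C :: real where "0 \<le> C"
    "\<And>c. (\<integral>\<^sup>+d. ennreal (b * of_bool (cdist c d \<le> N) + a * cdist c d powr - \<tau>) \<partial>count_space UNIV) \<le> ennreal C"
proof -
  define g where "g k = (8 * real k + 4) * (b * of_bool (int k \<le> N) + a * real k powr - \<tau>)" for k
  have g0: "0 \<le> g k" for k using assms by (simp add: g_def)
  have s1: "summable (\<lambda>k. (8 * real k + 4) * (b * of_bool (int k \<le> N)))"
  proof (rule summable_finite[of "{..nat N}"])
    fix k assume "k \<notin> {..nat N}"
    then have "\<not> int k \<le> N" by auto
    then show "(8 * real k + 4) * (b * of_bool (int k \<le> N)) = 0" by simp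
  qed simp
  have "summable (\<lambda>k. real k powr (1 - \<tau>))" using assms by (simp add: summable_real_powr_iff)
  then have "summable (\<lambda>k. 12 * a * real k powr (1 - \<tau>))" by (rule summable_mult)
  then have s2: "summable (\<lambda>k. (8 * real k + 4) * (a * real k powr - \<tau>))"
  proof (rule summable_comparison_test'[where N = 0])
    fix k :: nat
    have "(8 * real k + 4) * real k powr - \<tau> \<le> 12 * real k powr (1 - \<tau>)"
    \<comment> \<open>At \<open>k = 0\<close> both sides vanish, as
      \<open>0 powr x = 0\<close>.\<close>
    proof (cases "k = 0")
      case False
      then have "(8 * real k + 4) * real k powr - \<tau> \<le> (12 * real k) * real k powr - \<tau>"
        by (intro mult_right_mono) auto
      also have "\<dots> = 12 * real k powr (1 - \<tau>)"
        using False by (simp add: powr_diff powr_minus field_simps)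
      finally show ?thesis .
    qed simp
    from mult_left_mono[OF this assms(1)]
    show "norm ((8 * real k + 4) * (a * real k powr - \<tau>)) \<le> 12 * a * real k powr (1 - \<tau>)"
      using assms by (simp add: mult_ac)
  qed
  have sum: "summable g" using summable_add[OF s1 s2] by (simp add: g_def[abs_def] distrib_left)
  show thesis
  proof
    show "0 \<le> suminf g" using sum g0 by (intro suminf_nonneg) auto
    fix c
    have "(\<integral>\<^sup>+d. ennreal (b * of_bool (cdist c d \<le> N) + a * cdist c d powr - \<tau>) \<partial>count_space UNIV) =
        (\<integral>\<^sup>+d. (\<lambda>k. ennreal (b * of_bool (int k \<le> N) + a * real k powr - \<tau>)) (nat (cdist c d)) \<partial>count_space UNIV)"
      by simp
    also have "\<dots> \<le> (\<Sum>k. ennreal (8 * real k + 4) * ennreal (b * of_bool (int k \<le> N) + a * real k powr - \<tau>))"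
      by (rule nn_integral_cdist_le)
    also have "\<dots> = (\<Sum>k. ennreal (g k))"
      using assms by (intro suminf_cong) (simp add: g_def ennreal_mult)
    also have "\<dots> = ennreal (suminf g)" using g0 sum by (rule suminf_ennreal2)
    finally show "(\<integral>\<^sup>+d. ennreal (b * of_bool (cdist c d \<le> N) + a * cdist c d powr - \<tau>) \<partial>count_space UNIV)
        \<le> ennreal (suminf g)" .
  qed
qed

lemma bij_enumerate_cells: "bij_betw (from_nat_into UNIV) UNIV (UNIV :: (int \<times> int) set)"
  by (intro bij_betw_from_nat_into) (auto simp: finite_prod)

lemma emeasure_UN_cells_le:
  fixes A :: "int \<times> int \<Rightarrow> 'w set"
  assumes "\<And>c. A c \<in> sets M"
  shows "emeasure M (\<Union>c. A c) \<le> (\<integral>\<^sup>+c. emeasure M (A c) \<partial>count_space UNIV)"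
proof -
  let ?e = "from_nat_into (UNIV :: (int \<times> int) set)"
  have "(\<Union>c. A c) = (\<Union>n. A (?e n))"
    using bij_betw_imp_surj_on[OF bij_enumerate_cells] by (metis UN_extend_simps(10))
  also have "emeasure M \<dots> \<le> (\<Sum>n. emeasure M (A (?e n)))"
    by (intro emeasure_subadditive_countably image_subsetI assms)
  also have "\<dots> = (\<integral>\<^sup>+c. emeasure M (A c) \<partial>count_space UNIV)"
    using nn_integral_bij_count_space[OF bij_enumerate_cells, of "\<lambda>c. emeasure M (A c)"]
    by (simp add: nn_integral_count_space_nat)
  finally show ?thesis .
qed

section \<open>Edges that carry energy, and hubs near the origin\<close>

text \<open>In \<open>long_edge_bound\<close>, both radii are below the cell distance. The 2 added
  to \<tau> in the exponent pays for the squared length, and \<open>q < 1\<close> makes the weights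
  \<open>mark i \<omega> powr - q\<close> integrable. Summed over \<open>i\<close> and
  \<open>j\<close>, the right-hand side becomes a pair moment of the point process.\<close>

locale cell_graph = marked_cells M lam cell mark + scales L0 K
  for M :: "'w measure" and lam cell mark and L0 K :: int +
  fixes edge :: "nat \<Rightarrow> nat \<Rightarrow> 'w \<Rightarrow> bool" and \<sigma> \<tau> q \<kappa> k0 :: real
  assumes exponents: "2 < \<sigma>" "2 < \<tau>" "q < 1" "0 \<le> \<kappa>" "0 \<le> k0"
    and witnessed_bad: "\<And>m b. witnessed (\<lambda>a. lam * a powr - \<sigma>) {c. cdist (box m c) b \<le> 2}
      (k0 / 16 ^ m) (\<lambda>Rad. bad m Rad b)"
    and measurable_edge [measurable]: "\<And>i j. i \<noteq> j \<Longrightarrow> Measurable.pred M (edge i j)"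
    and long_edge_bound: "\<And>i j c d. i \<noteq> j \<Longrightarrow> L0 < cdist c d \<Longrightarrow>
      (\<integral>\<^sup>+\<omega>. indicator {c} (cell i \<omega>) * indicator {d} (cell j \<omega>) *
         of_bool (edge i j \<omega> \<and> mark i \<omega> powr (- 1 / \<sigma>) < cdist c d \<and> mark j \<omega> powr (- 1 / \<sigma>) < cdist c d) \<partial>M)
      \<le> ennreal (\<kappa> * cdist c d powr - (\<tau> + 2)) *
        (\<integral>\<^sup>+\<omega>. (indicator {c} (cell i \<omega>) * ennreal (mark i \<omega> powr - q)) *
           (indicator {d} (cell j \<omega>) * ennreal (mark j \<omega> powr - q)) \<partial>M)"
begin

text \<open>These are the edges along which the potential may vary: those of length at most
  \<open>L0\<close>, where shortcuts are not taken into account, and those longer than the radii of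
  both ends.\<close>

definition charged :: "nat \<Rightarrow> nat \<Rightarrow> 'w \<Rightarrow> bool" where
  "charged i j \<omega> \<longleftrightarrow> i \<noteq> j \<and> edge i j \<omega> \<and> cell i \<omega> \<noteq> cell j \<omega> \<and>
     (cdist (cell i \<omega>) (cell j \<omega>) \<le> L0 \<or>
      mark i \<omega> powr (- 1 / \<sigma>) < cdist (cell i \<omega>) (cell j \<omega>) \<and>
      mark j \<omega> powr (- 1 / \<sigma>) < cdist (cell i \<omega>) (cell j \<omega>))"

text \<open>Squared lengths bound the energy of a function that is Lipschitz for the cell distance.
  An edge is booked in the cell of its first index.\<close>

definition charge :: "int \<times> int \<Rightarrow> 'w \<Rightarrow> ennreal" where
  "charge c \<omega> = (\<Sum>i. \<Sum>j. indicator {c} (cell i \<omega>) * of_bool (charged i j \<omega>) *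
     ennreal ((cdist (cell i \<omega>) (cell j \<omega>))\<^sup>2))"

lemma measurable_cdist [measurable]:
  "(\<lambda>\<omega>. cdist (cell i \<omega>) (cell j \<omega>)) \<in> measurable M (count_space UNIV)"
  by measurable

lemma measurable_charged [measurable]: "Measurable.pred M (charged i j)"
proof (cases "i = j")
  case False
  then show ?thesis unfolding charged_def by measurable
qed (simp add: charged_def[abs_def])

lemma measurable_charge [measurable]: "charge c \<in> borel_measurable M"
  unfolding charge_def by measurable

text \<open>The moment formula for two cells, with sums and expectation exchanged so that bounds for
  single pairs of vertices can be added up.\<close>

lemma pair_moment:
  fixes \<psi> :: "real \<Rightarrow> ennreal"
  assumes "c \<noteq> d" and [measurable]: "\<psi> \<in> borel_measurable borel"
  shows "(\<Sum>i. \<Sum>j. \<integral>\<^sup>+\<omega>. (indicator {c} (cell i \<omega>) * \<psi> (mark i \<omega>)) * (indicator {d} (cell j \<omega>) * \<psi> (mark j \<omega>)) \<partial>M) =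
    (ennreal lam * (\<integral>\<^sup>+t. \<psi> t \<partial>uniform_measure lborel {0<..<1}))\<^sup>2"
proof -
  have "(\<Sum>i. \<Sum>j. \<integral>\<^sup>+\<omega>. (indicator {c} (cell i \<omega>) * \<psi> (mark i \<omega>)) * (indicator {d} (cell j \<omega>) * \<psi> (mark j \<omega>)) \<partial>M) =
      (\<integral>\<^sup>+\<omega>. (\<Sum>i. \<Sum>j. (indicator {c} (cell i \<omega>) * \<psi> (mark i \<omega>)) * (indicator {d} (cell j \<omega>) * \<psi> (mark j \<omega>))) \<partial>M)"
    by (simp add: nn_integral_suminf del: ennreal_suminf_cmult ennreal_suminf_multc)
  also have "\<dots> = (\<integral>\<^sup>+\<omega>. (\<Prod>e\<in>{c, d}. \<Sum>i. indicator {e} (cell i \<omega>) * \<psi> (mark i \<omega>)) \<partial>M)"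
    using assms(1) by simp
  also have "\<dots> = (\<Prod>e\<in>{c, d}. ennreal lam * (\<integral>\<^sup>+t. \<psi> t \<partial>uniform_measure lborel {0<..<1}))"
    by (rule nn_integral_marked_cells) auto
  finally show ?thesis using assms(1) by (simp add: power2_eq_square)
qed

text \<open>Sorting edges by their target cell \<open>d\<close> prepares the exchange of the sum
  over \<open>d\<close> with the expectation.\<close>

lemma charge_eq:
  "charge c \<omega> = (\<integral>\<^sup>+d. (\<Sum>i. \<Sum>j. indicator {c} (cell i \<omega>) * indicator {d} (cell j \<omega>) *
     of_bool (charged i j \<omega>) * ennreal ((cdist c d)\<^sup>2)) \<partial>count_space UNIV)"
proof -
  have single: "(\<integral>\<^sup>+d. indicator {c} (cell i \<omega>) * indicator {d} (cell j \<omega>) *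
      of_bool (charged i j \<omega>) * ennreal ((cdist c d)\<^sup>2) \<partial>count_space UNIV) =
      indicator {c} (cell i \<omega>) * of_bool (charged i j \<omega>) * ennreal ((cdist (cell i \<omega>) (cell j \<omega>))\<^sup>2)" for i j
  proof -
    have "(\<integral>\<^sup>+d. indicator {c} (cell i \<omega>) * indicator {d} (cell j \<omega>) *
      of_bool (charged i j \<omega>) * ennreal ((cdist c d)\<^sup>2) \<partial>count_space UNIV) =
      (\<integral>\<^sup>+d. (indicator {c} (cell i \<omega>) * of_bool (charged i j \<omega>) * ennreal ((cdist (cell i \<omega>) (cell j \<omega>))\<^sup>2)) *
        indicator {cell j \<omega>} d \<partial>count_space UNIV)"
      by (intro nn_integral_cong) (auto simp: indicator_def)
    then show ?thesis by (subst (asm) nn_integral_cmult_indicator) auto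
  qed
  show ?thesis unfolding charge_def
    by (simp add: nn_integral_suminf single del: ennreal_suminf_cmult ennreal_suminf_multc of_int_power)
qed

text \<open>For a target cell within \<open>L0\<close>, there are \<open>lam\<^sup>2\<close> pairs
  on average, each with squared length at most \<open>L0\<^sup>2\<close>. For a target at a larger
  distance D, the decay \<open>D powr - (\<tau> + 2)\<close> leaves \<open>D powr - \<tau>\<close>
  after multiplication by the squared length. Both bounds are summable over the plane.\<close>

lemma charge_bounded:
  obtains C :: real where "0 \<le> C" "\<And>c. (\<integral>\<^sup>+\<omega>. charge c \<omega> \<partial>M) \<le> ennreal C"
proof -
  define m where "m = (lam / (1 - q))\<^sup>2"
  have m: "(ennreal lam * ennreal (1 / (1 - q)))\<^sup>2 = ennreal m"
    using lam_nonneg exponents by (simp add: m_def power2_eq_square flip: ennreal_mult)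
  obtain C where C: "0 \<le> C"
    "\<And>c. (\<integral>\<^sup>+d. ennreal (lam\<^sup>2 * L0\<^sup>2 * of_bool (cdist c d \<le> L0) + \<kappa> * m * cdist c d powr - \<tau>) \<partial>count_space UNIV) \<le> ennreal C"
    using radial_sum_bounded[of "\<kappa> * m" "lam\<^sup>2 * L0\<^sup>2" \<tau> L0] exponents by (auto simp: m_def)
  have dbound: "(\<integral>\<^sup>+\<omega>. (\<Sum>i. \<Sum>j. indicator {c} (cell i \<omega>) * indicator {d} (cell j \<omega>) *
      of_bool (charged i j \<omega>) * ennreal ((cdist c d)\<^sup>2)) \<partial>M) \<le>
    ennreal (lam\<^sup>2 * L0\<^sup>2 * of_bool (cdist c d \<le> L0) + \<kappa> * m * cdist c d powr - \<tau>)" for c d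
  proof (cases "c = d")
    case True
    have zero: "indicator {c} (cell i \<omega>) * indicator {d} (cell j \<omega>) * of_bool (charged i j \<omega>) = (0 :: ennreal)" for i j \<omega>
      using True by (auto simp: charged_def indicator_def)
    show ?thesis unfolding zero by simp
  next
    case False
    let ?D = "cdist c d"
    have "(\<integral>\<^sup>+\<omega>. (\<Sum>i. \<Sum>j. indicator {c} (cell i \<omega>) * indicator {d} (cell j \<omega>) *
        of_bool (charged i j \<omega>) * ennreal (?D\<^sup>2)) \<partial>M) =
      (\<Sum>i. \<Sum>j. (\<integral>\<^sup>+\<omega>. indicator {c} (cell i \<omega>) * indicator {d} (cell j \<omega>) *
        of_bool (charged i j \<omega>) \<partial>M)) * ennreal (?D\<^sup>2)"
      by (simp add: nn_integral_suminf nn_integral_multc)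
    also have "\<dots> \<le> ennreal (lam\<^sup>2 * L0\<^sup>2 * of_bool (?D \<le> L0) + \<kappa> * m * ?D powr - \<tau>)"
    proof (cases "?D \<le> L0")
      case True
      have "(\<Sum>i. \<Sum>j. (\<integral>\<^sup>+\<omega>. indicator {c} (cell i \<omega>) * indicator {d} (cell j \<omega>) *
          of_bool (charged i j \<omega>) \<partial>M)) \<le>
        (\<Sum>i. \<Sum>j. \<integral>\<^sup>+\<omega>. (indicator {c} (cell i \<omega>) * 1) * (indicator {d} (cell j \<omega>) * 1) \<partial>M)"
        by (intro suminf_le nn_integral_mono) (auto simp: indicator_def)
      also have "\<dots> = (ennreal lam * (\<integral>\<^sup>+t. 1 \<partial>uniform_measure lborel {0<..<1::real}))\<^sup>2"
        using pair_moment[OF False, of "\<lambda>_. 1"] by simp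
      also have "\<dots> = ennreal (lam\<^sup>2)"
        using lam_nonneg by (simp add: emeasure_uniform_measure_1 power2_eq_square flip: ennreal_mult)
      finally have "(\<Sum>i. \<Sum>j. (\<integral>\<^sup>+\<omega>. indicator {c} (cell i \<omega>) * indicator {d} (cell j \<omega>) *
          of_bool (charged i j \<omega>) \<partial>M)) * ennreal (?D\<^sup>2) \<le> ennreal (lam\<^sup>2) * ennreal (?D\<^sup>2)"
        by (rule mult_right_mono) simp
      also have "\<dots> = ennreal (lam\<^sup>2 * ?D\<^sup>2)" by (simp add: ennreal_mult)
      also have "\<dots> \<le> ennreal (lam\<^sup>2 * L0\<^sup>2 * of_bool (?D \<le> L0) + \<kappa> * m * ?D powr - \<tau>)"
      proof (rule ennreal_leI)
        have "(real_of_int ?D)\<^sup>2 \<le> (real_of_int L0)\<^sup>2" using True by (intro power_mono) auto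
        then have "lam\<^sup>2 * (real_of_int ?D)\<^sup>2 \<le> lam\<^sup>2 * (real_of_int L0)\<^sup>2" by (intro mult_left_mono) auto
        moreover have "0 \<le> \<kappa> * m * ?D powr - \<tau>" using exponents by (simp add: m_def)
        ultimately show "lam\<^sup>2 * ?D\<^sup>2 \<le> lam\<^sup>2 * L0\<^sup>2 * of_bool (?D \<le> L0) + \<kappa> * m * ?D powr - \<tau>"
          using True by simp
      qed
      finally show ?thesis .
    next
      case far: False
      let ?\<psi> = "\<lambda>t. ennreal (t powr - q)"
      let ?k = "ennreal (\<kappa> * ?D powr - (\<tau> + 2))"
      have "(\<integral>\<^sup>+\<omega>. indicator {c} (cell i \<omega>) * indicator {d} (cell j \<omega>) * of_bool (charged i j \<omega>) \<partial>M) \<le>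
          ?k * (\<integral>\<^sup>+\<omega>. (indicator {c} (cell i \<omega>) * ?\<psi> (mark i \<omega>)) * (indicator {d} (cell j \<omega>) * ?\<psi> (mark j \<omega>)) \<partial>M)" for i j
      proof (cases "i = j")
        case False
        have "(\<integral>\<^sup>+\<omega>. indicator {c} (cell i \<omega>) * indicator {d} (cell j \<omega>) * of_bool (charged i j \<omega>) \<partial>M) \<le>
          (\<integral>\<^sup>+\<omega>. indicator {c} (cell i \<omega>) * indicator {d} (cell j \<omega>) *
         of_bool (edge i j \<omega> \<and> mark i \<omega> powr (- 1 / \<sigma>) < ?D \<and> mark j \<omega> powr (- 1 / \<sigma>) < ?D) \<partial>M)"
          using far by (intro nn_integral_mono) (auto simp: indicator_def charged_def)
        also have "\<dots> \<le> ?k * (\<integral>\<^sup>+\<omega>. (indicator {c} (cell i \<omega>) * ?\<psi> (mark i \<omega>)) * (indicator {d} (cell j \<omega>) * ?\<psi> (mark j \<omega>)) \<partial>M)"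
          using False far by (intro long_edge_bound) auto
        finally show ?thesis .
      qed (simp add: charged_def)
      then have "(\<Sum>i. \<Sum>j. (\<integral>\<^sup>+\<omega>. indicator {c} (cell i \<omega>) * indicator {d} (cell j \<omega>) * of_bool (charged i j \<omega>) \<partial>M)) \<le>
        (\<Sum>i. \<Sum>j. ?k * (\<integral>\<^sup>+\<omega>. (indicator {c} (cell i \<omega>) * ?\<psi> (mark i \<omega>)) * (indicator {d} (cell j \<omega>) * ?\<psi> (mark j \<omega>)) \<partial>M))"
        by (intro suminf_le) auto
      also have "\<dots> = ?k * (ennreal lam * (\<integral>\<^sup>+t. ?\<psi> t \<partial>uniform_measure lborel {0<..<1}))\<^sup>2"
        by (subst pair_moment[OF False, symmetric]) simp_all
      also have "\<dots> = ?k * ennreal m"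
        using exponents by (simp only: nn_integral_uniform_powr m)
      finally have "(\<Sum>i. \<Sum>j. (\<integral>\<^sup>+\<omega>. indicator {c} (cell i \<omega>) * indicator {d} (cell j \<omega>) *
          of_bool (charged i j \<omega>) \<partial>M)) * ennreal (?D\<^sup>2) \<le> ?k * ennreal m * ennreal (?D\<^sup>2)"
        by (rule mult_right_mono) simp
      also have "\<dots> = ennreal (\<kappa> * ?D powr - (\<tau> + 2) * m * ?D\<^sup>2)"
        using exponents by (simp add: m_def flip: ennreal_mult)
      also have "\<kappa> * ?D powr - (\<tau> + 2) * m * ?D\<^sup>2 = \<kappa> * m * ?D powr - \<tau>"
      proof -
        have D: "0 < real_of_int ?D" using far L0 by simp
        have "?D powr - (\<tau> + 2) * ?D powr 2 = ?D powr (- (\<tau> + 2) + 2)" by (rule powr_add[symmetric])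
        moreover have "real_of_int (?D\<^sup>2) = ?D powr 2" using D by simp
        ultimately have "?D powr - (\<tau> + 2) * ?D\<^sup>2 = ?D powr - \<tau>" by simp
        then show ?thesis by (simp only: mult_ac)
      qed
      finally show ?thesis using far by simp
    qed
    finally show ?thesis .
  qed
  have "(\<integral>\<^sup>+\<omega>. charge c \<omega> \<partial>M) \<le> ennreal C" for c
  proof -
    let ?g = "\<lambda>d \<omega>. \<Sum>i. \<Sum>j. indicator {c} (cell i \<omega>) * indicator {d} (cell j \<omega>) *
      of_bool (charged i j \<omega>) * ennreal ((cdist c d)\<^sup>2)"
    interpret P: pair_sigma_finite "count_space (UNIV :: (int \<times> int) set)" M
      by (intro pair_sigma_finite.intro sigma_finite_measure_count_space sigma_finite_measure_axioms)
    have "(\<integral>\<^sup>+\<omega>. charge c \<omega> \<partial>M) = (\<integral>\<^sup>+\<omega>. \<integral>\<^sup>+d. (\<lambda>(d, \<omega>). ?g d \<omega>) (d, \<omega>) \<partial>count_space UNIV \<partial>M)"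
      unfolding charge_eq by simp
    also have "\<dots> = (\<integral>\<^sup>+d. \<integral>\<^sup>+\<omega>. (\<lambda>(d, \<omega>). ?g d \<omega>) (d, \<omega>) \<partial>M \<partial>count_space UNIV)"
      by (rule P.Fubini, rule measurable_pair_measure_countable1) auto
    also have "\<dots> \<le> (\<integral>\<^sup>+d. ennreal (lam\<^sup>2 * L0\<^sup>2 * of_bool (cdist c d \<le> L0) + \<kappa> * m * cdist c d powr - \<tau>) \<partial>count_space UNIV)"
      using dbound by (intro nn_integral_mono) simp
    also have "\<dots> \<le> ennreal C" by (rule C(2))
    finally show ?thesis .
  qed
  with C(1) show thesis by (rule that)
qed

text \<open>A vertex with radius r > \<open>len m\<close> that reaches a cell at distance at most
  \<open>2 * len m\<close> from the origin lies in a cell at distance below 4 * r. Such a hub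
  exceeds the window of level \<open>m\<close>, yet it may have long edges into the support of the
  potential.\<close>

definition far_hub :: "nat \<Rightarrow> 'w \<Rightarrow> bool" where
  "far_hub m \<omega> \<longleftrightarrow> (\<exists>c. \<exists>r\<in>radii \<sigma> \<omega> c. len m < r \<and> cdist (0, 0) c / 4 < r)"

text \<open>The tail exponent is split as \<open>\<sigma> = \<tau>' + e\<close> with
  \<open>\<tau>' > 2\<close>: the first part is summable over the plane, the second leaves a
  negative power of \<open>len m\<close>.\<close>

lemma far_hub_bound:
  obtains C e :: real where "0 \<le> C" "0 < e"
    "\<And>m. {\<omega>\<in>space M. far_hub m \<omega>} \<in> sets M"
    "\<And>m. emeasure M {\<omega>\<in>space M. far_hub m \<omega>} \<le> ennreal (C * len m powr - e)"
proof -
  define e where "e = (\<sigma> - 2) / 2"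
  define \<tau>' where "\<tau>' = \<sigma> - e"
  have e: "0 < e" "2 < \<tau>'" using exponents by (auto simp: e_def \<tau>'_def field_simps)
  obtain C where C: "0 \<le> C"
    "\<And>c. (\<integral>\<^sup>+d. ennreal (lam * of_bool (cdist c d \<le> 0) + lam * 4 powr \<tau>' * cdist c d powr - \<tau>') \<partial>count_space UNIV) \<le> ennreal C"
    using radial_sum_bounded[of "lam * 4 powr \<tau>'" lam \<tau>' 0] e lam_nonneg by auto
  define A where "A m c = {\<omega>\<in>space M. \<exists>r\<in>radii \<sigma> \<omega> c. max (len m) (cdist (0, 0) c / 4) < r}" for m c
  have A: "A m c \<in> sets M"
    "emeasure M (A m c) \<le> ennreal (lam * max (len m) (cdist (0, 0) c / 4) powr - \<sigma>)" for m c
    using emeasure_witness[of \<sigma> "[(c, max (len m) (cdist (0, 0) c / 4))]"] exponents len_ge[of m]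
    by (auto simp: A_def)
  have eq: "{\<omega>\<in>space M. far_hub m \<omega>} = (\<Union>c. A m c)" for m
    by (auto simp: far_hub_def A_def)
  have bound: "lam * max (len m) (cdist (0, 0) c / 4) powr - \<sigma> \<le>
      (lam * of_bool (cdist (0, 0) c \<le> 0) + lam * 4 powr \<tau>' * cdist (0, 0) c powr - \<tau>') * len m powr - e" for m c
  proof -
    let ?x = "max (len m) (cdist (0, 0) c / 4)"
    have len: "1 \<le> real_of_int (len m)" using len_ge[of m] by simp
    have "?x powr - \<sigma> = ?x powr - \<tau>' * ?x powr - e"
      by (simp add: \<tau>'_def flip: powr_add)
    also have "\<dots> \<le> (of_bool (cdist (0, 0) c \<le> 0) + 4 powr \<tau>' * cdist (0, 0) c powr - \<tau>') * len m powr - e"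
    proof (intro mult_mono)
      show "?x powr - e \<le> len m powr - e" using e len by (intro powr_mono2') auto
      show "?x powr - \<tau>' \<le> of_bool (cdist (0, 0) c \<le> 0) + 4 powr \<tau>' * cdist (0, 0) c powr - \<tau>'"
      proof (cases "cdist (0, 0) c \<le> 0")
        case True
        have "?x powr - \<tau>' \<le> 1 powr - \<tau>'" using e len by (intro powr_mono2') auto
        then have "?x powr - \<tau>' \<le> 1" by simp
        moreover have "0 \<le> 4 powr \<tau>' * cdist (0, 0) c powr - \<tau>'" by simp
        moreover have "of_bool (cdist (0, 0) c \<le> 0) = (1 :: real)" using True by simp
        ultimately show ?thesis by linarith
      next
        case False
        then have "?x powr - \<tau>' \<le> (cdist (0, 0) c / 4) powr - \<tau>'" using e by (intro powr_mono2') auto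
        also have "\<dots> = 4 powr \<tau>' * cdist (0, 0) c powr - \<tau>'"
          by (simp add: powr_divide powr_minus field_simps)
        finally show ?thesis using False by simp
      qed
    qed auto
    finally have "lam * ?x powr - \<sigma> \<le>
        lam * ((of_bool (cdist (0, 0) c \<le> 0) + 4 powr \<tau>' * cdist (0, 0) c powr - \<tau>') * len m powr - e)"
      using lam_nonneg by (rule mult_left_mono)
    then show ?thesis by (simp add: algebra_simps)
  qed
  show thesis
  proof
    show "0 \<le> C" "0 < e" by fact+
    show "{\<omega>\<in>space M. far_hub m \<omega>} \<in> sets M" for m
      unfolding eq using A by (intro sets.countable_UN') auto
    show "emeasure M {\<omega>\<in>space M. far_hub m \<omega>} \<le> ennreal (C * len m powr - e)" for m
    proof -
      let ?h = "\<lambda>c. lam * of_bool (cdist (0, 0) c \<le> 0) + lam * 4 powr \<tau>' * cdist (0, 0) c powr - \<tau>'"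
      have h: "0 \<le> ?h c" for c using lam_nonneg by simp
      have "emeasure M {\<omega>\<in>space M. far_hub m \<omega>} \<le> (\<integral>\<^sup>+c. emeasure M (A m c) \<partial>count_space UNIV)"
        unfolding eq using A by (intro emeasure_UN_cells_le) auto
      also have "\<dots> \<le> (\<integral>\<^sup>+c. ennreal (?h c) * ennreal (len m powr - e) \<partial>count_space UNIV)"
      proof (rule nn_integral_mono)
        fix c
        have "emeasure M (A m c) \<le> ennreal (?h c * len m powr - e)"
          using A(2) bound by (meson ennreal_leI order_trans)
        then show "emeasure M (A m c) \<le> ennreal (?h c) * ennreal (len m powr - e)"
          using h by (simp add: ennreal_mult)
      qed
      also have "\<dots> = (\<integral>\<^sup>+c. ennreal (?h c) \<partial>count_space UNIV) * ennreal (len m powr - e)"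
        by (rule nn_integral_multc) simp
      also have "\<dots> \<le> ennreal C * ennreal (len m powr - e)"
        by (intro mult_right_mono C(2)) simp
      finally show ?thesis using C(1) by (simp add: ennreal_mult)
    qed
  qed
qed

text \<open>Borel-Cantelli, as the probabilities of far hubs and of the four bad boxes decay
  geometrically in \<open>m\<close>.\<close>

lemma AE_eventually_good:
  "AE \<omega> in M. eventually (\<lambda>m. \<not> far_hub m \<omega> \<and>
     (\<forall>b\<in>{-1, 0} \<times> {-1, 0}. \<not> bad m (radii \<sigma> \<omega>) b)) sequentially"
proof -
  have \<sigma>: "0 < \<sigma>" using exponents by simp
  obtain C e where C: "0 \<le> C" "0 < e"
    "\<And>m. {\<omega>\<in>space M. far_hub m \<omega>} \<in> sets M"
    "\<And>m. emeasure M {\<omega>\<in>space M. far_hub m \<omega>} \<le> ennreal (C * len m powr - e)"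
    using far_hub_bound by metis
  have "\<exists>W. W \<in> sets M \<and> emeasure M W \<le> ennreal (k0 / 16 ^ m) \<and>
      (\<forall>\<omega>\<in>space M. bad m (radii \<sigma> \<omega>) b \<longrightarrow> \<omega> \<in> W)" for m b
    using witnessed_emeasure[OF \<sigma> witnessed_bad[of m b]] by metis
  then obtain W where W: "\<And>m b. W m b \<in> sets M" "\<And>m b. emeasure M (W m b) \<le> ennreal (k0 / 16 ^ m)"
      "\<And>m b \<omega>. \<omega> \<in> space M \<Longrightarrow> bad m (radii \<sigma> \<omega>) b \<Longrightarrow> \<omega> \<in> W m b"
    by metis
  have geom: "len m powr - e \<le> (32 powr - e) ^ m" for m
  proof -
    have "(32 :: real) ^ m \<le> real_of_int L0 * real_of_int K ^ m"
      using L0 K mult_mono[of 1 "real_of_int L0" "32 ^ m" "real_of_int K ^ m"] by (simp add: power_mono)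
    also have "\<dots> \<le> len m" by (rule len_ge_power)
    finally have "len m powr - e \<le> (32 ^ m) powr - e" using C(2) by (intro powr_mono2') auto
    also have "\<dots> = (32 powr - e) ^ m" by (induction m) (auto simp: powr_mult)
    finally show ?thesis .
  qed
  have "(32 :: real) powr - e < 1 " using C(2) by (simp add: powr_less_one)
  then have sum1: "summable (\<lambda>m. C * (32 powr - e) ^ m)"
    by (intro summable_mult summable_geometric) auto
  have sum2: "summable (\<lambda>m. k0 * (1 / 16) ^ m)" by (intro summable_mult summable_geometric) simp
  have 1: "AE \<omega> in M. eventually (\<lambda>m. \<omega> \<in> space M - {\<omega>\<in>space M. far_hub m \<omega>}) sequentially"
  proof (rule borel_cantelli_AE1)
    have "measure M {\<omega>\<in>space M. far_hub m \<omega>} \<le> C * (32 powr - e) ^ m" for m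
    proof -
      have "emeasure M {\<omega>\<in>space M. far_hub m \<omega>} \<le> ennreal (C * (32 powr - e) ^ m)"
        using C(4)[of m] mult_left_mono[OF geom[of m] C(1)] by (meson ennreal_leI order_trans)
      then show ?thesis using C(1) by (simp add: emeasure_eq_measure)
    qed
    then show "summable (\<lambda>m. measure M {\<omega>\<in>space M. far_hub m \<omega>})"
      by (intro summable_comparison_test'[OF sum1]) auto
  qed (use C in \<open>auto simp: emeasure_eq_measure\<close>)
  have 2: "AE \<omega> in M. eventually (\<lambda>m. \<omega> \<in> space M - W m b) sequentially" for b
  proof (rule borel_cantelli_AE1)
    have "measure M (W m b) \<le> k0 * (1 / 16) ^ m" for m
      using W(2)[of m b] exponents by (simp add: emeasure_eq_measure power_divide)
    then show "summable (\<lambda>m. measure M (W m b))"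
      by (intro summable_comparison_test'[OF sum2]) auto
  qed (use W in \<open>auto simp: emeasure_eq_measure\<close>)
  have "AE \<omega> in M. \<forall>b\<in>{-1, 0} \<times> {-1, 0}. eventually (\<lambda>m. \<omega> \<in> space M - W m b) sequentially"
    using 2 by (simp add: AE_ball_countable)
  with 1 AE_space show ?thesis
  proof eventually_elim
    case (elim \<omega>)
    from elim(3) have "eventually (\<lambda>m. \<forall>b\<in>{-1, 0} \<times> {-1, 0}. \<omega> \<in> space M - W m b) sequentially"
      by (intro eventually_ball_finite) auto
    with elim(1) show ?case
      by eventually_elim (use W(3) elim(2) in blast)
  qed
qed

lemma AE_charge_finite: "AE \<omega> in M. \<forall>c. charge c \<omega> < \<infinity>"
proof -
  obtain C where "\<And>c. (\<integral>\<^sup>+\<omega>. charge c \<omega> \<partial>M) \<le> ennreal C" using charge_bounded by metis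
  then have "(\<integral>\<^sup>+\<omega>. charge c \<omega> \<partial>M) \<noteq> \<infinity>" for c by (metis ennreal_less_top leD infinity_ennreal_def)
  then have "AE \<omega> in M. charge c \<omega> \<noteq> \<infinity>" for c
    by (intro nn_integral_PInf_AE) auto
  then show ?thesis by (simp add: AE_all_countable less_top)
qed

lemma card_ball: "0 \<le> n \<Longrightarrow> real (card {c. cdist (0, 0) c \<le> n}) = (2 * n + 1)\<^sup>2"
proof -
  have eq: "{c. cdist (0, 0) c \<le> n} = {- n..n} \<times> {- n..n}" by (auto simp: cdist_def abs_le_iff)
  show "real (card {c. cdist (0, 0) c \<le> n}) = (2 * n + 1)\<^sup>2" if "0 \<le> n"
    unfolding eq card_cartesian_product using that by (simp add: power2_eq_square)
qed

text \<open>The expected charge of a square is at most of the order of its area, so the normalized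
  charges have a liminf of finite expectation. \<open>B\<close> depends on \<open>\<omega>\<close>,
  which is harmless: the energy criterion asks for one constant per graph.\<close>

lemma AE_frequently_charge:
  "AE \<omega> in M. \<exists>B::nat. frequently (\<lambda>m.
     (\<Sum>c | cdist (0, 0) c \<le> 2 * len m. charge c \<omega>) \<le> ennreal (B * (len m)\<^sup>2)) sequentially"
proof -
  obtain C where C: "0 \<le> C" "\<And>c. (\<integral>\<^sup>+\<omega>. charge c \<omega> \<partial>M) \<le> ennreal C" using charge_bounded by metis
  define T where "T m \<omega> = (\<Sum>c | cdist (0, 0) c \<le> 2 * len m. charge c \<omega>) * ennreal (1 / (len m)\<^sup>2)" for m \<omega>
  have [measurable]: "T m \<in> borel_measurable M" for m unfolding T_def by measurable
  \<comment> \<open>The square has \<open>(4 * len m + 1)\<^sup>2\<close> cells, at most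
    \<open>25 * (len m)\<^sup>2\<close>.\<close>
  have ET: "(\<integral>\<^sup>+\<omega>. T m \<omega> \<partial>M) \<le> ennreal (25 * C)" for m
  proof -
    have len: "1 \<le> real_of_int (len m)" using len_ge[of m] by simp
    have "(\<integral>\<^sup>+\<omega>. T m \<omega> \<partial>M) = (\<Sum>c | cdist (0, 0) c \<le> 2 * len m. \<integral>\<^sup>+\<omega>. charge c \<omega> \<partial>M) * ennreal (1 / (len m)\<^sup>2)"
      unfolding T_def by (subst nn_integral_multc) (simp_all add: nn_integral_sum)
    also have "\<dots> \<le> (\<Sum>c | cdist (0, 0) c \<le> 2 * len m. ennreal C) * ennreal (1 / (len m)\<^sup>2)"
      by (intro mult_right_mono sum_mono C(2)) simp
    also have "\<dots> = ennreal (real (card {c. cdist (0, 0) c \<le> 2 * len m}) * C * (1 / (len m)\<^sup>2))"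
      using C(1) by (simp add: ennreal_of_nat_eq_real_of_nat flip: ennreal_mult)
    also have "\<dots> \<le> ennreal (25 * C)"
    proof (rule ennreal_leI)
      have "real (card {c. cdist (0, 0) c \<le> 2 * len m}) = (4 * real_of_int (len m) + 1)\<^sup>2"
        using card_ball[of "2 * len m"] len_ge[of m] by simp
      also have "\<dots> \<le> (5 * real_of_int (len m))\<^sup>2" using len by (intro power_mono) auto
      finally have "real (card {c. cdist (0, 0) c \<le> 2 * len m}) * C \<le> 25 * (real_of_int (len m))\<^sup>2 * C"
        using C(1) by (intro mult_right_mono) (auto simp: power_mult_distrib)
      then show "real (card {c. cdist (0, 0) c \<le> 2 * len m}) * C * (1 / (len m)\<^sup>2) \<le> 25 * C"
        using len by (simp add: field_simps)
    qed
    finally show ?thesis .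
  qed
  have "(\<integral>\<^sup>+\<omega>. liminf (\<lambda>m. T m \<omega>) \<partial>M) \<le> liminf (\<lambda>m. \<integral>\<^sup>+\<omega>. T m \<omega> \<partial>M)"
    by (rule nn_integral_liminf) simp
  also have "\<dots> \<le> limsup (\<lambda>m. \<integral>\<^sup>+\<omega>. T m \<omega> \<partial>M)" by (rule Liminf_le_Limsup) simp
  also have "\<dots> \<le> ennreal (25 * C)" using ET by (intro Limsup_bounded) simp
  finally have "(\<integral>\<^sup>+\<omega>. liminf (\<lambda>m. T m \<omega>) \<partial>M) \<noteq> \<infinity>"
    by (metis ennreal_less_top leD infinity_ennreal_def)
  then have "AE \<omega> in M. liminf (\<lambda>m. T m \<omega>) \<noteq> \<infinity>" by (intro nn_integral_PInf_AE) auto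
  then show ?thesis
  proof eventually_elim
    case (elim \<omega>)
    then obtain B :: nat where B: "liminf (\<lambda>m. T m \<omega>) < of_nat B"
      using ennreal_Ex_less_of_nat by (auto simp: less_top)
    have "frequently (\<lambda>m. T m \<omega> < of_nat B) sequentially"
    proof (rule ccontr)
      assume "\<not> ?thesis"
      then have "eventually (\<lambda>m. of_nat B \<le> T m \<omega>) sequentially"
        by (simp add: frequently_def not_less)
      then have "of_nat B \<le> liminf (\<lambda>m. T m \<omega>)" by (rule Liminf_bounded)
      then show False using B by simp
    qed
    then have "frequently (\<lambda>m. (\<Sum>c | cdist (0, 0) c \<le> 2 * len m. charge c \<omega>) \<le> ennreal (B * (len m)\<^sup>2)) sequentially"
    proof (rule frequently_elim1)
      fix m assume T: "T m \<omega> < of_nat B"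
      let ?S = "\<Sum>c | cdist (0, 0) c \<le> 2 * len m. charge c \<omega>"
      have len: "1 \<le> real_of_int (len m)" using len_ge[of m] by simp
      have "?S = ?S * (ennreal (1 / (len m)\<^sup>2) * ennreal ((len m)\<^sup>2))"
        using len by (simp flip: ennreal_mult)
      also have "\<dots> = T m \<omega> * ennreal ((len m)\<^sup>2)" by (simp add: T_def mult.assoc)
      also have "\<dots> \<le> of_nat B * ennreal ((len m)\<^sup>2)" using T by (intro mult_right_mono) auto
      also have "\<dots> = ennreal (B * (len m)\<^sup>2)"
        by (simp add: ennreal_of_nat_eq_real_of_nat ennreal_mult)
      finally show "?S \<le> ennreal (B * (len m)\<^sup>2)" .
    qed
    then show ?case by blast
  qed
qed

end

section \<open>Poisson points, exponents and connection probabilities\<close>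

definition cell_of :: "real ^ 2 \<Rightarrow> int \<times> int" where
  "cell_of x = (\<lfloor>x $ 1\<rfloor>, \<lfloor>x $ 2\<rfloor>)"

definition cube :: "int \<times> int \<Rightarrow> (real ^ 2) set" where
  "cube c = {x. cell_of x = c}"

lemma sets_cube [measurable]: "cube c \<in> sets borel"
proof -
  have [measurable]: "(\<lambda>x :: real ^ 2. x $ i) \<in> borel_measurable borel" for i
    by (intro borel_measurable_continuous_onI continuous_intros)
  have "cube c = {x \<in> space borel. \<lfloor>x $ 1\<rfloor> = fst c \<and> \<lfloor>x $ 2\<rfloor> = snd c}"
    by (auto simp: cube_def cell_of_def)
  also have "\<dots> \<in> sets borel" by measurable
  finally show ?thesis .
qed

lemma measurable_cell_of [measurable]: "cell_of \<in> measurable borel (count_space UNIV)"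
proof (subst measurable_count_space_eq2_countable, safe)
  fix c
  have "cell_of -` {c} \<inter> space borel = cube c" by (auto simp: cube_def)
  then show "cell_of -` {c} \<inter> space borel \<in> sets borel" by simp
qed auto

definition corner :: "int \<times> int \<Rightarrow> real ^ 2" where
  "corner c = (\<chi> i. if i = 1 then real_of_int (fst c) else real_of_int (snd c))"

lemma cube_subset:
  "box (corner c) (corner (fst c + 1, snd c + 1)) \<subseteq> cube c"
  "cube c \<subseteq> cbox (corner c) (corner (fst c + 1, snd c + 1))"
proof -
  have in_cube: "x \<in> cube c \<longleftrightarrow> fst c \<le> x $ 1 \<and> x $ 1 < fst c + 1 \<and> snd c \<le> x $ 2 \<and> x $ 2 < snd c + 1"
    for x
    by (cases c) (auto simp: cube_def cell_of_def floor_eq_iff)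
  show "cube c \<subseteq> cbox (corner c) (corner (fst c + 1, snd c + 1))"
    by (auto simp: in_cube mem_box_cart forall_2 corner_def)
  show "box (corner c) (corner (fst c + 1, snd c + 1)) \<subseteq> cube c"
    by (auto simp: in_cube mem_box_cart forall_2 corner_def)
qed

lemma bounded_cube: "bounded (cube c)"
  using cube_subset(2) bounded_cbox bounded_subset by blast

lemma measure_cube: "measure lborel (cube c) = 1"
proof -
  let ?a = "corner c" and ?b = "corner (fst c + 1, snd c + 1)"
  have ne: "cbox ?a ?b \<noteq> {}" by (simp add: interval_ne_empty_cart corner_def)
  have 1: "measure lborel (cbox ?a ?b) = 1"
    using content_cbox_cart[OF ne] by (simp add: UNIV_2 corner_def)
  then have 2: "measure lborel (box ?a ?b) = 1"
    by (simp add: measure_lborel_box_eq measure_lborel_cbox_eq)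
  have "measure lborel (box ?a ?b) \<le> measure lborel (cube c)"
    using cube_subset emeasure_bounded_finite[OF bounded_cube[of c]]
    by (intro measure_mono_fmeasurable) (auto simp: fmeasurable_def)
  moreover have "measure lborel (cube c) \<le> measure lborel (cbox ?a ?b)"
    using cube_subset by (intro measure_mono_fmeasurable) auto
  ultimately show ?thesis using 1 2 by simp
qed

text \<open>Rounding down moves each coordinate by less than 1. For cells at distance D >= 2, the
  Euclidean distance is therefore at least D / 2.\<close>

lemma cdist_cell_of_le: "real_of_int (cdist (cell_of x) (cell_of y)) - 1 \<le> norm (x - y)"
proof -
  have "\<bar>x $ 1 - y $ 1\<bar> \<le> norm (x - y)" "\<bar>x $ 2 - y $ 2\<bar> \<le> norm (x - y)"
    using component_le_norm_cart[of "x - y" 1] component_le_norm_cart[of "x - y" 2] by simp_all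
  then show ?thesis unfolding cdist_def cell_of_def fst_conv snd_conv by linarith
qed

section \<open>Counts of Poisson points and independence\<close>

lemma nn_integral_poisson_count:
  fixes N :: "'w \<Rightarrow> nat"
  assumes "prob_space M" and [measurable]: "N \<in> measurable M (count_space UNIV)" and "0 \<le> lam"
    and P: "\<And>k. measure M {\<omega> \<in> space M. N \<omega> = k} = exp (- lam) * lam ^ k / fact k"
  shows "(\<integral>\<^sup>+\<omega>. of_nat (N \<omega>) \<partial>M) = ennreal lam"
proof -
  interpret prob_space M by fact
  have "(\<integral>\<^sup>+\<omega>. of_nat (N \<omega>) \<partial>M) = (\<integral>\<^sup>+\<omega>. (\<Sum>k. of_nat k * indicator {\<omega> \<in> space M. N \<omega> = k} \<omega>) \<partial>M)"
  proof (rule nn_integral_cong)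
    fix \<omega> assume "\<omega> \<in> space M"
    then have "(\<Sum>k. of_nat k * indicator {\<omega> \<in> space M. N \<omega> = k} \<omega>) =
        (\<Sum>k\<in>{N \<omega>}. of_nat k * indicator {\<omega> \<in> space M. N \<omega> = k} \<omega> :: ennreal)"
      by (intro suminf_finite) (auto simp: indicator_def)
    then show "of_nat (N \<omega>) = (\<Sum>k. of_nat k * indicator {\<omega> \<in> space M. N \<omega> = k} \<omega> :: ennreal)"
      using \<open>\<omega> \<in> space M\<close> by simp
  qed
  also have "\<dots> = (\<Sum>k. of_nat k * emeasure M {\<omega> \<in> space M. N \<omega> = k})"
    by (simp add: nn_integral_suminf nn_integral_cmult_indicator)
  also have "\<dots> = (\<Sum>k. ennreal (real k * (exp (- lam) * lam ^ k / fact k)))"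
    using assms(3) unfolding emeasure_eq_measure P ennreal_of_nat_eq_real_of_nat
    by (intro suminf_cong ennreal_mult[symmetric]) auto
  also have "\<dots> = ennreal lam"
  proof (rule suminf_ennreal_eq)
    have "(\<lambda>k. lam ^ k /\<^sub>R fact k) sums exp lam" by (rule exp_converges)
    then have "(\<lambda>k. (exp (- lam) * lam) * (lam ^ k /\<^sub>R fact k)) sums ((exp (- lam) * lam) * exp lam)"
      by (rule sums_mult)
    moreover have "(exp (- lam) * lam) * exp lam = lam" by (simp add: exp_minus)
    moreover have "(exp (- lam) * lam) * (lam ^ k /\<^sub>R fact k) =
        real (Suc k) * (exp (- lam) * lam ^ Suc k / fact (Suc k))" for k
      by (simp add: field_simps del: of_nat_Suc)
    ultimately have "(\<lambda>k. real (Suc k) * (exp (- lam) * lam ^ Suc k / fact (Suc k))) sums lam" by simp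
    then show "(\<lambda>k. real k * (exp (- lam) * lam ^ k / fact k)) sums lam"
      by (subst (asm) sums_Suc_iff) simp
  qed (use assms(3) in auto)
  finally show ?thesis .
qed

text \<open>Independence in \<open>poisson_point_process\<close> concerns sequences of sets, so the
  cells are enumerated by natural numbers. The bijective enumeration of the vertices turns the
  series of indicators into the number of points in a cube.\<close>

lemma poisson_cell_counts:
  fixes X :: "nat \<Rightarrow> 'w \<Rightarrow> real ^ 2"
  assumes "prob_space M" "0 \<le> lam" and V: "poisson_point_process M lam V" and X: "vertex_enumeration M V X"
    and F: "finite F"
  shows "(\<integral>\<^sup>+\<omega>. (\<Prod>c\<in>F. \<Sum>i. indicator {c} (cell_of (X i \<omega>))) \<partial>M) = ennreal lam ^ card F"
proof -
  interpret prob_space M by fact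
  let ?e = "from_nat_into (UNIV :: (int \<times> int) set)"
  let ?N = "\<lambda>c \<omega>. card (V \<omega> \<inter> cube c)"
  have bij: "bij_betw ?e UNIV UNIV" by (intro bij_betw_from_nat_into) (auto simp: finite_prod)
  have inj: "inj ?e" using bij by (simp add: bij_betw_def)
  define J where "J = ?e -` F"
  have J: "finite J" "?e ` J = F" "card J = card F"
    using F inj bij by (auto simp: J_def finite_vimageI bij_betw_def surj_image_vimage_eq card_vimage_inj)
  have [measurable]: "?N c \<in> measurable M (count_space UNIV)" for c
    using V sets_cube bounded_cube unfolding poisson_point_process_def by blast
  have EN: "(\<integral>\<^sup>+\<omega>. of_nat (?N c \<omega>) \<partial>M) = ennreal lam" for c
  proof (rule nn_integral_poisson_count)
    show "measure M {\<omega> \<in> space M. ?N c \<omega> = k} = exp (- lam) * lam ^ k / fact k" for k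
      using V sets_cube[of c] bounded_cube[of c] measure_cube[of c]
      unfolding poisson_point_process_def by simp
  qed (use assms in auto)
  have "indep_vars (\<lambda>_. count_space UNIV) (\<lambda>n \<omega>. ?N (?e n) \<omega>) UNIV"
  proof -
    have "disjoint_family (\<lambda>n. cube (?e n))"
      using inj by (auto simp: disjoint_family_on_def cube_def inj_def)
    then show ?thesis
      using V sets_cube bounded_cube unfolding poisson_point_process_def
      by (elim conjE allE[of _ "\<lambda>n. cube (?e n)"]) auto
  qed
  then have ind: "indep_vars (\<lambda>_. borel) (\<lambda>n \<omega>. of_nat (?N (?e n) \<omega>) :: ennreal) J"
    using indep_vars_subset[of _ _ UNIV J] by (intro indep_vars_compose2[where Y = "\<lambda>_. of_nat"]) auto
  have "AE \<omega> in M. (\<Prod>c\<in>F. \<Sum>i. indicator {c} (cell_of (X i \<omega>))) = (\<Prod>n\<in>J. of_nat (?N (?e n) \<omega>) :: ennreal)"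
  proof -
    have "AE \<omega> in M. bij_betw (\<lambda>n. X n \<omega>) UNIV (V \<omega>)" using X by (simp add: vertex_enumeration_def)
    moreover have "AE \<omega> in M. \<forall>B. bounded B \<longrightarrow> finite (V \<omega> \<inter> B)"
      using V by (simp add: poisson_point_process_def)
    ultimately show ?thesis
    proof eventually_elim
      case (elim \<omega>)
      have count: "(\<Sum>i. indicator {c} (cell_of (X i \<omega>))) = (of_nat (?N c \<omega>) :: ennreal)" for c
      proof -
        let ?I = "{i. cell_of (X i \<omega>) = c}"
        have b: "bij_betw (\<lambda>n. X n \<omega>) ?I (V \<omega> \<inter> cube c)"
          using elim(1) by (auto simp: bij_betw_def cube_def inj_on_def)
        have fin: "finite ?I" using b elim(2) bounded_cube[of c] bij_betw_finite by blast
        have "(\<Sum>i. indicator {c} (cell_of (X i \<omega>))) = (\<Sum>i\<in>?I. indicator {c} (cell_of (X i \<omega>)) :: ennreal)"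
          using fin by (intro suminf_finite) auto
        also have "\<dots> = of_nat (card ?I)" by simp
        finally show ?thesis using bij_betw_same_card[OF b] by simp
      qed
      show ?case unfolding count J(2)[symmetric]
        by (subst prod.reindex) (use inj in \<open>auto simp: inj_on_def\<close>)
    qed
  qed
  then have "(\<integral>\<^sup>+\<omega>. (\<Prod>c\<in>F. \<Sum>i. indicator {c} (cell_of (X i \<omega>))) \<partial>M) =
      (\<integral>\<^sup>+\<omega>. (\<Prod>n\<in>J. of_nat (?N (?e n) \<omega>)) \<partial>M)"
    by (rule nn_integral_cong_AE)
  also have "\<dots> = (\<Prod>n\<in>J. \<integral>\<^sup>+\<omega>. of_nat (?N (?e n) \<omega>) \<partial>M)"
    by (rule indep_vars_nn_integral[OF J(1) ind]) simp
  finally show ?thesis by (simp add: EN J(3))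
qed

text \<open>Preimages under \<open>f\<close> and \<open>g\<close> belong to the independent
  sigma-algebras generated by \<open>X\<close> and \<open>Y\<close>, and the values on rectangles
  determine the joint law.\<close>

lemma (in prob_space) indep_set_distr:
  assumes X: "X \<in> measurable M S" and Y: "Y \<in> measurable M T"
    and ind: "indep_set (sets (vimage_algebra (space M) X S)) (sets (vimage_algebra (space M) Y T))"
    and f: "f \<in> measurable S S'" and g: "g \<in> measurable T T'"
  shows "distr M (S' \<Otimes>\<^sub>M T') (\<lambda>\<omega>. (f (X \<omega>), g (Y \<omega>))) =
    distr M S' (\<lambda>\<omega>. f (X \<omega>)) \<Otimes>\<^sub>M distr M T' (\<lambda>\<omega>. g (Y \<omega>))"
proof (rule pair_measure_eqI[symmetric])
  have fX [measurable]: "(\<lambda>\<omega>. f (X \<omega>)) \<in> measurable M S'" by (rule measurable_compose[OF X f])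
  have gY [measurable]: "(\<lambda>\<omega>. g (Y \<omega>)) \<in> measurable M T'" by (rule measurable_compose[OF Y g])
  show "sigma_finite_measure (distr M S' (\<lambda>\<omega>. f (X \<omega>)))" "sigma_finite_measure (distr M T' (\<lambda>\<omega>. g (Y \<omega>)))"
    by (intro prob_space_imp_sigma_finite prob_space_distr fX gY)+
  fix A B assume AB: "A \<in> sets (distr M S' (\<lambda>\<omega>. f (X \<omega>)))" "B \<in> sets (distr M T' (\<lambda>\<omega>. g (Y \<omega>)))"
  then have [measurable]: "A \<in> sets S'" "B \<in> sets T'" by auto
  let ?A = "(\<lambda>\<omega>. f (X \<omega>)) -` A \<inter> space M" and ?B = "(\<lambda>\<omega>. g (Y \<omega>)) -` B \<inter> space M"
  have "?A = X -` (f -` A \<inter> space S) \<inter> space M" using measurable_space[OF X] by auto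
  then have A: "?A \<in> sets (vimage_algebra (space M) X S)"
    by (simp only: in_vimage_algebra measurable_sets[OF f \<open>A \<in> sets S'\<close>])
  have "?B = Y -` (g -` B \<inter> space T) \<inter> space M" using measurable_space[OF Y] by auto
  then have B: "?B \<in> sets (vimage_algebra (space M) Y T)"
    by (simp only: in_vimage_algebra measurable_sets[OF g \<open>B \<in> sets T'\<close>])
  have "emeasure M (?A \<inter> ?B) = emeasure M ?A * emeasure M ?B"
    using indep_setD[OF ind A B] by (simp add: emeasure_eq_measure ennreal_mult)
  moreover have "(\<lambda>\<omega>. (f (X \<omega>), g (Y \<omega>))) -` (A \<times> B) \<inter> space M = ?A \<inter> ?B" by auto
  ultimately show "emeasure (distr M S' (\<lambda>\<omega>. f (X \<omega>))) A * emeasure (distr M T' (\<lambda>\<omega>. g (Y \<omega>))) B =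
      emeasure (distr M (S' \<Otimes>\<^sub>M T') (\<lambda>\<omega>. (f (X \<omega>), g (Y \<omega>)))) (A \<times> B)"
    by (simp add: emeasure_distr)
qed simp

section \<open>Exponents and the decay of connection probabilities\<close>

text \<open>The three entries of \<open>m\<close> are lower bounds for \<theta>, and each hypothesis
  on the exponents puts one of them below \<delta> - 2; \<theta> is the midpoint. Then \<sigma> = 1
  + (\<delta> - 2) / \<theta> and \<tau> = \<delta> - \<theta> both exceed 2 and satisfy the
  identity.\<close>

lemma exponents_exist:
  fixes \<alpha> \<gamma> \<delta> :: real
  assumes "0 \<le> \<alpha>" "0 \<le> \<gamma>" "2 < \<delta>" "\<gamma> < 1 - 1 / \<delta>" "\<alpha> < 1 - \<gamma>"
  obtains \<sigma> \<tau> q \<theta> where "2 < \<sigma>" "2 < \<tau>" "q < 1" "0 \<le> \<theta>" "\<tau> + 2 = 2 * \<delta> - \<sigma> * \<theta>"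
    "\<And>s t. 0 < s \<Longrightarrow> s \<le> t \<Longrightarrow> t \<le> 1 \<Longrightarrow> s powr (\<theta> - \<gamma> * \<delta>) * t powr - (\<alpha> * \<delta>) \<le> s powr - q * t powr - q"
proof -
  define m where "m = max 0 (max (\<gamma> * \<delta> - 1) ((\<gamma> + \<alpha>) * \<delta> - 2))"
  have "\<gamma> * \<delta> < (1 - 1 / \<delta>) * \<delta>" using assms by (intro mult_strict_right_mono) auto
  then have "\<gamma> * \<delta> < \<delta> - 1" using assms by (simp add: left_diff_distrib)
  moreover have "(\<gamma> + \<alpha>) * \<delta> < 1 * \<delta>" using assms by (intro mult_strict_right_mono) auto
  ultimately have m: "0 \<le> m" "m < \<delta> - 2" using assms by (auto simp: m_def)
  define \<theta> where "\<theta> = (m + (\<delta> - 2)) / 2"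
  have \<theta>: "m < \<theta>" "\<theta> < \<delta> - 2" using m by (auto simp: \<theta>_def)
  then have \<theta>0: "0 < \<theta>" using m by simp
  \<comment> \<open>The first entry handles the smaller mark by itself; the second shares the total
    exponent equally between the two marks.\<close>
  define q where "q = max (\<gamma> * \<delta> - \<theta>) ((\<alpha> * \<delta> + (\<gamma> * \<delta> - \<theta>)) / 2)"
  have q: "q < 1" using \<theta> by (auto simp: q_def m_def distrib_right)
  have *: "s powr (\<theta> - \<gamma> * \<delta>) * t powr - (\<alpha> * \<delta>) \<le> s powr - q * t powr - q"
    if s: "0 < s" "s \<le> t" "t \<le> 1" for s t
  proof (cases "\<alpha> * \<delta> \<le> q")
    case True
    then show ?thesis using s by (intro mult_mono powr_mono') (auto simp: q_def)
  next
    case False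
    \<comment> \<open>The excess of the exponent of \<open>t\<close> over \<open>q\<close> is moved
      to the smaller mark \<open>s\<close>.\<close>
    have "t powr - (\<alpha> * \<delta>) = t powr - (\<alpha> * \<delta> - q) * t powr - q" by (simp flip: powr_add)
    also have "\<dots> \<le> s powr - (\<alpha> * \<delta> - q) * t powr - q"
      using False s by (intro mult_right_mono powr_mono2') auto
    finally have "s powr (\<theta> - \<gamma> * \<delta>) * t powr - (\<alpha> * \<delta>) \<le>
        s powr (\<theta> - \<gamma> * \<delta>) * (s powr - (\<alpha> * \<delta> - q) * t powr - q)" by (intro mult_left_mono) auto
    also have "\<dots> = s powr (\<theta> - \<gamma> * \<delta> - (\<alpha> * \<delta> - q)) * t powr - q"
      by (simp only: diff_conv_add_uminus[of "\<theta> - \<gamma> * \<delta>"] powr_add mult.assoc)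
    also have "\<dots> \<le> s powr - q * t powr - q"
    proof (intro mult_right_mono powr_mono')
      have "(\<alpha> * \<delta> + (\<gamma> * \<delta> - \<theta>)) / 2 \<le> q" by (simp add: q_def)
      then show "- q \<le> \<theta> - \<gamma> * \<delta> - (\<alpha> * \<delta> - q)" by simp
    qed (use s in auto)
    finally show ?thesis .
  qed
  show thesis
  proof
    show "2 < 1 + (\<delta> - 2) / \<theta>" using \<theta> \<theta>0 by (simp add: field_simps)
    show "2 < \<delta> - \<theta>" using \<theta> by simp
    show "\<delta> - \<theta> + 2 = 2 * \<delta> - (1 + (\<delta> - 2) / \<theta>) * \<theta>" using \<theta>0 by (simp add: field_simps)
  qed (use q \<theta>0 in \<open>auto intro: *\<close>)
qed

text \<open>The factor \<open>a powr \<theta> * D powr (\<sigma> * \<theta>)\<close> is at least 1,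
  because \<open>D\<close> exceeds the radius of the smaller mark \<open>a\<close>; it is inserted
  before \<open>pow\<close> is applied. The constant \<open>4 powr \<delta>\<close> comes from
  replacing \<open>r\<close> by \<open>D / 2\<close>.\<close>

lemma connection_bound:
  fixes \<alpha> \<gamma> \<delta> \<sigma> \<tau> q \<theta> C D :: real and \<rho> :: "real \<Rightarrow> real"
  assumes \<rho>: "\<And>x. 0 < x \<Longrightarrow> \<rho> x \<le> C * x powr - \<delta>" and C: "0 \<le> C" and \<delta>: "0 \<le> \<delta>"
    and \<sigma>: "0 < \<sigma>" and \<theta>: "0 \<le> \<theta>" and \<tau>: "\<tau> + 2 = 2 * \<delta> - \<sigma> * \<theta>"
    and pow: "\<And>s t. 0 < s \<Longrightarrow> s \<le> t \<Longrightarrow> t \<le> 1 \<Longrightarrow>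
      s powr (\<theta> - \<gamma> * \<delta>) * t powr - (\<alpha> * \<delta>) \<le> s powr - q * t powr - q"
    and s: "0 < s" "s \<le> 1" "s powr (- 1 / \<sigma>) < D" and t: "0 < t" "t \<le> 1" "t powr (- 1 / \<sigma>) < D"
    and D: "0 < D" "D / 2 \<le> r"
  shows "\<rho> (interpolation_kernel \<gamma> \<alpha> s t * r\<^sup>2) \<le>
    C * 4 powr \<delta> * D powr - (\<tau> + 2) * (s powr - q * t powr - q)"
proof -
  define a b where "a = min s t" and "b = max s t"
  have ab: "0 < a" "a \<le> b" "b \<le> 1" "a powr (- 1 / \<sigma>) < D" "s powr - q * t powr - q = a powr - q * b powr - q"
    using s t by (auto simp: a_def b_def min_def max_def mult.commute)
  have r: "0 < r" using D by simp
  have "interpolation_kernel \<gamma> \<alpha> s t * r\<^sup>2 = a powr \<gamma> * b powr \<alpha> * r powr 2"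
    using r by (simp add: interpolation_kernel_def a_def b_def)
  moreover have "\<rho> (a powr \<gamma> * b powr \<alpha> * r powr 2) \<le> C * (a powr \<gamma> * b powr \<alpha> * r powr 2) powr - \<delta>"
    using ab r by (intro \<rho>) auto
  moreover have "(a powr \<gamma> * b powr \<alpha> * r powr 2) powr - \<delta> = a powr - (\<gamma> * \<delta>) * b powr - (\<alpha> * \<delta>) * r powr - (2 * \<delta>)"
    by (simp add: powr_mult powr_powr)
  ultimately have "\<rho> (interpolation_kernel \<gamma> \<alpha> s t * r\<^sup>2) \<le>
      C * (a powr - (\<gamma> * \<delta>) * b powr - (\<alpha> * \<delta>) * r powr - (2 * \<delta>))" by simp
  also have "\<dots> \<le> C * (a powr - (\<gamma> * \<delta>) * b powr - (\<alpha> * \<delta>) * (4 powr \<delta> * D powr - (2 * \<delta>)))"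
  proof (intro mult_left_mono C)
    have "r powr - (2 * \<delta>) \<le> (D / 2) powr - (2 * \<delta>)" using D \<delta> by (intro powr_mono2') auto
    also have "\<dots> = (2 powr 2) powr \<delta> * D powr - (2 * \<delta>)"
      unfolding powr_powr by (simp add: powr_divide powr_minus field_simps)
    finally show "r powr - (2 * \<delta>) \<le> 4 powr \<delta> * D powr - (2 * \<delta>)" by simp
  qed simp
  also have "\<dots> \<le> C * (a powr - (\<gamma> * \<delta>) * b powr - (\<alpha> * \<delta>) * (4 powr \<delta> * D powr - (2 * \<delta>))) *
      (a powr \<theta> * D powr (\<sigma> * \<theta>))"
  proof -
    have "(a powr (- 1 / \<sigma>)) powr \<sigma> \<le> D powr \<sigma>" using ab \<sigma> by (intro powr_mono2) auto
    moreover have "(a powr (- 1 / \<sigma>)) powr \<sigma> = 1 / a" using ab \<sigma> by (simp add: powr_powr powr_neg_one)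
    ultimately have "1 / a \<le> D powr \<sigma>" by simp
    then have "1 \<le> a * D powr \<sigma>" using ab(1) by (simp add: field_simps)
    then have "1 powr \<theta> \<le> (a * D powr \<sigma>) powr \<theta>" using \<theta> by (intro powr_mono2) auto
    then have "1 \<le> a powr \<theta> * D powr (\<sigma> * \<theta>)" using ab by (simp add: powr_mult powr_powr)
    moreover have "0 \<le> C * (a powr - (\<gamma> * \<delta>) * b powr - (\<alpha> * \<delta>) * (4 powr \<delta> * D powr - (2 * \<delta>)))"
      using C by simp
    ultimately show ?thesis using mult_left_mono by fastforce
  qed
  also have "\<dots> = C * 4 powr \<delta> * (D powr - (2 * \<delta>) * D powr (\<sigma> * \<theta>)) *
      ((a powr \<theta> * a powr - (\<gamma> * \<delta>)) * b powr - (\<alpha> * \<delta>))" by (simp only: mult_ac)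
  also have "\<dots> = C * 4 powr \<delta> * D powr - (\<tau> + 2) * (a powr (\<theta> - \<gamma> * \<delta>) * b powr - (\<alpha> * \<delta>))"
    unfolding \<tau> by (simp flip: powr_add)
  also have "\<dots> \<le> C * 4 powr \<delta> * D powr - (\<tau> + 2) * (a powr - q * b powr - q)"
    using C pow ab by (intro mult_left_mono) auto
  finally show ?thesis unfolding ab(5) .
qed

section \<open>Recurrence at good scales\<close>

lemma finite_cdist_le: "finite {d. cdist c d \<le> n}"
proof -
  have "{d. cdist c d \<le> n} \<subseteq> {fst c - n..fst c + n} \<times> {snd c - n..snd c + n}"
    by (auto simp: cdist_def)
  then show ?thesis by (rule finite_subset) simp
qed

context cell_graph
begin

text \<open>Each pair is counted in the cell of its first index, and \<open>P\<close> fits into a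
  finite square of indices, whose sum stays below the double series.\<close>

lemma sum_charged_le:
  assumes "finite P" "finite S" and P: "\<And>i j. (i, j) \<in> P \<Longrightarrow> charged i j \<omega> \<and> cell i \<omega> \<in> S"
  shows "ennreal (\<Sum>(i, j)\<in>P. (cdist (cell i \<omega>) (cell j \<omega>))\<^sup>2) \<le> (\<Sum>c\<in>S. charge c \<omega>)"
proof -
  define t where "t c i j = indicator {c} (cell i \<omega>) * of_bool (charged i j \<omega>) *
     ennreal ((cdist (cell i \<omega>) (cell j \<omega>))\<^sup>2)" for c i j
  obtain N where N: "P \<subseteq> {..<N} \<times> {..<N}"
  proof -
    obtain n1 where "fst ` P \<subseteq> {..<n1}" using assms(1) finite_nat_bounded by blast
    moreover obtain n2 where "snd ` P \<subseteq> {..<n2}" using assms(1) finite_nat_bounded by blast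
    ultimately have "P \<subseteq> {..<max n1 n2} \<times> {..<max n1 n2}" by force
    then show thesis by (rule that)
  qed
  have "ennreal (\<Sum>(i, j)\<in>P. (cdist (cell i \<omega>) (cell j \<omega>))\<^sup>2) =
      (\<Sum>(i, j)\<in>P. ennreal ((cdist (cell i \<omega>) (cell j \<omega>))\<^sup>2))"
    by (simp add: case_prod_unfold)
  also have "\<dots> = (\<Sum>(i, j)\<in>P. \<Sum>c\<in>S. t c i j)"
  proof (intro sum.cong refl, safe)
    fix i j assume "(i, j) \<in> P"
    then have "(\<Sum>c\<in>S. t c i j) = (\<Sum>c\<in>S. if c = cell i \<omega> then ennreal ((cdist (cell i \<omega>) (cell j \<omega>))\<^sup>2) else 0)"
      using P by (intro sum.cong) (auto simp: t_def)
    then show "ennreal ((cdist (cell i \<omega>) (cell j \<omega>))\<^sup>2) = (\<Sum>c\<in>S. t c i j)"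
      using P \<open>(i, j) \<in> P\<close> assms(2) by simp
  qed
  also have "\<dots> = (\<Sum>c\<in>S. \<Sum>(i, j)\<in>P. t c i j)"
    unfolding case_prod_unfold by (rule sum.swap)
  also have "\<dots> \<le> (\<Sum>c\<in>S. charge c \<omega>)"
  proof (rule sum_mono)
    fix c
    have "(\<Sum>(i, j)\<in>P. t c i j) \<le> (\<Sum>(i, j)\<in>{..<N} \<times> {..<N}. t c i j)"
      using N by (intro sum_mono2) auto
    also have "\<dots> = (\<Sum>i<N. \<Sum>j<N. t c i j)" by (simp add: sum.cartesian_product)
    also have "\<dots> \<le> (\<Sum>i<N. \<Sum>j. t c i j)" by (intro sum_mono sum_le_suminf) auto
    also have "\<dots> \<le> (\<Sum>i. \<Sum>j. t c i j)" by (intro sum_le_suminf) auto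
    finally show "(\<Sum>(i, j)\<in>P. t c i j) \<le> charge c \<omega>" by (simp add: charge_def t_def)
  qed
  finally show ?thesis .
qed

text \<open>A charged edge joins different cells, so it adds at least 1 to the charge of its first
  cell.\<close>

lemma finite_charged:
  assumes "charge (cell i \<omega>) \<omega> < \<infinity>"
  shows "finite {j. charged i j \<omega>}"
proof (rule ccontr)
  assume inf: "infinite {j. charged i j \<omega>}"
  obtain n :: nat where n: "charge (cell i \<omega>) \<omega> < of_nat n"
    using assms ennreal_Ex_less_of_nat by auto
  obtain J where J: "J \<subseteq> {j. charged i j \<omega>}" "finite J" "card J = n"
    using infinite_arbitrarily_large[OF inf] by metis
  have "real n \<le> (\<Sum>(i, j)\<in>{i} \<times> J. real_of_int ((cdist (cell i \<omega>) (cell j \<omega>))\<^sup>2))"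
  proof -
    have "1 \<le> real_of_int ((cdist (cell i \<omega>) (cell j \<omega>))\<^sup>2)" if "j \<in> J" for j
    proof -
      have "cell i \<omega> \<noteq> cell j \<omega>" using that J by (auto simp: charged_def)
      then have "1 \<le> cdist (cell i \<omega>) (cell j \<omega>)"
        using cdist_eq_0_iff[of "cell i \<omega>" "cell j \<omega>"] cdist_nonneg[of "cell i \<omega>" "cell j \<omega>"] by linarith
      then have "1 \<le> (cdist (cell i \<omega>) (cell j \<omega>))\<^sup>2" by (simp add: one_le_power)
      then show ?thesis by (simp only: of_int_1_le_iff)
    qed
    then have "(\<Sum>j\<in>J. 1) \<le> (\<Sum>j\<in>J. real_of_int ((cdist (cell i \<omega>) (cell j \<omega>))\<^sup>2))" by (rule sum_mono)
    then show ?thesis using J by (simp add: sum.cartesian_product[symmetric])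
  qed
  then have "of_nat n \<le> ennreal (\<Sum>(i, j)\<in>{i} \<times> J. (cdist (cell i \<omega>) (cell j \<omega>))\<^sup>2)"
    unfolding ennreal_of_nat_eq_real_of_nat of_int_sum case_prod_unfold by (rule ennreal_leI)
  also have "\<dots> \<le> (\<Sum>c\<in>{cell i \<omega>}. charge c \<omega>)"
    using J by (intro sum_charged_le) auto
  finally show False using n by simp
qed

lemma far_hubI:
  fixes r :: real
  shows "r \<in> radii \<sigma> \<omega> c \<Longrightarrow> len m < r \<Longrightarrow> cdist (0, 0) c < 4 * r \<Longrightarrow> far_hub m \<omega>"
  unfolding far_hub_def by (intro exI[of _ c] bexI[of _ r] conjI) auto

text \<open>If the radius of \<open>i\<close> reached the cell of \<open>j\<close>, it would exceed
  \<open>L0\<close>; as the step is no shortcut, it would even exceed \<open>len m\<close>. A vertex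
  with such a radius that reaches, or lies in, the square of radius \<open>2 * len m\<close> is a
  far hub.\<close>

lemma radius_less:
  assumes "\<not> far_hub m \<omega>" "\<not> shortcut (radii \<sigma> \<omega>) L0 (len m) (cell i \<omega>) (cell j \<omega>)"
    and "L0 < cdist (cell i \<omega>) (cell j \<omega>)"
    and "cdist (0, 0) (cell i \<omega>) \<le> 2 * len m \<or> cdist (0, 0) (cell j \<omega>) \<le> 2 * len m"
  shows "mark i \<omega> powr (- 1 / \<sigma>) < cdist (cell i \<omega>) (cell j \<omega>)"
proof (rule ccontr)
  let ?r = "mark i \<omega> powr (- 1 / \<sigma>)"
  assume "\<not> ?thesis"
  then have D: "cdist (cell i \<omega>) (cell j \<omega>) \<le> ?r" by simp
  have r: "?r \<in> radii \<sigma> \<omega> (cell i \<omega>)" by (auto simp: radii_def)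
  have "L0 < ?r" using D assms(3) by linarith
  then have len: "len m < ?r" using assms(2) r D unfolding shortcut_def by (meson UnI1 not_le)
  have "cdist (0, 0) (cell i \<omega>) \<le> cdist (0, 0) (cell j \<omega>) + cdist (cell i \<omega>) (cell j \<omega>)"
    using cdist_triangle[of "(0, 0)" "cell i \<omega>" "cell j \<omega>"] by (simp add: cdist_commute)
  then have "real_of_int (cdist (0, 0) (cell i \<omega>)) < 4 * ?r" using assms(4) len D len_ge[of m] by linarith
  then show False using assms(1) far_hubI[OF r len] by simp
qed

text \<open>An edge along which the potential varies is no shortcut and meets the square of radius
  \<open>2 * len m\<close>; in the absence of far hubs it is charged. Its gradient is at most
  \<open>2 / len m\<close> times its length, so the energy is at most
  \<open>4 / (len m)\<^sup>2\<close> times the charge of the square, counted from either end: this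
  gives 4 * 2 * B.\<close>

lemma recurrent_if_good:
  fixes x :: "nat \<Rightarrow> 'v" and cf :: "'v \<Rightarrow> int \<times> int" and B :: nat
  assumes x: "bij_betw x UNIV V" "\<And>i. cf (x i) = cell i \<omega>" "\<And>c. finite {v \<in> V. cf v = c}"
    and E: "E \<subseteq> V \<times> V" "sym E" "\<And>i j. i \<noteq> j \<Longrightarrow> edge i j \<omega> \<longleftrightarrow> (x i, x j) \<in> E"
    and good: "eventually (\<lambda>m. \<not> far_hub m \<omega> \<and>
      (\<forall>b\<in>{-1, 0} \<times> {-1, 0}. \<not> bad m (radii \<sigma> \<omega>) b)) sequentially"
    and fin: "\<forall>c. charge c \<omega> < \<infinity>"
    and freq: "frequently (\<lambda>m. (\<Sum>c | cdist (0, 0) c \<le> 2 * len m. charge c \<omega>) \<le> ennreal (B * (len m)\<^sup>2)) sequentially"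
  shows "recurrent_component E (E\<^sup>* `` {v})"
proof (rule recurrent_component_if_bounded_energy)
  have finV: "finite {v \<in> V. cdist c (cf v) \<le> n}" for c n
  proof -
    have "{v \<in> V. cdist c (cf v) \<le> n} = (\<Union>d\<in>{d. cdist c d \<le> n}. {v \<in> V. cf v = d})" by auto
    then show ?thesis using finite_cdist_le x(3) by simp
  qed
  have large: "eventually (\<lambda>m. n < len m) sequentially" for n :: int
  proof -
    have "filterlim (\<lambda>m. 32 ^ m :: real) at_top sequentially" by real_asymp
    then have "eventually (\<lambda>m. real_of_int n < (32 :: real) ^ m) sequentially"
      unfolding filterlim_at_top_dense by blast
    then show ?thesis
    proof eventually_elim
      case (elim m)
      have "(32 :: real) ^ m \<le> real_of_int L0 * real_of_int K ^ m"
        using L0 K mult_mono[of 1 "real_of_int L0" "32 ^ m" "real_of_int K ^ m"] by (simp add: power_mono)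
      then have "real_of_int n < len m" using elim len_ge_power[of m] by linarith
      then show ?case by simp
    qed
  qed
  show "sym E" by fact
  show "finite (E `` {v})" for v
  proof (cases "v \<in> V")
    case True
    then obtain i where i: "v = x i" using x(1) by (auto simp: bij_betw_def)
    let ?c = "cell i \<omega>"
    obtain m where m: "\<not> far_hub m \<omega>" "cdist (0, 0) ?c < len m"
      using eventually_happens'[OF sequentially_bot eventually_conj[OF good large[of "cdist (0, 0) ?c"]]]
      by blast
    define n where "n = max (max L0 (len m)) \<lceil>mark i \<omega> powr (- 1 / \<sigma>)\<rceil>"
    \<comment> \<open>A neighbour beyond distance \<open>n\<close> along an edge that is not charged
      would have so large a radius that it is a far hub at level \<open>m\<close>.\<close>
    have "E `` {v} \<subseteq> {w \<in> V. cdist ?c (cf w) \<le> n} \<union> x ` {j. charged i j \<omega>}"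
    proof
      fix w assume w: "w \<in> E `` {v}"
      then have "w \<in> V" using E(1) by auto
      then obtain j where j: "w = x j" using x(1) by (auto simp: bij_betw_def)
      show "w \<in> {w \<in> V. cdist ?c (cf w) \<le> n} \<union> x ` {j. charged i j \<omega>}"
      proof (cases "charged i j \<omega>")
        case False
        let ?D = "cdist ?c (cell j \<omega>)"
        have "?D \<le> n"
        proof (rule ccontr)
          assume D: "\<not> ?D \<le> n"
          then have "i \<noteq> j" "?c \<noteq> cell j \<omega>" using L0 by (auto simp: n_def)
          moreover have "L0 < ?D" "len m < ?D" "mark i \<omega> powr (- 1 / \<sigma>) < ?D"
            using D by (auto simp: n_def) linarith
          ultimately have r: "?D \<le> mark j \<omega> powr (- 1 / \<sigma>)"
            using False E(3) w i j by (auto simp: charged_def)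
          have "cdist (0, 0) (cell j \<omega>) \<le> cdist (0, 0) ?c + ?D" by (rule cdist_triangle)
          then have "real_of_int (cdist (0, 0) (cell j \<omega>)) < 4 * mark j \<omega> powr (- 1 / \<sigma>)"
            using r m(2) \<open>len m < ?D\<close> len_ge[of m] by linarith
          moreover have "len m < mark j \<omega> powr (- 1 / \<sigma>)" using r \<open>len m < ?D\<close> by linarith
          moreover have "mark j \<omega> powr (- 1 / \<sigma>) \<in> radii \<sigma> \<omega> (cell j \<omega>)" by (auto simp: radii_def)
          ultimately show False using m(1) far_hubI by blast
        qed
        then show ?thesis using \<open>w \<in> V\<close> j x(2) by simp
      qed (use j in simp)
    qed
    then show ?thesis
      by (rule finite_subset) (intro finite_UnI finV finite_imageI finite_charged fin[rule_format])
  next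
    case False
    then have "E `` {v} = {}" using E(1) by auto
    then show ?thesis by simp
  qed
  fix S :: "'v set" assume S: "finite S"
  have "eventually (\<lambda>m. \<forall>v\<in>S. cdist (0, 0) (cf v) < len m) sequentially"
    using S large by (intro eventually_ball_finite) auto
  with good have "eventually (\<lambda>m. (\<not> far_hub m \<omega> \<and>
      (\<forall>b\<in>{-1, 0} \<times> {-1, 0}. \<not> bad m (radii \<sigma> \<omega>) b)) \<and> (\<forall>v\<in>S. cdist (0, 0) (cf v) < len m)) sequentially"
    by (rule eventually_conj)
  from frequently_ex[OF frequently_eventually_frequently[OF freq this]]
  obtain m where m: "\<not> far_hub m \<omega>" "\<And>b. b \<in> {-1, 0} \<times> {-1, 0} \<Longrightarrow> \<not> bad m (radii \<sigma> \<omega>) b"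
      "\<And>v. v \<in> S \<Longrightarrow> cdist (0, 0) (cf v) < len m"
      "(\<Sum>c | cdist (0, 0) c \<le> 2 * len m. charge c \<omega>) \<le> ennreal (B * (len m)\<^sup>2)"
    by blast
  have len: "1 \<le> real_of_int (len m)" using len_ge[of m] by simp
  have good_m: "\<not> bad m (radii \<sigma> \<omega>) b" if "fst b \<in> {-1, 0}" "snd b \<in> {-1, 0}" for b
    using m(2)[of b] that unfolding mem_Times_iff by blast
  obtain f :: "int \<times> int \<Rightarrow> real" where f:
    "\<And>c. cdist (0, 0) c < len m \<Longrightarrow> f c = 1"
    "\<And>c. 2 * len m < cdist (0, 0) c \<Longrightarrow> f c = 0"
    "\<And>c d. \<bar>f c - f d\<bar> \<le> 2 / len m * step_cost (radii \<sigma> \<omega>) L0 (len m) c d"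
    by (rule potential[of m "radii \<sigma> \<omega>"]) (erule (1) good_m, (rule that; assumption))
  \<comment> \<open>\<open>S\<close> may contain points outside \<open>V\<close>; they are isolated,
    so the value 1 there costs no energy.\<close>
  define F where "F v = (if v \<in> V then f (cf v) else of_bool (v \<in> S))" for v
  let ?L = "{c. cdist (0, 0) c \<le> 2 * len m}"
  have "finite {v. F v \<noteq> 0}"
  proof (rule finite_subset)
    show "{v. F v \<noteq> 0} \<subseteq> S \<union> {v \<in> V. cdist (0, 0) (cf v) \<le> 2 * len m}"
    proof
      fix v assume "v \<in> {v. F v \<noteq> 0}"
      then show "v \<in> S \<union> {v \<in> V. cdist (0, 0) (cf v) \<le> 2 * len m}"
        using f(2)[of "cf v"] by (cases "v \<in> V") (auto simp: F_def not_less[symmetric])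
    qed
  qed (use S finV in auto)
  moreover have "\<forall>v\<in>S. F v = 1" using f(1) m(3) by (auto simp: F_def)
  moreover have "dirichlet_le E F (8 * real B)"
    unfolding dirichlet_le_def
  proof safe
    fix P :: "('v \<times> 'v) set" assume P: "finite P" "P \<subseteq> E"
    have inj: "inj x" and surj: "x ` UNIV = V" using x(1) by (auto simp: bij_betw_def)
    let ?D = "\<lambda>i j. real_of_int ((cdist (cell i \<omega>) (cell j \<omega>))\<^sup>2)"
    define Q where "Q = {(i, j). (x i, x j) \<in> P \<and> f (cell i \<omega>) \<noteq> f (cell j \<omega>)}"
    have img: "P \<subseteq> map_prod x x ` {(i, j). (x i, x j) \<in> P}"
    proof safe
      fix v w assume "(v, w) \<in> P"
      then have "v \<in> V" "w \<in> V" using P(2) E(1) by auto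
      then obtain i j where "v = x i" "w = x j" using surj by auto
      then show "(v, w) \<in> map_prod x x ` {(i, j). (x i, x j) \<in> P}" using \<open>(v, w) \<in> P\<close> by force
    qed
    have injP: "inj_on (map_prod x x) A" for A
      using inj by (auto simp: inj_on_def)
    have eq: "P = map_prod x x ` {(i, j). (x i, x j) \<in> P}" by (intro equalityI img) auto
    have finI: "finite {(i, j). (x i, x j) \<in> P}"
      using P(1) eq injP finite_imageD by metis
    have finQ: "finite Q" by (rule finite_subset[OF _ finI]) (auto simp: Q_def)
    have F: "F (x i) = f (cell i \<omega>)" for i using surj x(2) by (auto simp: F_def)
    have Qedge: "i \<noteq> j" "edge i j \<omega>" "edge j i \<omega>" "cell i \<omega> \<noteq> cell j \<omega>"
        "\<not> shortcut (radii \<sigma> \<omega>) L0 (len m) (cell i \<omega>) (cell j \<omega>)"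
        "cdist (0, 0) (cell i \<omega>) \<le> 2 * len m \<or> cdist (0, 0) (cell j \<omega>) \<le> 2 * len m"
        "(f (cell i \<omega>) - f (cell j \<omega>))\<^sup>2 \<le> 4 / (len m)\<^sup>2 * ?D i j"
      if "(i, j) \<in> Q" for i j
    proof -
      have ne: "f (cell i \<omega>) \<noteq> f (cell j \<omega>)" using that by (simp add: Q_def)
      then show "i \<noteq> j" and cne: "cell i \<omega> \<noteq> cell j \<omega>" by auto
      have "(x i, x j) \<in> E" using that P(2) by (auto simp: Q_def)
      moreover from this have "(x j, x i) \<in> E" using E(2) by (auto simp: sym_def)
      ultimately show "edge i j \<omega>" "edge j i \<omega>" using E(3)[of i j] E(3)[of j i] \<open>i \<noteq> j\<close> by auto
      have cost: "0 < step_cost (radii \<sigma> \<omega>) L0 (len m) (cell i \<omega>) (cell j \<omega>)"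
      proof (rule ccontr)
        assume "\<not> ?thesis"
        then have "step_cost (radii \<sigma> \<omega>) L0 (len m) (cell i \<omega>) (cell j \<omega>) = 0"
          using step_cost_nonneg[of "radii \<sigma> \<omega>" L0 "len m"] by (meson antisym not_less)
        then show False using f(3)[of "cell i \<omega>" "cell j \<omega>"] ne by simp
      qed
      then show sc: "\<not> shortcut (radii \<sigma> \<omega>) L0 (len m) (cell i \<omega>) (cell j \<omega>)"
        by (auto simp: step_cost_def)
      show "cdist (0, 0) (cell i \<omega>) \<le> 2 * len m \<or> cdist (0, 0) (cell j \<omega>) \<le> 2 * len m"
        using ne f(2)[of "cell i \<omega>"] f(2)[of "cell j \<omega>"] by force
      have "\<bar>f (cell i \<omega>) - f (cell j \<omega>)\<bar> \<le> 2 / len m * cdist (cell i \<omega>) (cell j \<omega>)"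
        using f(3)[of "cell i \<omega>" "cell j \<omega>"] sc by (simp add: step_cost_def)
      then have "\<bar>f (cell i \<omega>) - f (cell j \<omega>)\<bar>\<^sup>2 \<le> (2 / len m * cdist (cell i \<omega>) (cell j \<omega>))\<^sup>2"
        by (intro power_mono) auto
      then show "(f (cell i \<omega>) - f (cell j \<omega>))\<^sup>2 \<le> 4 / (len m)\<^sup>2 * ?D i j"
        by (simp add: power_mult_distrib power_divide)
    qed
    have ch: "charged i j \<omega>" "charged j i \<omega>" if "(i, j) \<in> Q" for i j
    proof -
      note q = Qedge[OF that]
      have sc: "\<not> shortcut (radii \<sigma> \<omega>) L0 (len m) (cell j \<omega>) (cell i \<omega>)"
        using q(5) by (simp add: shortcut_def cdist_commute Un_commute)
      have "cdist (cell i \<omega>) (cell j \<omega>) \<le> L0 \<or>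
          mark i \<omega> powr (- 1 / \<sigma>) < cdist (cell i \<omega>) (cell j \<omega>) \<and>
          mark j \<omega> powr (- 1 / \<sigma>) < cdist (cell i \<omega>) (cell j \<omega>)"
        using radius_less[OF m(1) q(5)] radius_less[OF m(1) sc] q(6)
        by (auto simp: cdist_commute[of "cell j \<omega>"])
      then show "charged i j \<omega>" "charged j i \<omega>"
        using q by (auto simp: charged_def cdist_commute[of "cell j \<omega>"])
    qed
    have half: "(\<Sum>(i, j)\<in>R. ?D i j) \<le> B * (len m)\<^sup>2"
      if R: "finite R" "\<And>i j. (i, j) \<in> R \<Longrightarrow> charged i j \<omega> \<and> cell i \<omega> \<in> ?L" for R
    proof -
      have "ennreal (\<Sum>(i, j)\<in>R. (cdist (cell i \<omega>) (cell j \<omega>))\<^sup>2) \<le> (\<Sum>c\<in>?L. charge c \<omega>)"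
        using R finite_cdist_le by (intro sum_charged_le) auto
      also note m(4)
      finally have "real_of_int (\<Sum>(i, j)\<in>R. (cdist (cell i \<omega>) (cell j \<omega>))\<^sup>2) \<le> B * (len m)\<^sup>2"
        by (subst (asm) ennreal_le_iff) auto
      then show ?thesis by (simp only: of_int_sum case_prod_unfold)
    qed
    \<comment> \<open>An edge may have just one end in the square, whereas \<open>charge\<close>
      looks at the first cell: pairs whose second cell lies in the square are reversed.\<close>
    define Q1 where "Q1 = {(i, j) \<in> Q. cell i \<omega> \<in> ?L}"
    define Q2 where "Q2 = {(i, j) \<in> Q. cell j \<omega> \<in> ?L}"
    have fin12: "finite Q1" "finite Q2" by (auto intro: finite_subset[OF _ finQ] simp: Q1_def Q2_def)
    have Q12: "Q = Q1 \<union> Q2" using Qedge(6) by (auto simp: Q1_def Q2_def)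
    have Q1: "(\<Sum>(i, j)\<in>Q1. ?D i j) \<le> B * (len m)\<^sup>2"
      using fin12 ch by (intro half) (auto simp: Q1_def)
    have "(\<Sum>(i, j)\<in>prod.swap ` Q2. ?D i j) \<le> B * (len m)\<^sup>2"
      using fin12 ch by (intro half) (auto simp: Q2_def)
    then have Q2: "(\<Sum>(i, j)\<in>Q2. ?D i j) \<le> B * (len m)\<^sup>2"
      by (simp add: sum.reindex case_prod_unfold cdist_commute)
    have "(\<Sum>(v, w)\<in>P. (F v - F w)\<^sup>2) = (\<Sum>(i, j)\<in>{(i, j). (x i, x j) \<in> P}. (f (cell i \<omega>) - f (cell j \<omega>))\<^sup>2)"
      by (subst eq, subst sum.reindex[OF injP]) (simp add: case_prod_unfold F)
    also have "\<dots> = (\<Sum>(i, j)\<in>Q. (f (cell i \<omega>) - f (cell j \<omega>))\<^sup>2)"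
      using finI by (intro sum.mono_neutral_right) (auto simp: Q_def)
    also have "\<dots> \<le> (\<Sum>(i, j)\<in>Q. 4 / (len m)\<^sup>2 * ?D i j)"
      using Qedge(7) by (intro sum_mono) auto
    also have "\<dots> = 4 / (len m)\<^sup>2 * (\<Sum>(i, j)\<in>Q. ?D i j)"
      by (simp only: sum_distrib_left case_prod_unfold)
    also have "\<dots> \<le> 4 / (len m)\<^sup>2 * (B * (len m)\<^sup>2 + B * (len m)\<^sup>2)"
    proof (rule mult_left_mono)
      have "(\<Sum>(i, j)\<in>Q. ?D i j) \<le> (\<Sum>(i, j)\<in>Q1. ?D i j) + (\<Sum>(i, j)\<in>Q2. ?D i j)"
        unfolding Q12 using fin12 by (subst sum_Un) (auto intro!: sum_nonneg)
      then show "(\<Sum>(i, j)\<in>Q. ?D i j) \<le> B * (len m)\<^sup>2 + B * (len m)\<^sup>2" using Q1 Q2 by linarith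
    qed simp
    also have "\<dots> = 8 * real B" using len by (simp add: field_simps)
    finally show "(\<Sum>(v, w)\<in>P. (F v - F w)\<^sup>2) \<le> 8 * real B" .
  qed
  ultimately show "\<exists>f. finite {x. f x \<noteq> 0} \<and> (\<forall>x\<in>S. f x = 1) \<and> dirichlet_le E f (8 * real B)" by blast
qed

end

section \<open>The weight-dependent random connection model\<close>

text \<open>\<open>H\<close> depends on vertices and marks only, so the edge indicator may be
  replaced by its conditional expectation under the integral over \<open>H\<close>, and then by any
  upper bound for it.\<close>

lemma nn_integral_edge_le:
  fixes X :: "nat \<Rightarrow> 'w \<Rightarrow> 'a::euclidean_space"
  assumes "prob_space M" and X: "\<And>n. X n \<in> borel_measurable M"
    and mark: "\<And>n. (\<lambda>\<omega>. u \<omega> (X n \<omega>)) \<in> borel_measurable M"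
    and E: "independent_edges M \<rho> g X u E" and ij: "i < j"
    and H: "H \<in> sets (vertices_and_marks M X u)"
    and h: "AE \<omega> in M. \<omega> \<in> H \<longrightarrow> connection_probability \<rho> g (u \<omega>) (X i \<omega>) (X j \<omega>) \<le> h \<omega>"
  shows "(\<integral>\<^sup>+\<omega>. indicator H \<omega> * of_bool ((X i \<omega>, X j \<omega>) \<in> E \<omega>) \<partial>M) \<le>
    (\<integral>\<^sup>+\<omega>. indicator H \<omega> * ennreal (h \<omega>) \<partial>M)"
proof -
  interpret prob_space M by fact
  let ?F = "vertices_and_marks M X u"
  have sub: "subalgebra M ?F"
  proof -
    have "(\<lambda>\<omega> n. (X n \<omega>, u \<omega> (X n \<omega>))) \<in> measurable M (Pi\<^sub>M UNIV (\<lambda>_. borel))"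
      using X mark by (intro measurable_PiM_single') (auto intro: borel_measurable_Pair)
    then show ?thesis
      unfolding subalgebra_def vertices_and_marks_def
      by (intro conjI sets_image_in_sets) (auto simp: vertices_and_marks_def)
  qed
  interpret F: finite_measure_subalgebra M ?F by unfold_locales (rule sub)
  define e where "e = {\<omega> \<in> space M. (X i \<omega>, X j \<omega>) \<in> E \<omega>}"
  have e [measurable]: "e \<in> sets M" using E ij by (simp add: e_def independent_edges_def)
  have HM [measurable]: "H \<in> sets M" using H sub by (auto simp: subalgebra_def)
  have "AE \<omega> in M. real_cond_exp M ?F (indicator e) \<omega> = connection_probability \<rho> g (u \<omega>) (X i \<omega>) (X j \<omega>)"
  proof -
    \<comment> \<open>The finite-dimensional law is used for a single pair, prescribed to be an
      edge.\<close>
    have "{(i, j)} \<subseteq> {(i, j). i < j}" using ij by simp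
    then have "AE \<omega> in M. real_cond_exp M ?F
         (indicator {\<omega> \<in> space M. \<forall>(k, l)\<in>{(i, j)}. (X k \<omega>, X l \<omega>) \<in> E \<omega> \<longleftrightarrow> (k, l) \<in> {(i, j)}}) \<omega> =
       (\<Prod>(k, l)\<in>{(i, j)}. let p = connection_probability \<rho> g (u \<omega>) (X k \<omega>) (X l \<omega>)
                         in if (k, l) \<in> {(i, j)} then p else 1 - p)"
      using E unfolding independent_edges_def by (elim conjE allE[of _ "{(i, j)}"]) simp
    then show ?thesis by (simp add: e_def)
  qed
  with h have le: "AE \<omega> in M. ennreal (indicator H \<omega> * real_cond_exp M ?F (indicator e) \<omega>) \<le>
      indicator H \<omega> * ennreal (h \<omega>)"
    by eventually_elim (auto simp: indicator_def ennreal_leI)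
  have "AE \<omega> in M. 0 \<le> real_cond_exp M ?F (indicator e) \<omega>"
    by (rule F.real_cond_exp_pos) auto
  then have pos: "AE \<omega> in M. 0 \<le> indicator H \<omega> * real_cond_exp M ?F (indicator e) \<omega>"
    by eventually_elim simp
  have int: "integrable M (\<lambda>\<omega>. indicator H \<omega> * indicator e \<omega> :: real)"
    by (intro integrable_const_bound[where B = 1]) (auto simp: indicator_def)
  note ce = F.real_cond_exp_intg[OF int]
  have "(\<integral>\<^sup>+\<omega>. indicator H \<omega> * of_bool ((X i \<omega>, X j \<omega>) \<in> E \<omega>) \<partial>M) =
      (\<integral>\<^sup>+\<omega>. ennreal (indicator H \<omega> * indicator e \<omega>) \<partial>M)"
    by (intro nn_integral_cong) (auto simp: indicator_def e_def)
  also have "\<dots> = ennreal (\<integral>\<omega>. indicator H \<omega> * indicator e \<omega> \<partial>M)"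
    by (rule nn_integral_eq_integral[OF int]) (auto simp: indicator_def)
  also have "\<dots> = ennreal (\<integral>\<omega>. indicator H \<omega> * real_cond_exp M ?F (indicator e) \<omega> \<partial>M)"
    using H by (subst ce(2)) auto
  also have "\<dots> = (\<integral>\<^sup>+\<omega>. ennreal (indicator H \<omega> * real_cond_exp M ?F (indicator e) \<omega>) \<partial>M)"
    using H by (intro nn_integral_eq_integral[symmetric] ce(1) pos) auto
  also have "\<dots> \<le> (\<integral>\<^sup>+\<omega>. indicator H \<omega> * ennreal (h \<omega>) \<partial>M)"
    by (rule nn_integral_mono_AE[OF le])
  finally show ?thesis .
qed

lemma AE_mark:
  assumes "iid_uniform_marks M X u" and "(\<lambda>\<omega>. u \<omega> (X n \<omega>)) \<in> borel_measurable M"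
  shows "AE \<omega> in M. 0 < u \<omega> (X n \<omega>) \<and> u \<omega> (X n \<omega>) < 1"
proof -
  have eq: "distr M borel (\<lambda>\<omega>. u \<omega> (X n \<omega>)) = uniform_measure lborel {0<..<1}"
    using assms(1) unfolding iid_uniform_marks_def by blast
  have "AE t in distr M borel (\<lambda>\<omega>. u \<omega> (X n \<omega>)). 0 < t \<and> t < 1"
    unfolding eq by (rule AE_uniform_measureI) auto
  from AE_distrD[OF assms(2) this] show ?thesis .
qed

lemma marked_cells_wdrcm:
  fixes X :: "nat \<Rightarrow> 'w \<Rightarrow> real ^ 2"
  assumes "prob_space M" "0 \<le> lam" "poisson_point_process M lam V" "vertex_enumeration M V X"
    and marks: "iid_uniform_marks M X u"
  shows "marked_cells M lam (\<lambda>i \<omega>. cell_of (X i \<omega>)) (\<lambda>i \<omega>. u \<omega> (X i \<omega>))"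
proof -
  interpret prob_space M by fact
  have X [measurable]: "X n \<in> borel_measurable M" for n
    using assms(4) by (simp add: vertex_enumeration_def)
  have mark: "(\<lambda>\<omega>. u \<omega> (X n \<omega>)) \<in> borel_measurable M" for n
    using marks by (auto simp: iid_uniform_marks_def indep_vars_def)
  show ?thesis
  proof
    show "distr M (Pi\<^sub>M UNIV (\<lambda>_. count_space UNIV) \<Otimes>\<^sub>M Pi\<^sub>M UNIV (\<lambda>_. borel))
        (\<lambda>\<omega>. (\<lambda>i. cell_of (X i \<omega>), \<lambda>i. u \<omega> (X i \<omega>))) =
      distr M (Pi\<^sub>M UNIV (\<lambda>_. count_space UNIV)) (\<lambda>\<omega> i. cell_of (X i \<omega>)) \<Otimes>\<^sub>M
      distr M (Pi\<^sub>M UNIV (\<lambda>_. borel)) (\<lambda>\<omega> i. u \<omega> (X i \<omega>))"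
    proof (rule indep_set_distr[where f = "\<lambda>y i. cell_of (y i)" and g = "\<lambda>y. y"])
      show "(\<lambda>\<omega> n. X n \<omega>) \<in> measurable M (Pi\<^sub>M UNIV (\<lambda>_. borel))"
        by (intro measurable_PiM_single') auto
      show "(\<lambda>\<omega> n. u \<omega> (X n \<omega>)) \<in> measurable M (Pi\<^sub>M UNIV (\<lambda>_. borel))"
        using mark by (intro measurable_PiM_single') auto
      show "(\<lambda>y i. cell_of (y i)) \<in> measurable (Pi\<^sub>M UNIV (\<lambda>_. borel)) (Pi\<^sub>M UNIV (\<lambda>_. count_space UNIV))"
      proof -
        have proj: "(\<lambda>y. y i) \<in> measurable (Pi\<^sub>M UNIV (\<lambda>_. borel)) (borel :: (real ^ 2) measure)" for i :: nat
          by simp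
        have "(\<lambda>y. cell_of (y i)) \<in> measurable (Pi\<^sub>M UNIV (\<lambda>_. borel)) (count_space UNIV)" for i :: nat
          by (rule measurable_compose[OF proj measurable_cell_of])
        then show ?thesis by (intro measurable_PiM_single') auto
      qed
    qed (use marks in \<open>auto simp: iid_uniform_marks_def\<close>)
    show "indep_vars (\<lambda>_. borel) (\<lambda>i \<omega>. u \<omega> (X i \<omega>)) UNIV"
      using marks by (simp add: iid_uniform_marks_def)
    show "distr M borel (\<lambda>\<omega>. u \<omega> (X i \<omega>)) = uniform_measure lborel {0<..<1}" for i
      using marks by (simp add: iid_uniform_marks_def)
    show "(\<lambda>\<omega>. cell_of (X i \<omega>)) \<in> measurable M (count_space UNIV)" for i by measurable
  qed (use assms poisson_cell_counts in auto)
qed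

text \<open>The conditions on cells and radii form an event \<open>H\<close> of the vertices and
  marks. On \<open>H\<close>, the cell distance D >= 2 gives Euclidean distance at least D / 2, as
  \<open>connection_bound\<close> requires.\<close>

lemma planar_long_edge_bound:
  fixes X :: "nat \<Rightarrow> 'w \<Rightarrow> real ^ 2" and C \<alpha> \<gamma> \<delta> \<sigma> \<tau> q \<theta> :: real
  assumes "prob_space M" and X: "vertex_enumeration M V X" and marks: "iid_uniform_marks M X u"
    and E: "independent_edges M \<rho> (interpolation_kernel \<gamma> \<alpha>) X u E" and ij: "i < j"
    and \<rho>: "\<And>x. 0 < x \<Longrightarrow> \<rho> x \<le> C * x powr - \<delta>" and C: "0 \<le> C" and \<delta>: "0 \<le> \<delta>"
    and \<sigma>: "0 < \<sigma>" and \<theta>: "0 \<le> \<theta>" and \<tau>: "\<tau> + 2 = 2 * \<delta> - \<sigma> * \<theta>"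
    and pow: "\<And>s t. 0 < s \<Longrightarrow> s \<le> t \<Longrightarrow> t \<le> 1 \<Longrightarrow>
      s powr (\<theta> - \<gamma> * \<delta>) * t powr - (\<alpha> * \<delta>) \<le> s powr - q * t powr - q"
    and cd: "2 \<le> cdist c d"
  shows "(\<integral>\<^sup>+\<omega>. indicator {c} (cell_of (X i \<omega>)) * indicator {d} (cell_of (X j \<omega>)) *
       of_bool ((X i \<omega>, X j \<omega>) \<in> E \<omega> \<and>
         u \<omega> (X i \<omega>) powr (- 1 / \<sigma>) < cdist c d \<and> u \<omega> (X j \<omega>) powr (- 1 / \<sigma>) < cdist c d) \<partial>M)
    \<le> ennreal (C * 4 powr \<delta> * cdist c d powr - (\<tau> + 2)) *
      (\<integral>\<^sup>+\<omega>. (indicator {c} (cell_of (X i \<omega>)) * ennreal (u \<omega> (X i \<omega>) powr - q)) *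
         (indicator {d} (cell_of (X j \<omega>)) * ennreal (u \<omega> (X j \<omega>) powr - q)) \<partial>M)"
proof -
  interpret prob_space M by fact
  have Xm [measurable]: "X n \<in> borel_measurable M" for n
    using X by (simp add: vertex_enumeration_def)
  have mark [measurable]: "(\<lambda>\<omega>. u \<omega> (X n \<omega>)) \<in> borel_measurable M" for n
    using marks by (auto simp: iid_uniform_marks_def indep_vars_def)
  have [measurable]: "(\<lambda>\<omega>. indicator A (cell_of (X n \<omega>)) :: ennreal) \<in> borel_measurable M" for n A
    by (rule measurable_compose[OF measurable_compose[OF Xm measurable_cell_of]]) simp
  have [measurable]: "(\<lambda>\<omega>. ennreal (u \<omega> (X n \<omega>) powr - q)) \<in> borel_measurable M" for n
    by (rule measurable_compose[OF mark]) measurable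
  let ?F = "vertices_and_marks M X u" and ?D = "real_of_int (cdist c d)"
  have pair: "(\<lambda>\<omega>. (X n \<omega>, u \<omega> (X n \<omega>))) \<in> measurable ?F borel" for n
  proof -
    have "(\<lambda>\<omega> n. (X n \<omega>, u \<omega> (X n \<omega>))) \<in> measurable ?F (Pi\<^sub>M UNIV (\<lambda>_. borel))"
      unfolding vertices_and_marks_def by (rule measurable_vimage_algebra1) (auto simp: space_PiM)
    from measurable_compose[OF this measurable_component_singleton[of n]] show ?thesis by simp
  qed
  have [measurable]: "X n \<in> borel_measurable ?F" for n
    using measurable_compose[OF pair borel_measurable_continuous_onI[OF continuous_on_fst[OF continuous_on_id]]]
    by simp
  have [measurable]: "(\<lambda>\<omega>. u \<omega> (X n \<omega>)) \<in> borel_measurable ?F" for n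
    using measurable_compose[OF pair borel_measurable_continuous_onI[OF continuous_on_snd[OF continuous_on_id]]]
    by simp
  define H where "H = {\<omega> \<in> space ?F. cell_of (X i \<omega>) = c \<and> cell_of (X j \<omega>) = d \<and>
    u \<omega> (X i \<omega>) powr (- 1 / \<sigma>) < ?D \<and> u \<omega> (X j \<omega>) powr (- 1 / \<sigma>) < ?D}"
  define k where "k = C * 4 powr \<delta> * ?D powr - (\<tau> + 2)"
  define h where "h \<omega> = k * (u \<omega> (X i \<omega>) powr - q * u \<omega> (X j \<omega>) powr - q)" for \<omega>
  have H: "H \<in> sets ?F" unfolding H_def by measurable
  have space: "space ?F = space M" by (simp add: vertices_and_marks_def)
  have "(\<integral>\<^sup>+\<omega>. indicator {c} (cell_of (X i \<omega>)) * indicator {d} (cell_of (X j \<omega>)) *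
       of_bool ((X i \<omega>, X j \<omega>) \<in> E \<omega> \<and>
         u \<omega> (X i \<omega>) powr (- 1 / \<sigma>) < ?D \<and> u \<omega> (X j \<omega>) powr (- 1 / \<sigma>) < ?D) \<partial>M) =
      (\<integral>\<^sup>+\<omega>. indicator H \<omega> * of_bool ((X i \<omega>, X j \<omega>) \<in> E \<omega>) \<partial>M)"
    by (intro nn_integral_cong) (auto simp: H_def space indicator_def)
  also have "\<dots> \<le> (\<integral>\<^sup>+\<omega>. indicator H \<omega> * ennreal (h \<omega>) \<partial>M)"
  proof (rule nn_integral_edge_le[OF \<open>prob_space M\<close> Xm mark E ij H])
    show "AE \<omega> in M. \<omega> \<in> H \<longrightarrow>
        connection_probability \<rho> (interpolation_kernel \<gamma> \<alpha>) (u \<omega>) (X i \<omega>) (X j \<omega>) \<le> h \<omega>"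
      using AE_mark[OF marks mark, of i] AE_mark[OF marks mark, of j]
    proof eventually_elim
      case (elim \<omega>)
      show ?case
      proof
        assume \<omega>: "\<omega> \<in> H"
        then have "cdist (cell_of (X i \<omega>)) (cell_of (X j \<omega>)) = cdist c d" by (simp add: H_def)
        then have "?D / 2 \<le> norm (X i \<omega> - X j \<omega>)"
          using cdist_cell_of_le[of "X i \<omega>" "X j \<omega>"] cd by simp
        then have "\<rho> (interpolation_kernel \<gamma> \<alpha> (u \<omega> (X i \<omega>)) (u \<omega> (X j \<omega>)) * (norm (X i \<omega> - X j \<omega>))\<^sup>2) \<le> h \<omega>"
          unfolding h_def k_def using elim \<omega> cd
          by (intro connection_bound[OF \<rho> C \<delta> \<sigma> \<theta> \<tau> pow]) (auto simp: H_def)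
        then show "connection_probability \<rho> (interpolation_kernel \<gamma> \<alpha>) (u \<omega>) (X i \<omega>) (X j \<omega>) \<le> h \<omega>"
          by (simp add: connection_probability_def)
      qed
    qed
  qed
  also have "\<dots> \<le> (\<integral>\<^sup>+\<omega>. ennreal k * ((indicator {c} (cell_of (X i \<omega>)) * ennreal (u \<omega> (X i \<omega>) powr - q)) *
         (indicator {d} (cell_of (X j \<omega>)) * ennreal (u \<omega> (X j \<omega>) powr - q))) \<partial>M)"
    using C by (intro nn_integral_mono) (auto simp: H_def h_def k_def indicator_def ennreal_mult)
  also have "\<dots> = ennreal k * (\<integral>\<^sup>+\<omega>. (indicator {c} (cell_of (X i \<omega>)) * ennreal (u \<omega> (X i \<omega>) powr - q)) *
         (indicator {d} (cell_of (X j \<omega>)) * ennreal (u \<omega> (X j \<omega>) powr - q)) \<partial>M)"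
    by (rule nn_integral_cmult) measurable
  finally show ?thesis by (simp add: k_def)
qed

theorem corollary2p6:
  fixes M :: "'w measure"
    and lam \<alpha> \<gamma> \<delta> :: real
    and \<rho> :: "real \<Rightarrow> real"
    and V :: "'w \<Rightarrow> (real ^ 2) set"
    and u :: "'w \<Rightarrow> (real ^ 2) \<Rightarrow> real"
    and E :: "'w \<Rightarrow> ((real ^ 2) \<times> (real ^ 2)) set"
  assumes "lam > 0" and "\<alpha> \<ge> 0" and "\<gamma> \<ge> 0"
    and "\<forall>x>0. 0 \<le> \<rho> x \<and> \<rho> x \<le> 1"
    and "antimono_on {0<..} \<rho>"
    and "polynomial_profile \<rho> \<delta>"
    and "wdrcm M lam \<rho> (interpolation_kernel \<gamma> \<alpha>) V u E"
    and "\<delta> > 2" and "\<gamma> < 1 - 1 / \<delta>" and "\<alpha> < 1 - \<gamma>"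
  shows "AE \<omega> in M. \<forall>C \<in> connected_components (V \<omega>) (E \<omega>). recurrent_component (E \<omega>) C"
proof -
  interpret wdrcm M lam \<rho> "interpolation_kernel \<gamma> \<alpha>" V u E by fact
  obtain X where X: "vertex_enumeration M V X" and marks: "iid_uniform_marks M X u"
      and edges: "independent_edges M \<rho> (interpolation_kernel \<gamma> \<alpha>) X u E"
    using marks_and_edges by blast
  obtain C where C: "0 \<le> C" "\<And>x. 0 < x \<Longrightarrow> \<rho> x \<le> C * x powr - \<delta>"
  proof -
    obtain c C where c: "0 < c" "c \<le> C" "\<forall>x>0. \<rho> x \<le> C * min 1 (x powr - \<delta>)"
      using \<open>polynomial_profile \<rho> \<delta>\<close> unfolding polynomial_profile_def by blast
    have "\<rho> x \<le> C * x powr - \<delta>" if "0 < x" for x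
    proof -
      have "C * min 1 (x powr - \<delta>) \<le> C * x powr - \<delta>" using c by (intro mult_left_mono) auto
      then show ?thesis using c(3) that by (meson order_trans)
    qed
    then show thesis using c that[of C] by auto
  qed
  obtain \<sigma> \<tau> q \<theta> where ex: "2 < \<sigma>" "2 < \<tau>" "q < 1" "0 \<le> \<theta>" "\<tau> + 2 = 2 * \<delta> - \<sigma> * \<theta>"
    "\<And>s t. 0 < s \<Longrightarrow> s \<le> t \<Longrightarrow> t \<le> 1 \<Longrightarrow> s powr (\<theta> - \<gamma> * \<delta>) * t powr - (\<alpha> * \<delta>) \<le> s powr - q * t powr - q"
    using exponents_exist[of \<alpha> \<gamma> \<delta>] assms by metis
  obtain L0 K k0 where sc: "scales L0 K" "0 < k0"
    "\<And>m b. witnessed (\<lambda>a. lam * a powr - \<sigma>) {c. cdist (scales.box L0 K m c) b \<le> 2}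
      (k0 / 16 ^ m) (\<lambda>Rad. scales.bad L0 K m Rad b)"
    using scales_exist[of lam \<sigma>] assms ex by (metis less_imp_le)
  define cell where "cell i \<omega> = cell_of (X i \<omega>)" for i \<omega>
  define mark where "mark i \<omega> = u \<omega> (X i \<omega>)" for i \<omega>
  \<comment> \<open>Edge events are measurable, with a given conditional law, for increasing
    indices; ordering the indices makes \<open>edge\<close> symmetric by definition.\<close>
  define edge where "edge i j \<omega> \<longleftrightarrow> (X (min i j) \<omega>, X (max i j) \<omega>) \<in> E \<omega>" for i j \<omega>
  have mc: "marked_cells M lam cell mark"
    using marked_cells_wdrcm[OF prob_space_axioms _ poisson_vertices X marks] assms
    unfolding cell_def[abs_def] mark_def[abs_def] by simp
  interpret scales L0 K by fact
  have ordered: "(\<integral>\<^sup>+\<omega>. indicator {c} (cell i \<omega>) * indicator {d} (cell j \<omega>) *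
         of_bool (edge i j \<omega> \<and> mark i \<omega> powr (- 1 / \<sigma>) < cdist c d \<and> mark j \<omega> powr (- 1 / \<sigma>) < cdist c d) \<partial>M)
      \<le> ennreal (C * 4 powr \<delta> * cdist c d powr - (\<tau> + 2)) *
        (\<integral>\<^sup>+\<omega>. (indicator {c} (cell i \<omega>) * ennreal (mark i \<omega> powr - q)) *
           (indicator {d} (cell j \<omega>) * ennreal (mark j \<omega> powr - q)) \<partial>M)"
    if "i < j" "L0 < cdist c d" for i j c d
  proof -
    have "min i j = i" "max i j = j" using that(1) by auto
    \<comment> \<open>As L0 is at least 1, the cells of a long edge are at distance at least
      2.\<close>
    moreover have "2 \<le> cdist c d" using that(2) L0 by simp
    ultimately show ?thesis
      using planar_long_edge_bound[OF prob_space_axioms X marks edges that(1) C(2,1) _ _ ex(4-6), of c d] assms ex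
      unfolding cell_def mark_def edge_def by simp
  qed
  interpret cell_graph M lam cell mark L0 K edge \<sigma> \<tau> q "C * 4 powr \<delta>" k0
  proof (intro cell_graph.intro cell_graph_axioms.intro mc sc(1,3))
    show "Measurable.pred M (edge i j)" if "i \<noteq> j" for i j
    proof -
      have "min i j < max i j" using that by auto
      then have "{\<omega> \<in> space M. edge i j \<omega>} \<in> sets M"
        using edges unfolding independent_edges_def edge_def by blast
      then show ?thesis by (simp add: pred_def)
    qed
    show "(\<integral>\<^sup>+\<omega>. indicator {c} (cell i \<omega>) * indicator {d} (cell j \<omega>) *
         of_bool (edge i j \<omega> \<and> mark i \<omega> powr (- 1 / \<sigma>) < cdist c d \<and> mark j \<omega> powr (- 1 / \<sigma>) < cdist c d) \<partial>M)
      \<le> ennreal (C * 4 powr \<delta> * cdist c d powr - (\<tau> + 2)) *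
        (\<integral>\<^sup>+\<omega>. (indicator {c} (cell i \<omega>) * ennreal (mark i \<omega> powr - q)) *
           (indicator {d} (cell j \<omega>) * ennreal (mark j \<omega> powr - q)) \<partial>M)"
      if "i \<noteq> j" "L0 < cdist c d" for i j c d
    proof (cases "i < j")
      case False
      then have "j < i" using that by simp
      \<comment> \<open>Exchanging both the indices and the cells leaves the bound
        unchanged.\<close>
      from ordered[OF this, of d c] that(2) show ?thesis
        by (simp add: cdist_commute[of d] edge_def min.commute max.commute mult_ac conj_ac)
    qed (use ordered that in blast)
  qed (use ex C sc in auto)
  have "AE \<omega> in M. bij_betw (\<lambda>n. X n \<omega>) UNIV (V \<omega>)" using X by (simp add: vertex_enumeration_def)
  moreover have "AE \<omega> in M. \<forall>B. bounded B \<longrightarrow> finite (V \<omega> \<inter> B)"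
    using poisson_vertices by (simp add: poisson_point_process_def)
  ultimately show ?thesis
    using simple_graph AE_eventually_good AE_charge_finite AE_frequently_charge
  proof eventually_elim
    case (elim \<omega>)
    from elim(6) obtain B where B: "frequently (\<lambda>m.
       (\<Sum>c | cdist (0, 0) c \<le> 2 * len m. charge c \<omega>) \<le> ennreal (real_of_int (int B * (len m)\<^sup>2))) sequentially"
      by auto
    \<comment> \<open>Almost surely \<open>E\<close> is symmetric, so that ordering the indices
      changes nothing.\<close>
    have edge: "edge i j \<omega> \<longleftrightarrow> (X i \<omega>, X j \<omega>) \<in> E \<omega>" for i j
      using elim(3) by (auto simp: edge_def min_def max_def sym_def)
    have "recurrent_component (E \<omega>) ((E \<omega>)\<^sup>* `` {v})" for v
    proof (rule recurrent_if_good[where x = "\<lambda>n. X n \<omega>" and cf = cell_of])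
      show "finite {v \<in> V \<omega>. cell_of v = c}" for c
      proof -
        have "{v \<in> V \<omega>. cell_of v = c} = V \<omega> \<inter> cube c" by (auto simp: cube_def)
        then show ?thesis using elim(2) bounded_cube by simp
      qed
    qed (use elim B edge in \<open>auto simp: cell_def\<close>)
    then show ?case by (auto simp: connected_components_def quotient_def)
  qed
qed

end
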